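(* Let $N:V\to V$ be a nilpotent map of hook type and let $A$ be a standard tableau on the Young shape of $N$ with top row $n, i_{b-1},\dots,i_1$ (with the conventions $i_b=n$ and $i_0=0$). Then the component $K_A$ of the Springer fiber $\mathcal{B}_N$ is an iterated fiber bundle of base type $(B_1,\dots,B_{2b-1})$, where for $j=1,2,\dots,b-1$ $$B_{2j-1}=G_{i_j-i_{j-1}-1}\bigl(\ker N_{i_{j-1}}/\operatorname{im} N_{i_{j-1}}^{\,b(i_{j-1})-1}\bigr),\qquad B_{2j}=Fl(F_{i_j}/F_{i_{j-1}}),$$ and $B_{2b-1}$ is the full flag manifold $Fl(V/F_{i_{b-1}})$.
   Context: $V$ is an $n$-dimensional complex vector space, $Fl(U)$ is the variety of complete flags in a vector space $U$, and $G_k(U)$ is the Grassmannian of $k$-dimensional subspaces of $U$. A flag $F=(0=F_0\subset F_1\subset\dots\subset F_n=V)$, $\dim F_i=i$, is fixed by a nilpotent map $N$ if $NF_i\subseteq F_{i-1}$ for all $i\ge 1$; the Springer fiber $\mathcal{B}_N\subseteq Fl(V)$ is the variety of all flags fixed by $N$. The Young shape of $N$ has row lengths the sizes of the Jordan blocks of $N$; $b$ is its number of columns, i.e. the least positive integer with $N^b=0$. $N$ is of hook type if it has at most one Jordan block of size $>1$. A standard tableau is a filling of the $n$ boxes of the shape with $1,\dots,n$, decreasing left to right in rows and top to bottom in columns. For $F\in\mathcal{B}_N$, $N_i:V/F_i\to V/F_i$ is the map induced by $N$, and $b(i)$ is the least positive integer with $N_i^{b(i)}=0$. For a standard tableau $A$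 on the shape of $N$, let $c(i)$ be the column of $A$ containing $i$, and let $SV(A)\subseteq\mathcal{B}_N$ be the set of flags such that, for every $i=1,\dots,n$, $F_i/F_{i-1}\subseteq \ker N_{i-1}\cap\operatorname{im}N_{i-1}^{c(i)-1}$ and $F_i/F_{i-1}\not\subseteq\operatorname{im}N_{i-1}^{c(i)}$. Then $K_A$ denotes the closure $\overline{SV(A)}$, which is an irreducible component of $\mathcal{B}_N$; all components arise in this way. A space $X_1$ is an iterated fiber bundle of base type $(B_1,\dots,B_m)$ if there are spaces $X_1,B_1,X_2,B_2,\dots,X_m,B_m,X_{m+1}=\mathrm{pt}$ and maps $p_1,\dots,p_m$ such that $p_j:X_j\to B_j$ is a fiber bundle with typical fiber $X_{j+1}$. In the bases $B_{2j-1},B_{2j}$, $F$ denotes a flag of $K_A$ whose subspaces $F_1,\dots,F_{i_{j-1}}$ (and, for $B_{2j}$, also $F_{i_j}$) have been fixed at the earlier stages; the bases are understood up to isomorphism. *)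

theory Defs
  imports "HOL-Analysis.Analysis" "HOL-Algebra.AbelCoset" "Jordan_Normal_Form.VS_Connect"
begin

section \<open>Complex vector spaces, quotients and induced maps\<close>

text \<open>A complex vector space is a record V with \<open>vectorspace class_ring V\<close>, where
  \<open>class_ring\<close> is the field of all complex numbers. A subspace W, regarded as a vector space
  in its own right, is \<open>V\<lparr>carrier := W\<rparr>\<close>.\<close>

type_synonym 'v cvs = "(complex, 'v) module"

abbreviation cvs_dim :: "'v cvs \<Rightarrow> nat"
  where "cvs_dim V \<equiv> vectorspace.dim class_ring V"

abbreviation is_subspace :: "'v set \<Rightarrow> 'v cvs \<Rightarrow> bool"
  where "is_subspace W V \<equiv> VectorSpace.subspace class_ring W V"

text \<open>The elements of the quotient V/W are the cosets of W in V. The scalar multiple of a coset C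
  is written as a union of cosets because \<open>{c x | x \<in> C}\<close> is not a coset for c = 0. The record
  fields mult and one carry no meaning for vector spaces.\<close>

definition quotient_space :: "'v cvs \<Rightarrow> 'v set \<Rightarrow> 'v set cvs"
  where "quotient_space V W =
    \<lparr>carrier = a_rcosets\<^bsub>V\<^esub> W, mult = (\<lambda>_ _. W), one = W, zero = W,
     add = set_add V, smult = (\<lambda>c C. \<Union>x\<in>C. W +>\<^bsub>V\<^esub> (c \<odot>\<^bsub>V\<^esub> x))\<rparr>"

text \<open>The map V/W \<open>\<rightarrow>\<close> V/W induced by a linear N with \<open>N W \<subseteq> W\<close>: all the cosets in the union
  coincide.\<close>

definition induced_map :: "'v cvs \<Rightarrow> ('v \<Rightarrow> 'v) \<Rightarrow> 'v set \<Rightarrow> 'v set \<Rightarrow> 'v set"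
  where "induced_map V N W C = (\<Union>x\<in>C. W +>\<^bsub>V\<^esub> N x)"

definition ker :: "'v cvs \<Rightarrow> ('v \<Rightarrow> 'v) \<Rightarrow> 'v set"
  where "ker V N = {x \<in> carrier V. N x = \<zero>\<^bsub>V\<^esub>}"

definition im :: "'v cvs \<Rightarrow> ('v \<Rightarrow> 'v) \<Rightarrow> 'v set"
  where "im V N = N ` carrier V"

definition is_zero_map :: "'v cvs \<Rightarrow> ('v \<Rightarrow> 'v) \<Rightarrow> bool"
  where "is_zero_map V N \<longleftrightarrow> (\<forall>x\<in>carrier V. N x = \<zero>\<^bsub>V\<^esub>)"

definition nilpotent_map :: "'v cvs \<Rightarrow> ('v \<Rightarrow> 'v) \<Rightarrow> bool"
  where "nilpotent_map V N \<longleftrightarrow>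
    VectorSpace.linear_map class_ring V V N \<and> (\<exists>k. is_zero_map V (N ^^ k))"

definition nil_index :: "'v cvs \<Rightarrow> ('v \<Rightarrow> 'v) \<Rightarrow> nat"
  where "nil_index V N = (LEAST k. 0 < k \<and> is_zero_map V (N ^^ k))"


section \<open>Young shape and standard tableaux\<close>

text \<open>\<open>sh\<close> lists the sizes of the Jordan blocks of a nilpotent N in weakly decreasing order (the
  rows of the Young shape, from top to bottom): V has a basis consisting of the strings
  \<open>v r, N (v r), \<dots>, N\<^sup>s\<^sup>-\<^sup>1 (v r)\<close> with s the r-th entry of sh, and \<open>N\<^sup>s (v r) = 0\<close>.\<close>

definition young_shape :: "'v cvs \<Rightarrow> ('v \<Rightarrow> 'v) \<Rightarrow> nat list \<Rightarrow> bool"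
  where "young_shape V N sh \<longleftrightarrow>
    sorted_wrt (\<ge>) sh \<and> (\<forall>s\<in>set sh. 0 < s) \<and>
    (\<exists>v. (\<forall>r<length sh. v r \<in> carrier V \<and> (N ^^ (sh ! r)) (v r) = \<zero>\<^bsub>V\<^esub>) \<and>
         inj_on (\<lambda>(r, k). (N ^^ k) (v r)) (SIGMA r:{..<length sh}. {..<sh ! r}) \<and>
         vectorspace.basis class_ring V
           ((\<lambda>(r, k). (N ^^ k) (v r)) ` (SIGMA r:{..<length sh}. {..<sh ! r})))"

definition hook_shape :: "nat list \<Rightarrow> bool"
  where "hook_shape sh \<longleftrightarrow> card {r. r < length sh \<and> 1 < sh ! r} \<le> 1"

text \<open>Rows and columns of a shape are numbered from 1.\<close>

definition boxes :: "nat list \<Rightarrow> (nat \<times> nat) set"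
  where "boxes sh = {(r, c). 1 \<le> r \<and> r \<le> length sh \<and> 1 \<le> c \<and> c \<le> sh ! (r - 1)}"

definition standard_tableau :: "nat list \<Rightarrow> (nat \<times> nat \<Rightarrow> nat) \<Rightarrow> bool"
  where "standard_tableau sh A \<longleftrightarrow>
    bij_betw A (boxes sh) {1..sum_list sh} \<and>
    (\<forall>r c c'. (r, c) \<in> boxes sh \<and> (r, c') \<in> boxes sh \<and> c < c' \<longrightarrow> A (r, c') < A (r, c)) \<and>
    (\<forall>r r' c. (r, c) \<in> boxes sh \<and> (r', c) \<in> boxes sh \<and> r < r' \<longrightarrow> A (r', c) < A (r, c))"

definition column_of :: "nat list \<Rightarrow> (nat \<times> nat \<Rightarrow> nat) \<Rightarrow> nat \<Rightarrow> nat"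
  where "column_of sh A i = (THE c. \<exists>r. (r, c) \<in> boxes sh \<and> A (r, c) = i)"


section \<open>Grassmannians and flag varieties with their classical topology\<close>

text \<open>The canonical topology of a finite-dimensional complex vector space: the coarsest one that
  makes all linear functionals continuous.\<close>

definition linear_functionals :: "'v cvs \<Rightarrow> ('v \<Rightarrow> complex) set"
  where "linear_functionals V =
    {f. (\<forall>x\<in>carrier V. \<forall>y\<in>carrier V. f (x \<oplus>\<^bsub>V\<^esub> y) = f x + f y) \<and>
        (\<forall>c. \<forall>x\<in>carrier V. f (c \<odot>\<^bsub>V\<^esub> x) = c * f x)}"

definition cvs_topology :: "'v cvs \<Rightarrow> 'v topology"
  where "cvs_topology V = topology_generated_by
    {{x \<in> carrier V. f x \<in> S} | f S. f \<in> linear_functionals V \<and> open S}"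

definition quotient_topology :: "'a topology \<Rightarrow> ('a \<Rightarrow> 'b) \<Rightarrow> 'b set \<Rightarrow> 'b topology"
  where "quotient_topology X f Y =
    topology (\<lambda>S. S \<subseteq> Y \<and> openin X {x \<in> topspace X. f x \<in> S})"

lemma openin_quotient_topology:
  "openin (quotient_topology X f Y) S \<longleftrightarrow> S \<subseteq> Y \<and> openin X {x \<in> topspace X. f x \<in> S}"
proof -
  have "istopology (\<lambda>S. S \<subseteq> Y \<and> openin X {x \<in> topspace X. f x \<in> S})"
    unfolding istopology_def
  proof (intro conjI allI impI)
    fix S T
    assume S: "S \<subseteq> Y \<and> openin X {x \<in> topspace X. f x \<in> S}"
      and T: "T \<subseteq> Y \<and> openin X {x \<in> topspace X. f x \<in> T}"
    show "S \<inter> T \<subseteq> Y" using S by blast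
    have "{x \<in> topspace X. f x \<in> S \<inter> T} = {x \<in> topspace X. f x \<in> S} \<inter> {x \<in> topspace X. f x \<in> T}"
      by blast
    then show "openin X {x \<in> topspace X. f x \<in> S \<inter> T}" using S T by auto
  next
    fix \<K>
    assume K: "\<forall>S\<in>\<K>. S \<subseteq> Y \<and> openin X {x \<in> topspace X. f x \<in> S}"
    show "\<Union>\<K> \<subseteq> Y" using K by blast
    have "{x \<in> topspace X. f x \<in> \<Union>\<K>} = (\<Union>S\<in>\<K>. {x \<in> topspace X. f x \<in> S})" by blast
    then show "openin X {x \<in> topspace X. f x \<in> \<Union>\<K>}" using K by auto
  qed
  then show ?thesis by (simp add: quotient_topology_def topology_inverse')
qed

text \<open>The space of k-frames, i.e. linearly independent k-tuples of vectors, as a subspace of the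
  k-th power of V.\<close>

definition frame_space :: "'v cvs \<Rightarrow> nat \<Rightarrow> (nat \<Rightarrow> 'v) topology"
  where "frame_space V k =
    subtopology (product_topology (\<lambda>_. cvs_topology V) {..<k})
      {v. inj_on v {..<k} \<and> \<not> module.lin_dep class_ring V (v ` {..<k})}"

definition grassmannian :: "'v cvs \<Rightarrow> nat \<Rightarrow> 'v set topology"
  where "grassmannian V k =
    quotient_topology (frame_space V k) (\<lambda>v. module.span class_ring V (v ` {..<k}))
      {W. is_subspace W V \<and> cvs_dim (V\<lparr>carrier := W\<rparr>) = k}"

text \<open>A flag is a function on \<open>{0..dim V}\<close>, extended by \<open>undefined\<close> outside this range. The
  conditions on the dimensions of \<open>F 0\<close> and \<open>F (dim V)\<close> force them to be the zero space and V.\<close>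

definition flags :: "'v cvs \<Rightarrow> (nat \<Rightarrow> 'v set) set"
  where "flags V =
    {F \<in> extensional {0..cvs_dim V}.
       (\<forall>i\<le>cvs_dim V. is_subspace (F i) V \<and> cvs_dim (V\<lparr>carrier := F i\<rparr>) = i) \<and>
       (\<forall>i<cvs_dim V. F i \<subseteq> F (Suc i))}"

definition flag_variety :: "'v cvs \<Rightarrow> (nat \<Rightarrow> 'v set) topology"
  where "flag_variety V =
    subtopology (product_topology (grassmannian V) {0..cvs_dim V}) (flags V)"


section \<open>Springer fibers and their components\<close>

definition springer_fiber :: "'v cvs \<Rightarrow> ('v \<Rightarrow> 'v) \<Rightarrow> (nat \<Rightarrow> 'v set) topology"
  where "springer_fiber V N =
    subtopology (flag_variety V) {F \<in> flags V. \<forall>i\<in>{1..cvs_dim V}. N ` F i \<subseteq> F (i - 1)}"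

definition SV :: "'v cvs \<Rightarrow> ('v \<Rightarrow> 'v) \<Rightarrow> nat list \<Rightarrow> (nat \<times> nat \<Rightarrow> nat) \<Rightarrow> (nat \<Rightarrow> 'v set) set"
  where "SV V N sh A =
    {F \<in> topspace (springer_fiber V N).
       \<forall>i\<in>{1..cvs_dim V}.
         let Q = quotient_space V (F (i - 1));
             M = induced_map V N (F (i - 1));
             L = carrier (quotient_space (V\<lparr>carrier := F i\<rparr>) (F (i - 1)));
             c = column_of sh A i
         in L \<subseteq> ker Q M \<inter> im Q (M ^^ (c - 1)) \<and> \<not> L \<subseteq> im Q (M ^^ c)}"

text \<open>The closure is taken in the classical topology; as \<open>SV V N sh A\<close> is a constructible subset of
  a projective variety, it agrees with the Zariski closure.\<close>

definition component :: "'v cvs \<Rightarrow> ('v \<Rightarrow> 'v) \<Rightarrow> nat list \<Rightarrow> (nat \<times> nat \<Rightarrow> nat) \<Rightarrow>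
    (nat \<Rightarrow> 'v set) topology"
  where "component V N sh A =
    subtopology (springer_fiber V N) (springer_fiber V N closure_of SV V N sh A)"


section \<open>Iterated fiber bundles\<close>

definition fiber_bundle :: "'a topology \<Rightarrow> 'b topology \<Rightarrow> 'c topology \<Rightarrow> ('a \<Rightarrow> 'b) \<Rightarrow> bool"
  where "fiber_bundle X B Y p \<longleftrightarrow>
    continuous_map X B p \<and>
    (\<forall>y\<in>topspace B. \<exists>U h. openin B U \<and> y \<in> U \<and>
       homeomorphic_map (subtopology X {x \<in> topspace X. p x \<in> U})
         (prod_topology (subtopology B U) Y) h \<and>
       (\<forall>x\<in>topspace X. p x \<in> U \<longrightarrow> fst (h x) = p x))"

text \<open>All the spaces \<open>X 1, \<dots>, X (Suc m)\<close> live on the type of the total space \<open>X 1\<close>; this is no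
  restriction for nonempty bases, since then \<open>X (Suc j)\<close> is homeomorphic to a fiber of \<open>p j\<close>, which
  is a subspace of \<open>X j\<close>.\<close>

definition iterated_fiber_bundle :: "'a topology \<Rightarrow> nat \<Rightarrow> (nat \<Rightarrow> 'b topology) \<Rightarrow> bool"
  where "iterated_fiber_bundle X1 m B \<longleftrightarrow>
    (\<exists>X p. X 1 = X1 \<and>
       (\<forall>j\<in>{1..m}. fiber_bundle (X j) (B j) (X (Suc j)) (p j)) \<and>
       (\<exists>x::'a. topspace (X (Suc m)) = {x}))"

text \<open>The bases \<open>B (2 j - 1)\<close>, \<open>B (2 j)\<close> and \<open>B (2 b - 1)\<close> of the tower for a component, as determined
  by a flag F in that component; \<open>nil_index Q M\<close> is the least positive e with \<open>M\<^sup>e = 0\<close>.\<close>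

definition odd_base :: "'v cvs \<Rightarrow> ('v \<Rightarrow> 'v) \<Rightarrow> (nat \<Rightarrow> nat) \<Rightarrow> (nat \<Rightarrow> 'v set) \<Rightarrow> nat \<Rightarrow>
    'v set set set topology"
  where "odd_base V N i F j =
    (let Q = quotient_space V (F (i (j - 1)));
         M = induced_map V N (F (i (j - 1)))
     in grassmannian
          (quotient_space (Q\<lparr>carrier := ker Q M\<rparr>) (im Q (M ^^ (nil_index Q M - 1))))
          (i j - i (j - 1) - 1))"

definition even_base :: "'v cvs \<Rightarrow> (nat \<Rightarrow> nat) \<Rightarrow> (nat \<Rightarrow> 'v set) \<Rightarrow> nat \<Rightarrow>
    (nat \<Rightarrow> 'v set set) topology"
  where "even_base V i F j =
    flag_variety (quotient_space (V\<lparr>carrier := F (i j)\<rparr>) (F (i (j - 1))))"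

definition last_base :: "'v cvs \<Rightarrow> (nat \<Rightarrow> nat) \<Rightarrow> (nat \<Rightarrow> 'v set) \<Rightarrow> nat \<Rightarrow>
    (nat \<Rightarrow> 'v set set) topology"
  where "last_base V i F b = flag_variety (quotient_space V (F (i (b - 1))))"

end

theory Submission
  imports Defs
begin

text \<open>
  The idea of the proof. Let \<open>v\<close> generate the long Jordan string and number the adapted basis by the
  tableau: the basis vector \<open>N\<^sup>k v\<^sub>r\<close> gets the entry of the box in row r + 1 and column k + 1 as its
  index. The top row then lists the string \<open>e(i\<^sub>b) \<mapsto> e(i\<^sub>b\<^sub>-\<^sub>1) \<mapsto> \<dots> \<mapsto> e(i\<^sub>1) \<mapsto> 0\<close>, and N kills all other basis
  vectors, because in a hook all other rows have length one. Hence all the spaces that matter are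
  coordinate subspaces: for \<open>0 < j < b\<close>, \<open>im N\<^sup>b\<^sup>-\<^sup>j\<close> is spanned by the vectors with index in \<open>low j = {i\<^sub>1, \<dots>, i\<^sub>j}\<close>, and
  \<open>ker N\<^sup>j\<close> by those with index in \<open>high j\<close>, the complement of \<open>{i\<^sub>j\<^sub>+\<^sub>1, \<dots>, i\<^sub>b}\<close>. All the work is done
  with subspaces of coordinate spaces and carried back to V at the end.

  The component is the set K of all flags with \<open>im N\<^sup>b\<^sup>-\<^sup>j \<subseteq> F(i\<^sub>j) \<subseteq> ker N\<^sup>j\<close> for \<open>0 < j < b\<close>. Indeed, a
  flag in \<open>SV(A)\<close> meets \<open>im N\<close> in a new line exactly at the steps \<open>i\<^sub>1, \<dots>, i\<^sub>b\<^sub>-\<^sub>1\<close>, and the column of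
  \<open>i\<^sub>j\<close> forces this line to lie in \<open>im N\<^sup>b\<^sup>-\<^sup>j\<close>. So \<open>F(i\<^sub>j) \<inter> im N = im N\<^sup>b\<^sup>-\<^sup>j\<close>, and the condition on the
  kernel follows from \<open>N F(i\<^sub>j) \<subseteq> F(i\<^sub>j - 1)\<close>. This shows more precisely that \<open>SV(A)\<close> consists of the
  flags in K with \<open>e(i\<^sub>j) \<notin> F(i\<^sub>j - 1)\<close> for \<open>0 < j < b\<close> (\<open>springer_cell\<close> and \<open>SV_iff\<close>). The set K is
  closed (\<open>K_closed\<close>), and every flag in K is the limit for \<open>t \<rightarrow> 0\<close> of its images under suitable
  unipotent maps \<open>1 - t \<eta>\<close>, which lie in \<open>SV(A)\<close> for \<open>t \<noteq> 0\<close> (\<open>cell_dense\<close>). Thus K is the closure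
  of \<open>SV(A)\<close> (\<open>component_eq\<close>).

  Let E be the coordinate flag. The spaces of the tower are subspaces of K itself: \<open>Zs j\<close> is the set of
  flags in K that agree with E up to dimension \<open>i\<^sub>j\<close>, and \<open>Ys j\<close> the set of flags in \<open>Zs j\<close> that agree
  with E also in dimension \<open>i\<^sub>j\<^sub>+\<^sub>1\<close>, so that
  \<open>K = Zs 0 \<supseteq> Ys 0 \<supseteq> Zs 1 \<supseteq> \<dots> \<supseteq> Ys (b - 1) = Zs (b - 1) \<supseteq> Zs b = {E}\<close>. Each step is a fiber
  bundle whose typical fiber is the next space.

  On \<open>Zs j\<close> the map \<open>F \<mapsto> F(i\<^sub>j\<^sub>+\<^sub>1)\<close> takes its values in the subspaces between \<open>E(i\<^sub>j) + \<complex> e(i\<^sub>j\<^sub>+\<^sub>1)\<close> and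
  \<open>ker N\<^sup>j\<^sup>+\<^sup>1\<close>, which form the Grassmannian of the quotient of these two spaces, and its fiber over
  \<open>E(i\<^sub>j\<^sub>+\<^sub>1)\<close> is \<open>Ys j\<close>. Near any point a linear automorphism that depends continuously on the base
  point, fixes \<open>im N\<close> and \<open>E(i\<^sub>j)\<close> pointwise, and preserves all \<open>ker N\<^sup>l\<close> with \<open>l > j\<close>, moves
  \<open>E(i\<^sub>j\<^sub>+\<^sub>1)\<close> to the given subspace. It preserves the conditions that define K and therefore
  trivializes the map (\<open>odd_bundle\<close>).

  On \<open>Ys j\<close> the subspaces between \<open>E(i\<^sub>j)\<close> and \<open>E(i\<^sub>j\<^sub>+\<^sub>1)\<close> are subject to no condition and may be
  chosen independently of the others, so that \<open>Ys j\<close> is the product of the flag variety of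
  \<open>E(i\<^sub>j\<^sub>+\<^sub>1) / E(i\<^sub>j)\<close> and \<open>Zs (j + 1)\<close> (\<open>even_bundle\<close>).

  The bases of the theorem are formed from an arbitrary flag of the component instead of E. As
  the Grassmannians and the flag variety of a vector space depend up to homeomorphism only on its
  dimension, they are compared with the bases above by counting dimensions.
\<close>

section \<open>Topological preliminaries\<close>

lemma continuous_map_complex_mult:
  fixes f g :: "'a \<Rightarrow> complex"
  assumes "continuous_map X euclidean f" "continuous_map X euclidean g"
  shows "continuous_map X euclidean (\<lambda>x. f x * g x)"
  using assms by (simp add: continuous_map_atin tendsto_mult)

lemma continuous_map_complex_prod:
  fixes f :: "'a \<Rightarrow> 'b \<Rightarrow> complex"
  assumes "finite I" "\<And>i. i \<in> I \<Longrightarrow> continuous_map X euclidean (\<lambda>x. f x i)"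
  shows "continuous_map X euclidean (\<lambda>x. prod (f x) I)"
  using assms by (simp add: continuous_map_atin tendsto_prod)

lemma continuous_map_complex_divide:
  fixes f g :: "'a \<Rightarrow> complex"
  assumes "continuous_map X euclidean f" "continuous_map X euclidean g"
    and "\<And>x. x \<in> topspace X \<Longrightarrow> g x \<noteq> 0"
  shows "continuous_map X euclidean (\<lambda>x. f x / g x)"
  using assms by (simp add: continuous_map_atin tendsto_divide)

lemma openin_nonzero_set:
  fixes f :: "'a \<Rightarrow> complex"
  assumes "continuous_map X euclidean f"
  shows "openin X {x \<in> topspace X. f x \<noteq> c}"
proof -
  have "openin X {x \<in> topspace X. f x \<in> - {c}}"
    by (rule openin_continuous_map_preimage[OF assms]) (auto simp: open_openin[symmetric])
  then show ?thesis by simp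
qed

lemma continuous_map_locally:
  assumes "\<And>x. x \<in> topspace X \<Longrightarrow> \<exists>U. openin X U \<and> x \<in> U \<and> continuous_map (subtopology X U) Y f"
  shows "continuous_map X Y f"
proof -
  obtain T where T: "\<And>x. x \<in> topspace X \<Longrightarrow> openin X (T x) \<and> x \<in> T x \<and> continuous_map (subtopology X (T x)) Y f"
    using assms by metis
  show ?thesis
    by (rule pasting_lemma[where I = "topspace X" and T = T and f = "\<lambda>_. f"]) (use T in auto)
qed

lemma open_cover_closedin:
  assumes "C \<subseteq> topspace X"
    and "\<And>x. x \<in> topspace X \<Longrightarrow> x \<notin> C \<Longrightarrow> \<exists>U. openin X U \<and> x \<in> U \<and> U \<inter> C = {}"
  shows "closedin X C"
proof -
  have "openin X (topspace X - C)"
    by (subst openin_subopen) (use assms openin_subset in fastforce)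
  then show ?thesis using assms(1) by (simp add: closedin_def)
qed

text \<open>An injection into any type carries a topology along. In this way the bases of the tower, which
  live on a type of coordinate subspaces, get copies on the type that the theorem prescribes.\<close>

lemma homeomorphic_space_pushforward:
  assumes "inj_on f (topspace X)"
  shows "X homeomorphic_space (quotient_topology X f (f ` topspace X))"
proof -
  have ts: "topspace (quotient_topology X f (f ` topspace X)) = f ` topspace X"
  proof -
    have "{x \<in> topspace X. f x \<in> f ` topspace X} = topspace X" by auto
    then have "openin (quotient_topology X f (f ` topspace X)) (f ` topspace X)"
      by (simp add: openin_quotient_topology)
    then show ?thesis
      by (metis openin_quotient_topology openin_subset openin_topspace subset_antisym)
  qed
  have "homeomorphic_map X (quotient_topology X f (f ` topspace X)) f"
    unfolding homeomorphic_map_def quotient_map_def ts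
    using assms by (auto simp: openin_quotient_topology)
  then show ?thesis by (rule homeomorphic_map_imp_homeomorphic_space)
qed

lemma homeomorphic_maps_product:
  assumes "homeomorphic_maps X X' f f'" "homeomorphic_maps Y Y' g g'"
  shows "homeomorphic_maps (prod_topology X Y) (prod_topology X' Y')
    (\<lambda>(x, y). (f x, g y)) (\<lambda>(x, y). (f' x, g' y))"
  using assms by (auto simp: homeomorphic_maps_prod)

lemma homeomorphic_maps_restrict:
  assumes "homeomorphic_maps X Y f g" "f ` (topspace X \<inter> S) = topspace Y \<inter> T"
  shows "homeomorphic_maps (subtopology X S) (subtopology Y T) f g"
  using assms by (simp add: homeomorphic_maps_subtopologies)

lemma fiber_bundleI:
  assumes "continuous_map X B p"
    and "\<And>y. y \<in> topspace B \<Longrightarrow> \<exists>U h h'. openin B U \<and> y \<in> U \<and>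
      homeomorphic_maps (subtopology X {x \<in> topspace X. p x \<in> U})
        (prod_topology (subtopology B U) Y) h h' \<and>
      (\<forall>x\<in>topspace X. p x \<in> U \<longrightarrow> fst (h x) = p x)"
  shows "fiber_bundle X B Y p"
  unfolding fiber_bundle_def using assms by (meson homeomorphic_map_maps)

lemma fiber_bundle_homeomorphic:
  assumes fb: "fiber_bundle X B Y p"
    and f: "homeomorphic_maps X' X f f'" and g: "homeomorphic_maps B B' g g'"
    and k: "homeomorphic_maps Y Y' k k'"
  shows "fiber_bundle X' B' Y' (g \<circ> p \<circ> f)"
proof (rule fiber_bundleI)
  have cp: "continuous_map X B p" using fb by (simp add: fiber_bundle_def)
  show "continuous_map X' B' (g \<circ> p \<circ> f)"
    using cp f g by (auto simp: homeomorphic_maps_def intro!: continuous_map_compose)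
  fix y assume y: "y \<in> topspace B'"
  have "g' y \<in> topspace B" using g y by (auto simp: homeomorphic_maps_def continuous_map_def)
  then obtain U h where U: "openin B U" "g' y \<in> U"
      and h: "homeomorphic_map (subtopology X {x \<in> topspace X. p x \<in> U}) (prod_topology (subtopology B U) Y) h"
      and hp: "\<forall>x\<in>topspace X. p x \<in> U \<longrightarrow> fst (h x) = p x"
    using fb unfolding fiber_bundle_def by meson
  obtain h' where hh': "homeomorphic_maps (subtopology X {x \<in> topspace X. p x \<in> U})
      (prod_topology (subtopology B U) Y) h h'"
    using h homeomorphic_map_maps by blast
  have Usub: "U \<subseteq> topspace B" using U(1) by (rule openin_subset)
  have gU: "openin B' (g ` U)"
    using g U(1) Usub by (meson homeomorphic_map_maps homeomorphic_map_openness)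
  have fX: "f x \<in> topspace X" if "x \<in> topspace X'" for x
    using f that by (auto simp: homeomorphic_maps_def continuous_map_def)
  have pB: "p x \<in> topspace B" if "x \<in> topspace X" for x
    using cp that by (auto simp: continuous_map_def)
  have f'X: "f' x \<in> topspace X'" "f (f' x) = x" if "x \<in> topspace X" for x
    using f that by (auto simp: homeomorphic_maps_def continuous_map_def)
  have inj: "g a = g b \<longleftrightarrow> a = b" if "a \<in> topspace B" "b \<in> topspace B" for a b
    using g that by (metis homeomorphic_maps_def)
  have iff: "g (p (f x)) \<in> g ` U \<longleftrightarrow> p (f x) \<in> U" if "x \<in> topspace X'" for x
    using inj Usub fX[OF that] pB by blast
  have 1: "homeomorphic_maps (subtopology X' {x \<in> topspace X'. (g \<circ> p \<circ> f) x \<in> g ` U})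
      (subtopology X {x \<in> topspace X. p x \<in> U}) f f'"
  proof (rule homeomorphic_maps_restrict[OF f])
    show "f ` (topspace X' \<inter> {x \<in> topspace X'. (g \<circ> p \<circ> f) x \<in> g ` U}) =
        topspace X \<inter> {x \<in> topspace X. p x \<in> U}"
    proof (intro equalityI subsetI)
      fix x assume "x \<in> f ` (topspace X' \<inter> {x \<in> topspace X'. (g \<circ> p \<circ> f) x \<in> g ` U})"
      then show "x \<in> topspace X \<inter> {x \<in> topspace X. p x \<in> U}"
        using iff fX by auto
    next
      fix x assume x: "x \<in> topspace X \<inter> {x \<in> topspace X. p x \<in> U}"
      then have "f' x \<in> topspace X'" "f (f' x) = x" using f'X by auto
      then show "x \<in> f ` (topspace X' \<inter> {x \<in> topspace X'. (g \<circ> p \<circ> f) x \<in> g ` U})"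
        using x by (intro image_eqI[of _ _ "f' x"]) auto
    qed
  qed
  have g2: "homeomorphic_maps (subtopology B U) (subtopology B' (g ` U)) g g'"
    by (rule homeomorphic_maps_restrict[OF g]) (use Usub openin_subset[OF gU] in auto)
  let ?h = "(\<lambda>(x, y). (g x, k y)) \<circ> (h \<circ> f)"
  let ?h' = "(f' \<circ> h') \<circ> (\<lambda>(x, y). (g' x, k' y))"
  have "homeomorphic_maps (subtopology X' {x \<in> topspace X'. (g \<circ> p \<circ> f) x \<in> g ` U})
      (prod_topology (subtopology B' (g ` U)) Y') ?h ?h'"
    using homeomorphic_maps_compose[OF conjI[OF homeomorphic_maps_compose[OF conjI[OF 1 hh']]
          homeomorphic_maps_product[OF g2 k]]] .
  moreover have "fst (?h x) = (g \<circ> p \<circ> f) x" if "x \<in> topspace X'" "(g \<circ> p \<circ> f) x \<in> g ` U" for x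
    using hp fX[OF that(1)] iff[OF that(1)] that(2) by (auto simp: case_prod_unfold)
  moreover have "y \<in> g ` U"
    using U(2) y g by (auto simp: homeomorphic_maps_def intro!: image_eqI[of _ _ "g' y"])
  ultimately show "\<exists>U h h'. openin B' U \<and> y \<in> U \<and>
      homeomorphic_maps (subtopology X' {x \<in> topspace X'. (g \<circ> p \<circ> f) x \<in> U})
        (prod_topology (subtopology B' U) Y') h h' \<and>
      (\<forall>x\<in>topspace X'. (g \<circ> p \<circ> f) x \<in> U \<longrightarrow> fst (h x) = (g \<circ> p \<circ> f) x)"
    using gU by blast
qed

section \<open>Continuity of matrix inversion\<close>

lemma continuous_map_det:
  fixes f :: "'z \<Rightarrow> nat \<Rightarrow> nat \<Rightarrow> complex"
  assumes "\<And>m l. m < k \<Longrightarrow> l < k \<Longrightarrow> continuous_map Z euclidean (\<lambda>z. f z m l)"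
  shows "continuous_map Z euclidean (\<lambda>z. det (mat k k (\<lambda>(m, l). f z m l)))"
proof -
  have "det (mat k k (\<lambda>(m, l). f z m l)) =
      (\<Sum>p | p permutes {0..<k}. signof p * (\<Prod>i = 0..<k. f z i (p i)))" for z
    by (subst det_def'[of _ k]) (auto intro!: sum.cong prod.cong simp: permutes_in_image)
  moreover have "continuous_map Z euclidean
      (\<lambda>z. \<Sum>p | p permutes {0..<k}. signof p * (\<Prod>i = 0..<k. f z i (p i)))"
    using assms
    by (intro continuous_map_sum continuous_map_complex_mult continuous_map_complex_prod
        finite_permutations) (auto simp: permutes_in_image)
  ultimately show ?thesis by simp
qed

lemma continuous_map_adj_mat:
  fixes f :: "'z \<Rightarrow> nat \<Rightarrow> nat \<Rightarrow> complex"
  assumes f: "\<And>m l. m < k \<Longrightarrow> l < k \<Longrightarrow> continuous_map Z euclidean (\<lambda>z. f z m l)"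
    and "i < k" "j < k"
  shows "continuous_map Z euclidean (\<lambda>z. adj_mat (mat k k (\<lambda>(m, l). f z m l)) $$ (i, j))"
proof -
  let ?g = "\<lambda>z m l. f z (if m < j then m else Suc m) (if l < i then l else Suc l)"
  have "mat_delete (mat k k (\<lambda>(m, l). f z m l)) j i = mat (k - 1) (k - 1) (\<lambda>(m, l). ?g z m l)" for z
    using assms by (auto simp: mat_delete_def intro!: eq_matI)
  then have "adj_mat (mat k k (\<lambda>(m, l). f z m l)) $$ (i, j) =
      (-1) ^ (j + i) * det (mat (k - 1) (k - 1) (\<lambda>(m, l). ?g z m l))" for z
    using assms by (simp add: adj_mat_def cofactor_def)
  moreover have "continuous_map Z euclidean (\<lambda>z. (-1) ^ (j + i) * det (mat (k - 1) (k - 1) (\<lambda>(m, l). ?g z m l)))"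
    by (intro continuous_map_complex_mult continuous_map_det f) (use assms in auto)
  ultimately show ?thesis by simp
qed

text \<open>Since \<open>adj A / det A\<close> is a formula for the inverse, a square matrix that depends continuously on
  a parameter is invertible on an open set and its inverse is continuous there. Invertibility is
  expressed by a left inverse because linear combinations produce it in this form.\<close>

lemma continuous_left_inverse:
  fixes f :: "'z \<Rightarrow> nat \<Rightarrow> nat \<Rightarrow> complex"
  assumes f: "\<And>m l. m < k \<Longrightarrow> l < k \<Longrightarrow> continuous_map Z euclidean (\<lambda>z. f z m l)"
  defines "D \<equiv> {z \<in> topspace Z. \<exists>c. \<forall>l<k. \<forall>l'<k. (\<Sum>m<k. c l m * f z m l') = (if l = l' then 1 else 0)}"
  obtains c where "openin Z D"
    and "\<And>l m. l < k \<Longrightarrow> m < k \<Longrightarrow> continuous_map (subtopology Z D) euclidean (\<lambda>z. c z l m)"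
    and "\<And>z l l'. z \<in> D \<Longrightarrow> l < k \<Longrightarrow> l' < k \<Longrightarrow> (\<Sum>m<k. c z l m * f z m l') = (if l = l' then 1 else (0::complex))"
proof -
  let ?A = "\<lambda>z. mat k k (\<lambda>(m, l). f z m l)"
  let ?c = "\<lambda>z l m. adj_mat (?A z) $$ (l, m) / det (?A z)"
  have A: "?A z \<in> carrier_mat k k" for z by simp
  have mult: "(\<Sum>m<k. C $$ (l, m) * f z m l') = (C * ?A z) $$ (l, l')"
    if "C \<in> carrier_mat k k" "l < k" "l' < k" for C z l l'
    using that by (simp add: scalar_prod_def atLeast0LessThan)
  have inv: "(\<Sum>m<k. ?c z l m * f z m l') = (if l = l' then 1 else 0)"
    if "det (?A z) \<noteq> 0" "l < k" "l' < k" for z l l'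
  proof -
    have "(\<Sum>m<k. ?c z l m * f z m l') = (\<Sum>m<k. adj_mat (?A z) $$ (l, m) * f z m l') / det (?A z)"
      by (simp add: sum_divide_distrib)
    also have "\<dots> = (det (?A z) \<cdot>\<^sub>m 1\<^sub>m k) $$ (l, l') / det (?A z)"
      using mult[OF adj_mat(1)[OF A] that(2,3)] adj_mat(3)[OF A] by metis
    finally show ?thesis using that by simp
  qed
  have D: "D = {z \<in> topspace Z. det (?A z) \<noteq> 0}"
  proof (intro equalityI subsetI)
    fix z assume "z \<in> D"
    then obtain c where z: "z \<in> topspace Z"
      and c: "\<And>l l'. l < k \<Longrightarrow> l' < k \<Longrightarrow> (\<Sum>m<k. c l m * f z m l') = (if l = l' then 1 else 0)"
      unfolding D_def by blast
    let ?C = "mat k k (\<lambda>(l, m). c l m)"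
    have "?C * ?A z = 1\<^sub>m k"
    proof (rule eq_matI)
      fix l l' assume l: "l < dim_row (1\<^sub>m k)" "l' < dim_col (1\<^sub>m k)"
      have "(?C * ?A z) $$ (l, l') = (\<Sum>m<k. ?C $$ (l, m) * f z m l')"
        using mult[of ?C l l' z] l by simp
      then show "(?C * ?A z) $$ (l, l') = 1\<^sub>m k $$ (l, l')" using l c by simp
    qed auto
    then have "det ?C * det (?A z) = 1" by (metis A det_mult det_one mat_carrier)
    then show "z \<in> {z \<in> topspace Z. det (?A z) \<noteq> 0}" using z by auto
  next
    fix z assume "z \<in> {z \<in> topspace Z. det (?A z) \<noteq> 0}"
    then show "z \<in> D" unfolding D_def using inv by (intro CollectI conjI exI[of _ "?c z"]) auto
  qed
  have "openin Z D"
    unfolding D by (rule openin_nonzero_set, rule continuous_map_det) (rule f)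
  moreover have "continuous_map (subtopology Z D) euclidean (\<lambda>z. ?c z l m)" if "l < k" "m < k" for l m
    by (intro continuous_map_complex_divide continuous_map_from_subtopology
        continuous_map_adj_mat continuous_map_det f that) (auto simp: D)
  moreover have "(\<Sum>m<k. ?c z l m * f z m l') = (if l = l' then 1 else 0)"
    if "z \<in> D" "l < k" "l' < k" for z l l'
    using inv that by (simp add: D)
  ultimately show thesis by (rule that[of ?c])
qed

section \<open>Coordinate vectors and reduced bases\<close>

type_synonym cvec = "nat \<Rightarrow> complex"

text \<open>Coordinate vectors are functions on all of \<open>nat\<close> that vanish outside an index set S. Thus the
  spaces \<open>\<complex>\<^sup>S\<close> for varying S live on one type, and \<open>Cn S \<subseteq> Cn T\<close> for \<open>S \<subseteq> T\<close> is a true inclusion.\<close>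

definition Cn :: "nat set \<Rightarrow> cvec set"
  where "Cn S = {x. \<forall>a. a \<notin> S \<longrightarrow> x a = 0}"

definition unitv :: "nat \<Rightarrow> cvec"
  where "unitv a = (\<lambda>b. if b = a then 1 else 0)"

definition lsub :: "cvec set \<Rightarrow> bool"
  where "lsub W \<longleftrightarrow> (\<lambda>_. 0) \<in> W \<and> (\<forall>x\<in>W. \<forall>y\<in>W. (\<lambda>a. x a + y a) \<in> W) \<and>
    (\<forall>c. \<forall>x\<in>W. (\<lambda>a. c * x a) \<in> W)"

definition lc :: "'i set \<Rightarrow> ('i \<Rightarrow> complex) \<Rightarrow> ('i \<Rightarrow> cvec) \<Rightarrow> cvec"
  where "lc I c v = (\<lambda>b. \<Sum>a\<in>I. c a * v a b)"

definition sp :: "'i set \<Rightarrow> ('i \<Rightarrow> cvec) \<Rightarrow> cvec set"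
  where "sp I v = range (\<lambda>c. lc I c v)"

definition indep :: "'i set \<Rightarrow> ('i \<Rightarrow> cvec) \<Rightarrow> bool"
  where "indep I v \<longleftrightarrow> (\<forall>c. (\<forall>b. lc I c v b = 0) \<longrightarrow> (\<forall>a\<in>I. c a = 0))"

text \<open>The projection of W to the coordinates in I is bijective: the standard basis lifts to W, and
  the kernel is zero. These sets I index the affine charts of the Grassmannian, and \<open>rr I W\<close> is
  the lifted standard basis, i.e. the rows of the reduced echelon form of W with pivots I.\<close>

definition chart :: "nat set \<Rightarrow> cvec set \<Rightarrow> bool"
  where "chart I W \<longleftrightarrow> (\<forall>a\<in>I. \<exists>s\<in>W. \<forall>b\<in>I. s b = unitv a b) \<and>
    (\<forall>w\<in>W. (\<forall>b\<in>I. w b = 0) \<longrightarrow> (\<forall>b. w b = 0))"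

definition rr :: "nat set \<Rightarrow> cvec set \<Rightarrow> nat \<Rightarrow> cvec"
  where "rr I W a = (SOME s. s \<in> W \<and> (\<forall>b\<in>I. s b = unitv a b))"

lemma Cn_mono: "S \<subseteq> T \<Longrightarrow> Cn S \<subseteq> Cn T"
  by (auto simp: Cn_def)

lemma unitv_Cn: "unitv a \<in> Cn S \<longleftrightarrow> a \<in> S"
  by (auto simp: Cn_def unitv_def)

lemma lsub_Cn: "lsub (Cn S)"
  by (auto simp: lsub_def Cn_def)

lemma lsub_add: "lsub W \<Longrightarrow> x \<in> W \<Longrightarrow> y \<in> W \<Longrightarrow> (\<lambda>a. x a + y a) \<in> W"
  by (auto simp: lsub_def)

lemma lsub_scale: "lsub W \<Longrightarrow> x \<in> W \<Longrightarrow> (\<lambda>a. c * x a) \<in> W"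
  by (auto simp: lsub_def)

lemma lsub_zero: "lsub W \<Longrightarrow> (\<lambda>_. 0) \<in> W"
  by (auto simp: lsub_def)

lemma lsub_diff: "lsub W \<Longrightarrow> x \<in> W \<Longrightarrow> y \<in> W \<Longrightarrow> (\<lambda>a. x a - y a) \<in> W"
  using lsub_add[of W x "\<lambda>a. (-1) * y a"] lsub_scale[of W y "-1"] by simp

lemma lsub_lc:
  assumes "lsub W" "\<And>a. a \<in> I \<Longrightarrow> v a \<in> W"
  shows "lc I c v \<in> W"
  using assms(2)
proof (induction I rule: infinite_finite_induct)
  case (insert a I)
  have "lc (insert a I) c v = (\<lambda>b. c a * v a b + lc I c v b)"
    using insert.hyps by (simp add: lc_def)
  moreover have "(\<lambda>b. c a * v a b + lc I c v b) \<in> W"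
    using insert by (intro lsub_add[OF assms(1)] lsub_scale[OF assms(1)]) auto
  ultimately show ?case by simp
qed (use lsub_zero[OF assms(1)] in \<open>auto simp: lc_def\<close>)

lemma lsub_sp: "lsub (sp I v)"
  unfolding lsub_def
proof (intro conjI ballI allI)
  show "(\<lambda>_. 0) \<in> sp I v"
    unfolding sp_def by (rule range_eqI[of _ _ "\<lambda>_. 0"]) (simp add: lc_def)
next
  fix x y assume "x \<in> sp I v" "y \<in> sp I v"
  then obtain c d where "x = lc I c v" "y = lc I d v" by (auto simp: sp_def)
  then show "(\<lambda>a. x a + y a) \<in> sp I v"
    unfolding sp_def
    by (intro range_eqI[of _ _ "\<lambda>a. c a + d a"]) (simp add: lc_def algebra_simps sum.distrib)
next
  fix k x assume "x \<in> sp I v"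
  then obtain c where "x = lc I c v" by (auto simp: sp_def)
  then show "(\<lambda>a. k * x a) \<in> sp I v"
    unfolding sp_def
    by (intro range_eqI[of _ _ "\<lambda>a. k * c a"]) (simp add: lc_def algebra_simps sum_distrib_left)
qed

lemma sp_subset: "lsub W \<Longrightarrow> (\<And>a. a \<in> I \<Longrightarrow> v a \<in> W) \<Longrightarrow> sp I v \<subseteq> W"
  by (auto simp: sp_def intro: lsub_lc)

lemma lc_reindex:
  assumes "bij_betw e J I"
  shows "lc I c v = lc J (c \<circ> e) (v \<circ> e)"
  unfolding lc_def by (rule ext, subst sum.reindex_bij_betw[OF assms, symmetric]) simp

lemma sp_reindex:
  assumes e: "bij_betw e J I"
  shows "sp J (v \<circ> e) = sp I v"
proof (intro equalityI subsetI)
  fix x assume "x \<in> sp J (v \<circ> e)"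
  then obtain c where x: "x = lc J c (v \<circ> e)" by (auto simp: sp_def)
  have "x = lc I (c \<circ> inv_into J e) v"
    unfolding lc_reindex[OF e] x using e
    by (auto simp: lc_def bij_betw_def intro!: ext sum.cong)
  then show "x \<in> sp I v" by (auto simp: sp_def)
next
  fix x assume "x \<in> sp I v"
  then show "x \<in> sp J (v \<circ> e)" using lc_reindex[OF e] by (auto simp: sp_def)
qed

lemma indep_reindex:
  assumes e: "bij_betw e J I"
  shows "indep J (v \<circ> e) \<longleftrightarrow> indep I v"
proof
  assume L: "indep J (v \<circ> e)"
  show "indep I v" unfolding indep_def
  proof (intro allI impI ballI)
    fix c a assume "\<forall>b. lc I c v b = 0" "a \<in> I"
    then have "\<forall>b\<in>J. (c \<circ> e) b = 0" using L lc_reindex[OF e] by (metis indep_def)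
    then show "c a = 0" using e \<open>a \<in> I\<close> by (metis bij_betw_iff_bijections comp_apply)
  qed
next
  assume R: "indep I v"
  show "indep J (v \<circ> e)" unfolding indep_def
  proof (intro allI impI ballI)
    fix c a assume c: "\<forall>b. lc J c (v \<circ> e) b = 0" "a \<in> J"
    have "lc J c (v \<circ> e) = lc I (c \<circ> inv_into J e) v"
      unfolding lc_reindex[OF e] using e
      by (auto simp: lc_def bij_betw_def intro!: ext sum.cong)
    then have "(c \<circ> inv_into J e) (e a) = 0"
      using R c e by (metis bij_betwE indep_def)
    then show "c a = 0" using e c(2) by (simp add: bij_betw_def)
  qed
qed

lemma indep_dual:
  assumes "finite I" "\<And>a b. a \<in> I \<Longrightarrow> b \<in> I \<Longrightarrow> v a b = unitv a b"
  shows "indep I v"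
  unfolding indep_def
proof (intro allI impI ballI)
  fix c a assume c: "\<forall>b. lc I c v b = 0" and a: "a \<in> I"
  have "lc I c v a = (\<Sum>b\<in>I. if b = a then c a else 0)"
    unfolding lc_def by (rule sum.cong) (use assms a in \<open>auto simp: unitv_def\<close>)
  then show "c a = 0" using c a assms(1) by simp
qed

text \<open>Gaussian elimination without elimination: a minimal set of coordinates on which the vectors
  of a space W are still determined is automatically the index set of a reduced basis of W.\<close>

lemma row_reduce:
  assumes "lsub W" "W \<subseteq> Cn S" "finite S"
  shows "\<exists>I\<subseteq>S. chart I W"
proof -
  define P where "P I \<longleftrightarrow> I \<subseteq> S \<and> (\<forall>w\<in>W. (\<forall>b\<in>I. w b = 0) \<longrightarrow> (\<forall>b. w b = 0))" for I
  have "P S" unfolding P_def using assms(2) by (auto simp: Cn_def)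
  then obtain I where I: "P I" and min: "\<And>J. P J \<Longrightarrow> card I \<le> card J"
    using ex_has_least_nat[of P S card] by blast
  have "finite I" using I assms(3) finite_subset by (auto simp: P_def)
  have "\<exists>s\<in>W. \<forall>b\<in>I. s b = unitv a b" if a: "a \<in> I" for a
  proof -
    have "\<not> P (I - {a})" using min[of "I - {a}"] a \<open>finite I\<close> card_Diff1_less[of I a] by auto
    then obtain w where w: "w \<in> W" "\<forall>b\<in>I - {a}. w b = 0" "\<exists>b. w b \<noteq> 0"
      using I by (auto simp: P_def)
    then have "w a \<noteq> 0" using I by (auto simp: P_def)
    then show ?thesis
      using w lsub_scale[OF assms(1) w(1), of "1 / w a"]
      by (intro bexI[of _ "\<lambda>b. 1 / w a * w b"]) (auto simp: unitv_def)
  qed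
  then have "chart I W" using I by (simp add: P_def chart_def)
  then show ?thesis using I by (auto simp: P_def)
qed

lemma rr:
  assumes "chart I W" "a \<in> I"
  shows "rr I W a \<in> W" "b \<in> I \<Longrightarrow> rr I W a b = unitv a b"
proof -
  have "\<exists>s. s \<in> W \<and> (\<forall>b\<in>I. s b = unitv a b)" using assms by (auto simp: chart_def)
  then have "rr I W a \<in> W \<and> (\<forall>b\<in>I. rr I W a b = unitv a b)"
    unfolding rr_def by (rule someI_ex)
  then show "rr I W a \<in> W" "b \<in> I \<Longrightarrow> rr I W a b = unitv a b" by auto
qed

lemma chart_eqI:
  assumes "lsub W" "chart I W" "x \<in> W" "y \<in> W" "\<And>b. b \<in> I \<Longrightarrow> x b = y b"
  shows "x = y"
proof -
  have "(\<lambda>b. x b - y b) \<in> W" using assms by (intro lsub_diff)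
  then have "\<forall>b. x b - y b = 0" using assms by (auto simp: chart_def)
  then show ?thesis by auto
qed

lemma rr_unique:
  assumes "lsub W" "chart I W" "a \<in> I" "s \<in> W" "\<And>b. b \<in> I \<Longrightarrow> s b = unitv a b"
  shows "rr I W a = s"
  by (rule chart_eqI[OF assms(1,2)]) (use rr[OF assms(2,3)] assms(4,5) in auto)

lemma lc_rr_coord:
  assumes "finite I" "chart I W" "b \<in> I"
  shows "lc I c (rr I W) b = c b"
proof -
  have "lc I c (rr I W) b = (\<Sum>a\<in>I. if a = b then c b else 0)"
    unfolding lc_def by (rule sum.cong) (use rr[OF assms(2)] assms(3) in \<open>auto simp: unitv_def\<close>)
  then show ?thesis using assms by simp
qed

lemma chart_expand:
  assumes "lsub W" "chart I W" "finite I" "w \<in> W"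
  shows "lc I w (rr I W) = w"
  by (rule chart_eqI[OF assms(1,2)])
    (use assms rr[OF assms(2)] lc_rr_coord in \<open>auto intro: lsub_lc\<close>)

lemma chart_mem_iff:
  assumes "lsub W" "chart I W" "finite I"
  shows "w \<in> W \<longleftrightarrow> lc I w (rr I W) = w"
  using chart_expand[OF assms] lsub_lc[OF assms(1), of I "rr I W"] rr[OF assms(2)] by metis

lemma chart_sp:
  assumes "lsub W" "chart I W" "finite I"
  shows "sp I (rr I W) = W"
proof
  show "sp I (rr I W) \<subseteq> W" by (rule sp_subset[OF assms(1)]) (use rr[OF assms(2)] in auto)
  show "W \<subseteq> sp I (rr I W)" using chart_expand[OF assms] by (auto simp: sp_def) (metis rangeI)
qed

lemma chart_indep: "chart I W \<Longrightarrow> finite I \<Longrightarrow> indep I (rr I W)"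
  by (rule indep_dual) (auto simp: rr)


section \<open>Coordinates on complex vector spaces\<close>

locale lin_inj = vectorspace "class_ring :: complex ring" V for V :: "'v cvs" (structure) +
  fixes \<phi> :: "'v \<Rightarrow> cvec"
  assumes inj: "inj_on \<phi> (carrier V)"
    and phi_add: "x \<in> carrier V \<Longrightarrow> y \<in> carrier V \<Longrightarrow> \<phi> (x \<oplus> y) = (\<lambda>a. \<phi> x a + \<phi> y a)"
    and phi_smult: "x \<in> carrier V \<Longrightarrow> \<phi> (c \<odot> x) = (\<lambda>a. c * \<phi> x a)"
begin

lemma phi_zero: "\<phi> \<zero> = (\<lambda>_. 0)"
proof -
  have "\<phi> (0 \<odot> \<zero>) = (\<lambda>a. 0 * \<phi> \<zero> a)" by (rule phi_smult) simp
  moreover have "0 \<odot> \<zero> = \<zero>" using smult_r_null[of 0] by simp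
  ultimately show ?thesis by simp
qed

lemma smult_in: "x \<in> carrier V \<Longrightarrow> c \<odot> x \<in> carrier V"
  using smult_closed[of c x] by simp

lemma phi_finsum:
  assumes "finite I" "x ` I \<subseteq> carrier V"
  shows "(\<Oplus>a\<in>I. c a \<odot> x a) \<in> carrier V \<and> \<phi> (\<Oplus>a\<in>I. c a \<odot> x a) = lc I c (\<phi> \<circ> x)"
  using assms
proof (induction I rule: finite_induct)
  case empty
  then show ?case by (simp add: phi_zero lc_def)
next
  case (insert a I)
  have "(\<Oplus>a\<in>insert a I. c a \<odot> x a) = c a \<odot> x a \<oplus> (\<Oplus>a\<in>I. c a \<odot> x a)"
    by (rule finsum_insert) (use insert smult_in in auto)
  then show ?case using insert smult_in by (auto simp: phi_add phi_smult lc_def)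
qed

lemma phi_lincomb_image:
  assumes "finite I" "x ` I \<subseteq> carrier V" "inj_on x I"
  shows "\<phi> (lincomb c (x ` I)) = lc I (c \<circ> x) (\<phi> \<circ> x)"
proof -
  have "lincomb c (x ` I) = (\<Oplus>v\<in>x ` I. c v \<odot> v)" by (simp add: lincomb_def)
  also have "\<phi> \<dots> = lc (x ` I) c \<phi>" using phi_finsum[of "x ` I" "\<lambda>v. v" c] assms by (simp add: comp_def)
  also have "\<dots> = lc I (c \<circ> x) (\<phi> \<circ> x)" by (rule lc_reindex) (use assms in \<open>simp add: bij_betw_def\<close>)
  finally show ?thesis .
qed

lemma span_carrier: "A \<subseteq> carrier V \<Longrightarrow> span A \<subseteq> carrier V"
  by (rule span_is_subset2)

lemma phi_span:
  assumes "finite I" "x ` I \<subseteq> carrier V" "inj_on x I"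
  shows "\<phi> ` span (x ` I) = sp I (\<phi> \<circ> x)"
proof -
  have "span (x ` I) = {lincomb a (x ` I) | a. True}"
    using finite_span[of "x ` I"] assms by simp
  then have "\<phi> ` span (x ` I) = {\<phi> (lincomb a (x ` I)) | a. True}"
    by (simp only:) blast
  also have "\<dots> = {lc I (a \<circ> x) (\<phi> \<circ> x) | a. True}"
    by (simp only: phi_lincomb_image[OF assms])
  also have "\<dots> = sp I (\<phi> \<circ> x)"
  proof (intro equalityI subsetI)
    fix y assume "y \<in> sp I (\<phi> \<circ> x)"
    then obtain c where c: "y = lc I c (\<phi> \<circ> x)" by (auto simp: sp_def)
    have "y = lc I ((c \<circ> inv_into I x) \<circ> x) (\<phi> \<circ> x)"
      unfolding c lc_def using assms(3) by (auto intro!: ext sum.cong)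
    then show "y \<in> {lc I (a \<circ> x) (\<phi> \<circ> x) | a. True}" by blast
  qed (auto simp: sp_def)
  finally show ?thesis .
qed

text \<open>A family indexed by I can be linearly dependent because of a repetition, whereas linear
  dependence of its image as a set ignores repetitions. This accounts for the injectivity on the left.\<close>

lemma frame_iff:
  assumes "finite I" "x ` I \<subseteq> carrier V"
  shows "inj_on x I \<and> lin_indpt (x ` I) \<longleftrightarrow> indep I (\<phi> \<circ> x)"
proof
  assume L: "inj_on x I \<and> lin_indpt (x ` I)"
  show "indep I (\<phi> \<circ> x)"
    unfolding indep_def
  proof (intro allI impI ballI)
    fix c a assume c: "\<forall>b. lc I c (\<phi> \<circ> x) b = 0" and a: "a \<in> I"
    let ?c = "c \<circ> inv_into I x"
    have "\<phi> (lincomb ?c (x ` I)) = lc I c (\<phi> \<circ> x)"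
      using L by (subst phi_lincomb_image) (use assms in \<open>auto simp: lc_def intro!: ext sum.cong\<close>)
    also have "\<dots> = \<phi> \<zero>" using c phi_zero by auto
    finally have "lincomb ?c (x ` I) = \<zero>"
      using inj lincomb_closed[of "x ` I" ?c] assms by (auto dest: inj_onD)
    then show "c a = 0"
      using L a assms lin_dep_crit[of "x ` I" "x ` I" ?c "x a"] by auto
  qed
next
  assume R: "indep I (\<phi> \<circ> x)"
  have inj_x: "inj_on x I"
  proof (rule inj_onI, rule ccontr)
    fix a b assume ab: "a \<in> I" "b \<in> I" "x a = x b" "a \<noteq> b"
    let ?c = "\<lambda>d. if d = a then 1 else if d = b then -1 else (0::complex)"
    have "lc I ?c (\<phi> \<circ> x) = (\<lambda>d. \<Sum>e\<in>I. (if e = a then \<phi> (x a) d else 0) + (if e = b then - \<phi> (x a) d else 0))"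
      unfolding lc_def by (rule ext, rule sum.cong) (use ab in auto)
    also have "\<dots> = (\<lambda>_. 0)" using ab assms(1) by (simp add: sum.distrib)
    finally have "\<forall>d. lc I ?c (\<phi> \<circ> x) d = 0" by simp
    then have "?c a = 0" using R[unfolded indep_def, rule_format, of ?c a] ab(1) by blast
    then show False by simp
  qed
  moreover have "lin_indpt (x ` I)"
  proof (rule finite_lin_indpt2)
    fix c assume "lincomb c (x ` I) = \<zero>"
    then have "lc I (c \<circ> x) (\<phi> \<circ> x) = (\<lambda>_. 0)"
      using phi_lincomb_image[OF assms inj_x, of c] phi_zero by simp
    then have "\<forall>a\<in>I. (c \<circ> x) a = 0"
      using R[unfolded indep_def, rule_format, of "c \<circ> x"] by simp
    then show "\<forall>v\<in>x ` I. c v = \<zero>\<^bsub>class_ring\<^esub>" by simp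
  qed (use assms in auto)
  ultimately show "inj_on x I \<and> lin_indpt (x ` I)" by simp
qed

lemma subspace_iff:
  assumes "W \<subseteq> carrier V"
  shows "is_subspace W V \<longleftrightarrow> lsub (\<phi> ` W)"
proof
  assume "is_subspace W V"
  then have sub: "submodule class_ring W V" by (simp add: subspace_def)
  show "lsub (\<phi> ` W)"
    unfolding lsub_def
  proof (intro conjI ballI allI)
    show "(\<lambda>_. 0) \<in> \<phi> ` W" using phi_zero submodule.zero_closed[OF sub] by (metis imageI)
  next
    fix x y assume "x \<in> \<phi> ` W" "y \<in> \<phi> ` W"
    then obtain u v where "u \<in> W" "v \<in> W" "x = \<phi> u" "y = \<phi> v" by auto
    moreover have "u \<oplus> v \<in> W" by (rule submodule.m_closed[OF sub]) fact+
    moreover have "\<phi> (u \<oplus> v) = (\<lambda>a. \<phi> u a + \<phi> v a)"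
      by (rule phi_add) (use assms \<open>u \<in> W\<close> \<open>v \<in> W\<close> in auto)
    ultimately show "(\<lambda>a. x a + y a) \<in> \<phi> ` W" by (metis imageI)
  next
    fix c x assume "x \<in> \<phi> ` W"
    then obtain u where "u \<in> W" "x = \<phi> u" by auto
    moreover have "c \<odot> u \<in> W" by (rule submodule.smult_closed[OF sub]) (use \<open>u \<in> W\<close> in auto)
    moreover have "\<phi> (c \<odot> u) = (\<lambda>a. c * \<phi> u a)"
      by (rule phi_smult) (use assms \<open>u \<in> W\<close> in auto)
    ultimately show "(\<lambda>a. c * x a) \<in> \<phi> ` W" by (metis imageI)
  qed
next
  assume L: "lsub (\<phi> ` W)"
  have mem: "x \<in> W" if "x \<in> carrier V" "\<phi> x \<in> \<phi> ` W" for x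
    using that assms inj by (auto dest!: inj_onD)
  have "submodule class_ring W V"
  proof (unfold_locales)
    show "W \<subseteq> carrier V" by (rule assms)
    show "\<zero> \<in> W" using L by (intro mem) (auto simp: phi_zero lsub_def)
    show "v \<oplus> w \<in> W" if "v \<in> W" "w \<in> W" for v w
    proof (rule mem)
      have vw: "v \<in> carrier V" "w \<in> carrier V" using that assms by auto
      then show "v \<oplus> w \<in> carrier V" by simp
      show "\<phi> (v \<oplus> w) \<in> \<phi> ` W" unfolding phi_add[OF vw] using that by (intro lsub_add[OF L]) auto
    qed
    show "c \<odot> v \<in> W" if "c \<in> carrier class_ring" "v \<in> W" for c v
    proof (rule mem)
      have v: "v \<in> carrier V" using that assms by auto
      then show "c \<odot> v \<in> carrier V" by (rule smult_in)
      show "\<phi> (c \<odot> v) \<in> \<phi> ` W" unfolding phi_smult[OF v] using that by (intro lsub_scale[OF L]) auto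
    qed
  qed
  then show "is_subspace W V" using vectorspace_axioms by (simp add: subspace_def)
qed

lemma lin_inj_subspace:
  assumes "is_subspace W V"
  shows "lin_inj (V\<lparr>carrier := W\<rparr>) \<phi>"
proof -
  have W: "W \<subseteq> carrier V" using assms by (simp add: subspace_def submodule_def)
  show ?thesis
    by (intro lin_inj.intro lin_inj_axioms.intro subspace_is_vs[OF assms])
      (use inj_on_subset[OF inj W] phi_add phi_smult subsetD[OF W] in auto)
qed

lemma dim_frame:
  assumes "finite I" "x ` I \<subseteq> carrier V" "indep I (\<phi> \<circ> x)" "\<phi> ` carrier V = sp I (\<phi> \<circ> x)"
  shows "fin_dim \<and> dim = card I"
proof -
  have f: "inj_on x I" "lin_indpt (x ` I)" using frame_iff assms by auto
  have "\<phi> ` span (x ` I) = \<phi> ` carrier V" using phi_span assms f by simp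
  then have g: "span (x ` I) = carrier V"
    using inj span_carrier[OF assms(2)] by (metis inj_on_image_eq_iff order_refl)
  have "basis (x ` I)" using f g assms by (simp add: basis_def)
  then have "dim = card (x ` I)" by (intro dim_basis) (use assms in auto)
  moreover have "fin_dim" unfolding fin_dim_def using g assms by blast
  ultimately show ?thesis using f by (simp add: card_image)
qed

lemma frame_spans:
  assumes "fin_dim" "finite I" "x ` I \<subseteq> carrier V" "indep I (\<phi> \<circ> x)" "dim \<le> card I"
  shows "\<phi> ` carrier V = sp I (\<phi> \<circ> x)"
proof -
  have f: "inj_on x I" "lin_indpt (x ` I)" using frame_iff assms by auto
  have "basis (x ` I)" by (rule dim_li_is_basis) (use assms f in \<open>auto simp: card_image\<close>)
  then have "span (x ` I) = carrier V" by (simp add: basis_def)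
  then show ?thesis using phi_span[OF assms(2,3) f(1)] by simp
qed

end

text \<open>The dimension is expressed by the number of elements of a chart; \<open>grassmannian_iff\<close> below links
  this to the dimension of a vector space.\<close>

definition Gs :: "nat set \<Rightarrow> nat \<Rightarrow> cvec set set"
  where "Gs S k = {W. W \<subseteq> Cn S \<and> lsub W \<and> (\<exists>I\<subseteq>S. card I = k \<and> chart I W)}"

locale coords = lin_inj V \<phi> for V :: "'v cvs" (structure) and \<phi> :: "'v \<Rightarrow> cvec" +
  fixes S :: "nat set"
  assumes finS: "finite S" and surj: "\<phi> ` carrier V = Cn S"
begin

definition \<psi> :: "cvec \<Rightarrow> 'v" where "\<psi> = inv_into (carrier V) \<phi>"

lemma psi_in: "x \<in> Cn S \<Longrightarrow> \<psi> x \<in> carrier V"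
  unfolding \<psi>_def using surj by (metis inv_into_into)

lemma phi_psi: "x \<in> Cn S \<Longrightarrow> \<phi> (\<psi> x) = x"
  unfolding \<psi>_def using surj by (metis f_inv_into_f)

lemma psi_phi: "v \<in> carrier V \<Longrightarrow> \<psi> (\<phi> v) = v"
  unfolding \<psi>_def using inj by simp

lemma phi_in: "v \<in> carrier V \<Longrightarrow> \<phi> v \<in> Cn S"
  using surj by auto

lemma phi_psi_image: "W \<subseteq> Cn S \<Longrightarrow> \<phi> ` \<psi> ` W = W"
  using phi_psi by (force simp: image_image)

lemma psi_phi_image: "W \<subseteq> carrier V \<Longrightarrow> \<psi> ` \<phi> ` W = W"
  using psi_phi by (force simp: image_image)

lemma dim_Gs:
  assumes W: "W \<subseteq> carrier V" and "\<phi> ` W \<in> Gs S k"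
  shows "is_subspace W V" "cvs_dim (V\<lparr>carrier := W\<rparr>) = k" "vectorspace.fin_dim class_ring (V\<lparr>carrier := W\<rparr>)"
proof -
  obtain I where I: "I \<subseteq> S" "card I = k" "chart I (\<phi> ` W)" and L: "lsub (\<phi> ` W)"
    using assms by (auto simp: Gs_def)
  show s: "is_subspace W V" using subspace_iff W L by simp
  interpret sub: lin_inj "V\<lparr>carrier := W\<rparr>" \<phi> by (rule lin_inj_subspace[OF s])
  have finI: "finite I" using I finS finite_subset by blast
  let ?r = "rr I (\<phi> ` W)"
  have r: "?r a \<in> \<phi> ` W" if "a \<in> I" for a using rr[OF I(3) that] by simp
  have pr: "\<phi> (\<psi> (?r a)) = ?r a" "\<psi> (?r a) \<in> W" if "a \<in> I" for a
    using r[OF that] W phi_psi phi_in psi_phi by auto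
  have eq: "lc I c (\<phi> \<circ> (\<psi> \<circ> ?r)) = lc I c ?r" for c
    unfolding lc_def by (intro ext sum.cong) (auto simp: pr)
  have "sub.fin_dim \<and> sub.dim = card I"
  proof (rule sub.dim_frame[OF finI])
    show "(\<psi> \<circ> ?r) ` I \<subseteq> carrier (V\<lparr>carrier := W\<rparr>)" using pr by auto
    show "indep I (\<phi> \<circ> (\<psi> \<circ> ?r))"
      using chart_indep[OF I(3) finI] by (simp only: indep_def eq)
    show "\<phi> ` carrier (V\<lparr>carrier := W\<rparr>) = sp I (\<phi> \<circ> (\<psi> \<circ> ?r))"
      using chart_sp[OF L I(3) finI] by (simp add: sp_def eq)
  qed
  then show "cvs_dim (V\<lparr>carrier := W\<rparr>) = k" "sub.fin_dim" using I by auto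
qed

lemma grassmannian_iff:
  "is_subspace W V \<and> cvs_dim (V\<lparr>carrier := W\<rparr>) = k \<longleftrightarrow> W \<subseteq> carrier V \<and> \<phi> ` W \<in> Gs S k"
proof
  assume L: "is_subspace W V \<and> cvs_dim (V\<lparr>carrier := W\<rparr>) = k"
  then have W: "W \<subseteq> carrier V" by (simp add: subspace_def submodule_def)
  then have l: "lsub (\<phi> ` W)" using L subspace_iff by simp
  moreover have c: "\<phi> ` W \<subseteq> Cn S" using W phi_in by auto
  ultimately obtain I where I: "I \<subseteq> S" "chart I (\<phi> ` W)" using row_reduce finS by blast
  then have "\<phi> ` W \<in> Gs S (card I)" using l c by (auto simp: Gs_def)
  with dim_Gs[OF W this] L W show "W \<subseteq> carrier V \<and> \<phi> ` W \<in> Gs S k" by simp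
qed (use dim_Gs in auto)

lemma frame_Gs:
  assumes "finite I" "x ` I \<subseteq> carrier V" "indep I (\<phi> \<circ> x)"
  shows "sp I (\<phi> \<circ> x) \<in> Gs S (card I)"
proof -
  have f: "inj_on x I" using frame_iff assms by auto
  let ?W = "span (x ` I)"
  have W: "is_subspace ?W V" by (rule span_is_subspace[OF assms(2)])
  have e: "\<phi> ` ?W = sp I (\<phi> \<circ> x)" by (rule phi_span[OF assms(1,2) f])
  interpret sub: lin_inj "V\<lparr>carrier := ?W\<rparr>" \<phi> by (rule lin_inj_subspace[OF W])
  have "sub.dim = card I"
    using sub.dim_frame[OF assms(1) _ assms(3)] e in_own_span[OF assms(2)] by simp
  then show ?thesis using grassmannian_iff[of ?W "card I"] W e by simp
qed

end

section \<open>The Grassmannian of a coordinate space\<close>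

definition cn :: "nat set \<Rightarrow> cvec cvs"
  where "cn S = \<lparr>carrier = Cn S, mult = (\<lambda>x _. x), one = (\<lambda>_. 0), zero = (\<lambda>_. 0),
    add = (\<lambda>x y a. x a + y a), smult = (\<lambda>c x a. c * x a)\<rparr>"

lemma vectorspace_cn: "vectorspace class_ring (cn S)"
proof (rule vs_criteria[OF class_field], goal_cases)
  case 3
  show ?case
  proof
    fix v assume "v \<in> carrier (cn S)"
    then show "\<exists>w\<in>carrier (cn S). v \<oplus>\<^bsub>cn S\<^esub> w = \<zero>\<^bsub>cn S\<^esub>"
      by (intro bexI[of _ "\<lambda>a. - v a"]) (auto simp: cn_def Cn_def)
  qed
qed (auto simp: cn_def Cn_def algebra_simps)

lemma coords_cn:
  assumes "finite S"
  shows "coords (cn S) (\<lambda>x. x) S"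
  by (intro coords.intro lin_inj.intro lin_inj_axioms.intro coords_axioms.intro vectorspace_cn assms)
    (auto simp: cn_def)

lemma quotient_map_quotient_topology:
  assumes "f ` topspace X = Y"
  shows "quotient_map X (quotient_topology X f Y) f" "topspace (quotient_topology X f Y) = Y"
proof -
  have "{x \<in> topspace X. f x \<in> Y} = topspace X" using assms by auto
  then have "openin (quotient_topology X f Y) Y" by (simp add: openin_quotient_topology)
  then show ts: "topspace (quotient_topology X f Y) = Y"
    by (metis openin_quotient_topology openin_subset openin_topspace subset_antisym)
  show "quotient_map X (quotient_topology X f Y) f"
    unfolding quotient_map_def ts using assms by (auto simp: openin_quotient_topology)
qed

context coords
begin

lemma coords_dim: "fin_dim" "dim = card S"
proof -
  have 1: "lc S c (\<phi> \<circ> (\<psi> \<circ> unitv)) = lc S c unitv" for c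
    unfolding lc_def by (intro ext sum.cong) (auto simp: phi_psi unitv_Cn)
  have 2: "x = lc S x unitv" if "x \<in> Cn S" for x
    using that finS by (auto simp: lc_def unitv_def Cn_def if_distrib sum.delta cong: if_cong)
  have "fin_dim \<and> dim = card S"
  proof (rule dim_frame[OF finS])
    show "(\<psi> \<circ> unitv) ` S \<subseteq> carrier V" by (auto simp: psi_in unitv_Cn)
    show "indep S (\<phi> \<circ> (\<psi> \<circ> unitv))"
      using indep_dual[of S unitv] finS by (simp add: indep_def 1)
    have "sp S unitv = Cn S"
    proof
      show "sp S unitv \<subseteq> Cn S" by (rule sp_subset[OF lsub_Cn]) (simp add: unitv_Cn)
      show "Cn S \<subseteq> sp S unitv" using 2 by (auto simp: sp_def)
    qed
    then show "\<phi> ` carrier V = sp S (\<phi> \<circ> (\<psi> \<circ> unitv))" using surj by (simp add: sp_def 1)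
  qed
  then show "fin_dim" "dim = card S" by auto
qed

lemma phi_functional: "(\<lambda>x. \<phi> x a) \<in> linear_functionals V"
  by (simp add: linear_functionals_def phi_add phi_smult)

text \<open>The induction over the support of \<open>\<phi> y\<close> peels off one coordinate at a time.\<close>

lemma functional_expand:
  assumes f: "f \<in> linear_functionals V" and "x \<in> carrier V"
  shows "f x = (\<Sum>a\<in>S. \<phi> x a * f (\<psi> (unitv a)))"
proof -
  have "finite T \<Longrightarrow> T \<subseteq> S \<Longrightarrow> (\<forall>y\<in>carrier V. \<phi> y \<in> Cn T \<longrightarrow> f y = (\<Sum>a\<in>T. \<phi> y a * f (\<psi> (unitv a))))" for T
  proof (induction T rule: finite_induct)
    case empty
    show ?case
    proof (intro ballI impI)
      fix y assume y: "y \<in> carrier V" "\<phi> y \<in> Cn {}"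
      then have "\<phi> y = \<phi> (0 \<odot> y)" by (auto simp: phi_smult Cn_def)
      then have "y = 0 \<odot> y" using inj_onD[OF inj] y smult_in by blast
      then have "f y = 0" using f y unfolding linear_functionals_def
        by (metis (mono_tags, lifting) mem_Collect_eq mult_zero_left)
      then show "f y = (\<Sum>a\<in>{}. \<phi> y a * f (\<psi> (unitv a)))" by simp
    qed
  next
    case (insert b T)
    show ?case
    proof (intro ballI impI)
      fix y assume y: "y \<in> carrier V" "\<phi> y \<in> Cn (insert b T)"
      let ?u = "\<psi> (unitv b)" and ?z = "\<psi> ((\<phi> y)(b := 0))"
      have b: "b \<in> S" "T \<subseteq> S" using insert.prems by auto
      have zC: "(\<phi> y)(b := 0) \<in> Cn T" using y by (auto simp: Cn_def)
      then have zS: "(\<phi> y)(b := 0) \<in> Cn S" using Cn_mono[OF b(2)] by auto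
      have u: "?u \<in> carrier V" "\<phi> ?u = unitv b" using b by (auto simp: psi_in phi_psi unitv_Cn)
      have z: "?z \<in> carrier V" "\<phi> ?z = (\<phi> y)(b := 0)" using zS by (auto simp: psi_in phi_psi)
      have "\<phi> y = \<phi> (\<phi> y b \<odot> ?u \<oplus> ?z)"
        using u z smult_in[OF u(1)] by (auto simp: phi_add phi_smult unitv_def)
      then have "y = \<phi> y b \<odot> ?u \<oplus> ?z"
        by (rule inj_onD[OF inj]) (use u z y smult_in in auto)
      then have "f y = f (\<phi> y b \<odot> ?u \<oplus> ?z)" by (rule arg_cong)
      also have "\<dots> = f (\<phi> y b \<odot> ?u) + f ?z"
        using f u(1) z(1) smult_in[OF u(1)] unfolding linear_functionals_def by blast
      also have "f (\<phi> y b \<odot> ?u) = \<phi> y b * f ?u"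
        using f u(1) unfolding linear_functionals_def by blast
      also have "f ?z = (\<Sum>a\<in>T. \<phi> y a * f (\<psi> (unitv a)))"
      proof -
        have "f ?z = (\<Sum>a\<in>T. \<phi> ?z a * f (\<psi> (unitv a)))" using insert.IH b z zC by auto
        also have "\<dots> = (\<Sum>a\<in>T. \<phi> y a * f (\<psi> (unitv a)))"
          by (rule sum.cong) (use insert.hyps z in auto)
        finally show ?thesis .
      qed
      finally show "f y = (\<Sum>a\<in>insert b T. \<phi> y a * f (\<psi> (unitv a)))"
        using insert.hyps by simp
    qed
  qed
  then show ?thesis using assms finS phi_in by blast
qed

lemma topspace_cvs: "topspace (cvs_topology V) = carrier V"
proof -
  have "(\<lambda>_. 0) \<in> linear_functionals V" by (simp add: linear_functionals_def)
  then have "carrier V \<subseteq> topspace (cvs_topology V)"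
    unfolding cvs_topology_def topology_generated_by_topspace
    by (intro subsetI UnionI[of "carrier V"]) (auto intro!: exI[of _ "\<lambda>_. 0"] exI[of _ UNIV])
  then show ?thesis unfolding cvs_topology_def topology_generated_by_topspace by auto
qed

lemma continuous_map_functional:
  "f \<in> linear_functionals V \<Longrightarrow> continuous_map (cvs_topology V) euclidean f"
  unfolding continuous_map_def topspace_cvs
  by (auto simp: cvs_topology_def open_openin[symmetric] intro!: topology_generated_by_Basis)

text \<open>The topology is generated by all functionals, but each of them is a linear combination of the
  finitely many coordinates.\<close>

lemma continuous_map_cvs:
  "continuous_map Z (cvs_topology V) g \<longleftrightarrow>
    g \<in> topspace Z \<rightarrow> carrier V \<and> (\<forall>a\<in>S. continuous_map Z euclidean (\<lambda>z. \<phi> (g z) a))"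
proof
  assume L: "continuous_map Z (cvs_topology V) g"
  then show "g \<in> topspace Z \<rightarrow> carrier V \<and> (\<forall>a\<in>S. continuous_map Z euclidean (\<lambda>z. \<phi> (g z) a))"
    using continuous_map_compose[OF L continuous_map_functional[OF phi_functional]]
      continuous_map_funspace[OF L] by (auto simp: comp_def topspace_cvs)
next
  assume R: "g \<in> topspace Z \<rightarrow> carrier V \<and> (\<forall>a\<in>S. continuous_map Z euclidean (\<lambda>z. \<phi> (g z) a))"
  have cf: "continuous_map Z euclidean (\<lambda>z. f (g z))" if f: "f \<in> linear_functionals V" for f
  proof (rule continuous_map_eq)
    show "continuous_map Z euclidean (\<lambda>z. \<Sum>a\<in>S. \<phi> (g z) a * f (\<psi> (unitv a)))"
      by (intro continuous_map_sum continuous_map_complex_mult finS) (use R in auto)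
    show "(\<Sum>a\<in>S. \<phi> (g z) a * f (\<psi> (unitv a))) = f (g z)" if "z \<in> topspace Z" for z
      by (rule functional_expand[OF f, symmetric]) (use R that in auto)
  qed
  show "continuous_map Z (cvs_topology V) g"
    unfolding cvs_topology_def
  proof (rule continuous_on_generated_topo)
    fix U assume "U \<in> {{x \<in> carrier V. f x \<in> S} |f S. f \<in> linear_functionals V \<and> open S}"
    then obtain f O' where U: "U = {x \<in> carrier V. f x \<in> O'}" "f \<in> linear_functionals V" "open O'" by auto
    have "g -` U \<inter> topspace Z = {z \<in> topspace Z. f (g z) \<in> O'}" using U R by auto
    then show "openin Z (g -` U \<inter> topspace Z)"
      using openin_continuous_map_preimage[OF cf[OF U(2)], of O'] U(3) by (simp add: open_openin[symmetric])
  next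
    show "g ` topspace Z \<subseteq> \<Union> {{x \<in> carrier V. f x \<in> S} |f S. f \<in> linear_functionals V \<and> open S}"
      using R topspace_cvs unfolding cvs_topology_def topology_generated_by_topspace by auto
  qed
qed

lemma topspace_frame:
  "topspace (frame_space V k) = {v \<in> {..<k} \<rightarrow>\<^sub>E carrier V. indep {..<k} (\<phi> \<circ> v)}"
proof -
  have "topspace (frame_space V k) = {v \<in> {..<k} \<rightarrow>\<^sub>E carrier V. inj_on v {..<k} \<and> lin_indpt (v ` {..<k})}"
    unfolding frame_space_def topspace_subtopology topspace_product_topology topspace_cvs by blast
  also have "\<dots> = {v \<in> {..<k} \<rightarrow>\<^sub>E carrier V. indep {..<k} (\<phi> \<circ> v)}"
  proof (intro Collect_cong conj_cong refl)
    fix v assume "v \<in> {..<k} \<rightarrow>\<^sub>E carrier V"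
    then have "v ` {..<k} \<subseteq> carrier V" by auto
    then show "(inj_on v {..<k} \<and> lin_indpt (v ` {..<k})) = indep {..<k} (\<phi> \<circ> v)"
      by (intro frame_iff) auto
  qed
  finally show ?thesis .
qed

lemma continuous_map_frame:
  "continuous_map Z (frame_space V k) g \<longleftrightarrow> g \<in> topspace Z \<rightarrow> topspace (frame_space V k) \<and>
    (\<forall>m<k. \<forall>a\<in>S. continuous_map Z euclidean (\<lambda>z. \<phi> (g z m) a))"
proof -
  have "continuous_map Z (frame_space V k) g \<longleftrightarrow> g \<in> topspace Z \<rightarrow> topspace (frame_space V k) \<and>
    continuous_map Z (product_topology (\<lambda>_. cvs_topology V) {..<k}) g"
    unfolding frame_space_def continuous_map_in_subtopology
    using continuous_map_funspace by fastforce
  then show ?thesis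
    unfolding continuous_map_componentwise continuous_map_cvs topspace_frame
    by (auto simp: PiE_iff Pi_iff image_subset_iff)
qed

lemma span_frame:
  assumes "v \<in> topspace (frame_space V k)"
  shows "span (v ` {..<k}) \<subseteq> carrier V" "\<phi> ` span (v ` {..<k}) = sp {..<k} (\<phi> \<circ> v)"
    "sp {..<k} (\<phi> \<circ> v) \<in> Gs S k"
proof -
  have v: "v ` {..<k} \<subseteq> carrier V" "indep {..<k} (\<phi> \<circ> v)"
    using assms by (auto simp: topspace_frame)
  then show "span (v ` {..<k}) \<subseteq> carrier V" by (intro span_carrier)
  show "\<phi> ` span (v ` {..<k}) = sp {..<k} (\<phi> \<circ> v)" 
    using phi_span[of "{..<k}" v] frame_iff[of "{..<k}" v] v by simp
  show "sp {..<k} (\<phi> \<circ> v) \<in> Gs S k" using frame_Gs[OF _ v] by simp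
qed

lemma grassmannian_quotient:
  shows "quotient_map (frame_space V k) (grassmannian V k) (\<lambda>v. span (v ` {..<k}))"
    and topspace_grassmannian: "topspace (grassmannian V k) = {W. W \<subseteq> carrier V \<and> \<phi> ` W \<in> Gs S k}"
proof -
  have eq: "(\<lambda>v. span (v ` {..<k})) ` topspace (frame_space V k) = {W. W \<subseteq> carrier V \<and> \<phi> ` W \<in> Gs S k}"
  proof (intro equalityI subsetI)
    fix W assume "W \<in> (\<lambda>v. span (v ` {..<k})) ` topspace (frame_space V k)"
    then show "W \<in> {W. W \<subseteq> carrier V \<and> \<phi> ` W \<in> Gs S k}" using span_frame by auto
  next
    fix W assume "W \<in> {W. W \<subseteq> carrier V \<and> \<phi> ` W \<in> Gs S k}"
    then obtain I where W: "W \<subseteq> carrier V" and I: "I \<subseteq> S" "card I = k" "chart I (\<phi> ` W)" "lsub (\<phi> ` W)"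
      by (auto simp: Gs_def)
    have finI: "finite I" using I finS finite_subset by blast
    obtain e where e: "bij_betw e {..<k} I"
      using ex_bij_betw_nat_finite[OF finI] I by (auto simp: atLeast0LessThan)
    let ?v = "\<lambda>m\<in>{..<k}. \<psi> (rr I (\<phi> ` W) (e m))"
    have r: "rr I (\<phi> ` W) (e m) \<in> \<phi> ` W" if "m < k" for m
      using rr(1)[OF I(3), of "e m"] bij_betwE[OF e] that by auto
    have pr: "\<phi> (?v m) = rr I (\<phi> ` W) (e m)" "?v m \<in> carrier V" if "m < k" for m
      using r[OF that] W that phi_psi psi_in phi_in by auto
    have lceq: "lc {..<k} c (\<phi> \<circ> ?v) = lc {..<k} c (rr I (\<phi> ` W) \<circ> e)" for c
      unfolding lc_def by (intro ext sum.cong) (use pr(1) in auto)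
    have "indep {..<k} (\<phi> \<circ> ?v)"
      using indep_reindex[OF e, of "rr I (\<phi> ` W)"] chart_indep[OF I(3) finI] unfolding indep_def lceq by blast
    then have fr: "?v \<in> topspace (frame_space V k)" using pr by (auto simp: topspace_frame)
    have "sp {..<k} (\<phi> \<circ> ?v) = sp {..<k} (rr I (\<phi> ` W) \<circ> e)" unfolding sp_def lceq by simp
    also have "\<dots> = \<phi> ` W" using sp_reindex[OF e] chart_sp[OF I(4,3) finI] by simp
    finally have "\<phi> ` span (?v ` {..<k}) = \<phi> ` W" using span_frame(2)[OF fr] by simp
    then have "span (?v ` {..<k}) = W"
      using inj W span_frame(1)[OF fr] by (metis inj_on_image_eq_iff)
    then show "W \<in> (\<lambda>v. span (v ` {..<k})) ` topspace (frame_space V k)" using fr by blast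
  qed
  have g: "grassmannian V k = quotient_topology (frame_space V k) (\<lambda>v. span (v ` {..<k}))
      {W. W \<subseteq> carrier V \<and> \<phi> ` W \<in> Gs S k}"
    unfolding grassmannian_def grassmannian_iff ..
  show "quotient_map (frame_space V k) (grassmannian V k) (\<lambda>v. span (v ` {..<k}))"
    "topspace (grassmannian V k) = {W. W \<subseteq> carrier V \<and> \<phi> ` W \<in> Gs S k}"
    unfolding g using quotient_map_quotient_topology[OF eq] by auto
qed

end

lemma topspace_Gr: "finite S \<Longrightarrow> topspace (grassmannian (cn S) k) = Gs S k"
  using coords.topspace_grassmannian[OF coords_cn] by (auto simp: cn_def Gs_def)

lemma topspace_frame_cn: "finite S \<Longrightarrow> topspace (frame_space (cn S) k) = {v \<in> {..<k} \<rightarrow>\<^sub>E Cn S. indep {..<k} v}"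
  using coords.topspace_frame[OF coords_cn] by (simp add: cn_def comp_def)

lemma Gr_quotient:
  assumes "finite S"
  shows "quotient_map (frame_space (cn S) k) (grassmannian (cn S) k) (sp {..<k})"
proof (rule quotient_map_eq[OF coords.grassmannian_quotient(1)[OF coords_cn[OF assms]]])
  fix v assume "v \<in> topspace (frame_space (cn S) k)"
  then show "module.span class_ring (cn S) (v ` {..<k}) = sp {..<k} v"
    using coords.span_frame(2)[OF coords_cn[OF assms]] by (simp add: comp_def)
qed

text \<open>The basic criterion: a family of subspaces with a continuous basis is continuous, since it is
  the composition of a map to the space of frames with the quotient map.\<close>

lemma continuous_map_into_Gr:
  assumes "finite S" "finite I" "card I = k"
    and f: "\<And>z. z \<in> topspace Z \<Longrightarrow> f z = sp I (v z) \<and> indep I (v z) \<and> (\<forall>a\<in>I. v z a \<in> Cn S)"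
    and v: "\<And>a b. a \<in> I \<Longrightarrow> b \<in> S \<Longrightarrow> continuous_map Z euclidean (\<lambda>z. v z a b)"
  shows "continuous_map Z (grassmannian (cn S) k) f"
proof -
  obtain e where e: "bij_betw e {..<k} I"
    using ex_bij_betw_nat_finite[OF assms(2)] assms(3) by (auto simp: atLeast0LessThan)
  have eI: "e m \<in> I" if "m < k" for m using bij_betwE[OF e] that by auto
  let ?g = "\<lambda>z. \<lambda>m\<in>{..<k}. v z (e m)"
  have lceq: "lc {..<k} c (?g z) = lc {..<k} c (v z \<circ> e)" for c z
    unfolding lc_def by (intro ext sum.cong) auto
  have "continuous_map Z (frame_space (cn S) k) ?g"
    unfolding coords.continuous_map_frame[OF coords_cn[OF assms(1)]]
  proof (intro conjI allI impI ballI)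
    show "?g \<in> topspace Z \<rightarrow> topspace (frame_space (cn S) k)"
    proof
      fix z assume z: "z \<in> topspace Z"
      then have "indep {..<k} (?g z)"
        using indep_reindex[OF e, of "v z"] f unfolding indep_def lceq by blast
      then show "?g z \<in> topspace (frame_space (cn S) k)"
        using f[OF z] eI unfolding topspace_frame_cn[OF assms(1)] by auto
    qed
    show "continuous_map Z euclidean (\<lambda>z. ?g z m a)" if "m < k" "a \<in> S" for m a
      using that v eI by simp
  qed
  then have "continuous_map Z (grassmannian (cn S) k) (sp {..<k} \<circ> ?g)"
    by (rule continuous_map_compose[OF _ quotient_imp_continuous_map[OF Gr_quotient[OF assms(1)]]])
  then show ?thesis
  proof (rule continuous_map_eq)
    fix z assume z: "z \<in> topspace Z"
    have "sp {..<k} (?g z) = sp {..<k} (v z \<circ> e)" unfolding sp_def lceq ..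
    then show "(sp {..<k} \<circ> ?g) z = f z" using sp_reindex[OF e] f[OF z] by simp
  qed
qed

lemma Gs_sp_eq:
  assumes "finite S" "finite I" "card I = k" "W \<in> Gs S k" "indep I v" "\<And>a. a \<in> I \<Longrightarrow> v a \<in> W"
  shows "W = sp I v"
proof -
  interpret coords "cn S" "\<lambda>x. x" S by (rule coords_cn[OF assms(1)])
  have W: "W \<subseteq> carrier (cn S)" using assms by (auto simp: Gs_def cn_def)
  have W': "(\<lambda>x. x) ` W \<in> Gs S k" using assms by simp
  interpret sub: lin_inj "cn S\<lparr>carrier := W\<rparr>" "\<lambda>x. x"
    by (rule lin_inj_subspace[OF dim_Gs(1)[OF W W']])
  have "(\<lambda>x. x) ` carrier (cn S\<lparr>carrier := W\<rparr>) = sp I ((\<lambda>x. x) \<circ> v)"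
    by (rule sub.frame_spans) (use assms dim_Gs(2,3)[OF W W'] in \<open>auto simp: comp_def\<close>)
  then show ?thesis by (simp add: comp_def)
qed

lemma sp_Gs:
  assumes "finite S" "finite I" "card I = k" "indep I v" "\<And>a. a \<in> I \<Longrightarrow> v a \<in> Cn S"
  shows "sp I v \<in> Gs S k"
  using coords.frame_Gs[OF coords_cn[OF assms(1)], of I v] assms
  by (auto simp: comp_def cn_def)

text \<open>A basis of the smaller space is a linearly independent family of the right length in the larger
  one.\<close>

lemma Gs_eqI:
  assumes "finite S" "W \<in> Gs S k" "W' \<in> Gs S k" "W \<subseteq> W'"
  shows "W = W'"
proof -
  obtain I where I: "I \<subseteq> S" "card I = k" "chart I W" "lsub W" using assms by (auto simp: Gs_def)
  then have fin: "finite I" using assms(1) finite_subset by blast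
  have "W' = sp I (rr I W)"
    by (rule Gs_sp_eq[OF assms(1) fin I(2) assms(3) chart_indep[OF I(3) fin]]) (use rr[OF I(3)] assms in auto)
  then show ?thesis using chart_sp[OF I(4,3) fin] by simp
qed

lemma Gs_chartI:
  assumes "finite S" "finite I" "card I = k" "W \<in> Gs S k"
    and "\<And>a. a \<in> I \<Longrightarrow> \<exists>s\<in>W. \<forall>b\<in>I. s b = unitv a b"
  shows "chart I W"
  unfolding chart_def
proof (intro conjI ballI impI)
  show "\<exists>s\<in>W. \<forall>b\<in>I. s b = unitv a b" if "a \<in> I" for a by (rule assms(5)[OF that])
  obtain s where s: "\<And>a. a \<in> I \<Longrightarrow> s a \<in> W \<and> (\<forall>b\<in>I. s a b = unitv a b)" using assms(5) by metis
  have W: "W = sp I s" by (rule Gs_sp_eq[OF assms(1-4) indep_dual]) (use s assms(2) in auto)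
  fix w assume w: "w \<in> W" "\<forall>b\<in>I. w b = 0"
  then obtain c where c: "w = lc I c s" using W by (auto simp: sp_def)
  have "c b = 0" if "b \<in> I" for b
  proof -
    have "lc I c s b = (\<Sum>a\<in>I. if a = b then c b else 0)"
      unfolding lc_def by (rule sum.cong) (use s that in \<open>auto simp: unitv_def\<close>)
    then show ?thesis using w(2) c that assms(2) by simp
  qed
  then show "\<forall>b. w b = 0" unfolding c by (simp add: lc_def)
qed

text \<open>On the open set where I is the index set of a reduced basis, the reduced basis depends
  continuously on the subspace: both the set and the functions are pulled back to the space of
  frames, where the reduced basis arises by inverting a square submatrix.\<close>

lemma chart_continuous:
  assumes "finite S" "I \<subseteq> S" "card I = k"
  defines "G \<equiv> grassmannian (cn S) k"
  shows chart_openin: "openin G {W \<in> Gs S k. chart I W}" (is "openin G ?U")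
    and rr_continuous: "a \<in> I \<Longrightarrow> continuous_map (subtopology G {W \<in> Gs S k. chart I W}) euclidean (\<lambda>W. rr I W a b)"
proof -
  have finI: "finite I" using assms finite_subset by blast
  obtain e where e: "bij_betw e {..<k} I"
    using ex_bij_betw_nat_finite[OF finI] assms(3) by (auto simp: atLeast0LessThan)
  have eI: "e m \<in> I" if "m < k" for m using bij_betwE[OF e] that by auto
  have inj_e: "e l = e l' \<longleftrightarrow> l = l'" if "l < k" "l' < k" for l l'
    using e that by (auto simp: bij_betw_def inj_on_def)
  have I_ball: "(\<forall>a\<in>I. P a) \<longleftrightarrow> (\<forall>l<k. P (e l))" for P
    using e by (auto simp: bij_betw_def)
  let ?X = "frame_space (cn S) k"
  have cont: "continuous_map ?X euclidean (\<lambda>v. v m a)" if "m < k" for m a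
  proof (cases "a \<in> S")
    case True
    have "continuous_map ?X ?X (\<lambda>v. v)" by simp
    then show ?thesis
      unfolding coords.continuous_map_frame[OF coords_cn[OF assms(1)]] using that True by auto
  next
    case False
    show ?thesis
    proof (rule continuous_map_eq)
      show "continuous_map ?X euclidean (\<lambda>_. 0)" by simp
      fix v assume "v \<in> topspace ?X"
      then have "v m \<in> Cn S" using that unfolding topspace_frame_cn[OF assms(1)] by blast
      then show "0 = v m a" using False by (simp add: Cn_def)
    qed
  qed
  let ?D = "{v \<in> topspace ?X. \<exists>c. \<forall>l<k. \<forall>l'<k. (\<Sum>m<k. c l m * v m (e l')) = (if l = l' then 1 else 0)}"
  obtain c where opD: "openin ?X ?D"
    and cc: "\<And>l m. l < k \<Longrightarrow> m < k \<Longrightarrow> continuous_map (subtopology ?X ?D) euclidean (\<lambda>v. c v l m)"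
    and cinv: "\<And>v l l'. v \<in> ?D \<Longrightarrow> l < k \<Longrightarrow> l' < k \<Longrightarrow> (\<Sum>m<k. c v l m * v m (e l')) = (if l = l' then 1 else 0)"
    by (rule continuous_left_inverse[of k ?X "\<lambda>v m l. v m (e l)"]) (use cont in blast)+
  have GsX: "sp {..<k} v \<in> Gs S k" if "v \<in> topspace ?X" for v
    using that quotient_imp_surjective_map[OF Gr_quotient[OF assms(1), of k]] topspace_Gr[OF assms(1)] by blast
  have D: "?D = {v \<in> topspace ?X. sp {..<k} v \<in> ?U}"
  proof (intro Collect_cong conj_cong refl)
    fix v assume v: "v \<in> topspace ?X"
    have "(\<exists>c. \<forall>l<k. \<forall>l'<k. (\<Sum>m<k. c l m * v m (e l')) = (if l = l' then 1 else 0)) \<longleftrightarrow>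
        (\<exists>c. \<forall>l<k. \<forall>l'<k. lc {..<k} (c l) v (e l') = unitv (e l) (e l'))"
      unfolding lc_def unitv_def by (intro ex_cong1 all_cong) (auto simp: inj_e)
    also have "\<dots> \<longleftrightarrow> (\<forall>l<k. \<exists>c. \<forall>l'<k. lc {..<k} c v (e l') = unitv (e l) (e l'))"
      using choice_iff'[of "\<lambda>l. l < k" "\<lambda>l c. \<forall>l'<k. lc {..<k} c v (e l') = unitv (e l) (e l')"] by blast
    also have "\<dots> \<longleftrightarrow> (\<forall>a\<in>I. \<exists>s\<in>sp {..<k} v. \<forall>b\<in>I. s b = unitv a b)"
      unfolding I_ball sp_def by auto
    also have "\<dots> \<longleftrightarrow> chart I (sp {..<k} v)"
      using Gs_chartI[OF assms(1) finI assms(3) GsX[OF v]] by (auto simp: chart_def)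
    finally show "(\<exists>c. \<forall>l<k. \<forall>l'<k. (\<Sum>m<k. c l m * v m (e l')) = (if l = l' then 1 else 0)) \<longleftrightarrow>
        sp {..<k} v \<in> ?U" using GsX[OF v] by simp
  qed
  have U: "?U \<subseteq> topspace G" by (auto simp: G_def topspace_Gr[OF assms(1)])
  have q: "quotient_map ?X G (sp {..<k})" unfolding G_def by (rule Gr_quotient[OF assms(1)])
  show op: "openin G ?U" using q U opD unfolding D quotient_map_def by blast
  show "continuous_map (subtopology G ?U) euclidean (\<lambda>W. rr I W a b)" if a: "a \<in> I"
  proof (rule continuous_compose_quotient_map)
    show "quotient_map (subtopology ?X ?D) (subtopology G ?U) (sp {..<k})"
      by (rule quotient_map_restriction[OF q D[symmetric]]) (use op in auto)
    obtain l where l: "l < k" "a = e l" using a e by (auto simp: bij_betw_def)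
    have "continuous_map (subtopology ?X ?D) euclidean (\<lambda>v. \<Sum>m<k. c v l m * v m b)"
      by (intro continuous_map_sum continuous_map_complex_mult cc l
          continuous_map_from_subtopology[OF cont]) auto
    then show "continuous_map (subtopology ?X ?D) euclidean ((\<lambda>W. rr I W a b) \<circ> sp {..<k})"
    proof (rule continuous_map_eq)
      fix v assume "v \<in> topspace (subtopology ?X ?D)"
      then have v: "v \<in> ?D" by simp
      then have ch: "chart I (sp {..<k} v)" unfolding D by auto
      have "rr I (sp {..<k} v) a = lc {..<k} (c v l) v"
      proof (rule rr_unique[OF lsub_sp ch a])
        show "lc {..<k} (c v l) v \<in> sp {..<k} v" by (auto simp: sp_def)
        fix b assume "b \<in> I"
        then obtain l' where "l' < k" "b = e l'" using e by (auto simp: bij_betw_def)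
        then show "lc {..<k} (c v l) v b = unitv a b"
          using cinv[OF v l(1)] inj_e l by (simp add: lc_def unitv_def) 
      qed
      then show "(\<Sum>m<k. c v l m * v m b) = ((\<lambda>W. rr I W a b) \<circ> sp {..<k}) v"
        by (simp add: lc_def)
    qed
  qed
qed

section \<open>Grassmannians and flag varieties in coordinates\<close>

context coords
begin

lemma grassmannian_homeo:
  "homeomorphic_maps (grassmannian V k) (grassmannian (cn S) k) ((`) \<phi>) ((`) \<psi>)"
  unfolding homeomorphic_maps_def
proof (intro conjI ballI)
  have "continuous_map (frame_space V k) (grassmannian (cn S) k) ((`) \<phi> \<circ> (\<lambda>v. span (v ` {..<k})))"
  proof (rule continuous_map_into_Gr[where v = "\<lambda>v. \<phi> \<circ> v" and I = "{..<k}"])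
    fix v assume v: "v \<in> topspace (frame_space V k)"
    then have "\<phi> (v m) \<in> Cn S" if "m < k" for m using that phi_in unfolding topspace_frame by blast
    then show "((`) \<phi> \<circ> (\<lambda>v. span (v ` {..<k}))) v = sp {..<k} (\<phi> \<circ> v) \<and> indep {..<k} (\<phi> \<circ> v) \<and>
        (\<forall>a\<in>{..<k}. (\<phi> \<circ> v) a \<in> Cn S)"
      using span_frame(2)[OF v] v unfolding topspace_frame by simp
  next
    fix m b assume "m \<in> {..<k}" "b \<in> S"
    moreover have "continuous_map (frame_space V k) (frame_space V k) (\<lambda>v. v)" by simp
    ultimately show "continuous_map (frame_space V k) euclidean (\<lambda>v. (\<phi> \<circ> v) m b)"
      unfolding continuous_map_frame by simp
  qed (use finS in auto)
  then show "continuous_map (grassmannian V k) (grassmannian (cn S) k) ((`) \<phi>)"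
    by (rule continuous_compose_quotient_map[OF grassmannian_quotient(1)])
next
  interpret c: coords "cn S" "\<lambda>x. x" S by (rule coords_cn[OF finS])
  let ?g = "\<lambda>v. \<lambda>m\<in>{..<k}. \<psi> (v m)"
  have fr: "?g v \<in> topspace (frame_space V k)" "\<psi> ` sp {..<k} v = span (?g v ` {..<k})"
    if v: "v \<in> topspace (frame_space (cn S) k)" for v
  proof -
    have v': "v m \<in> Cn S" if "m < k" for m using v that unfolding topspace_frame_cn[OF finS] by blast
    have e: "lc {..<k} c (\<phi> \<circ> ?g v) = lc {..<k} c v" for c
      unfolding lc_def by (intro ext sum.cong) (auto simp: phi_psi v')
    have "indep {..<k} v" using v unfolding topspace_frame_cn[OF finS] by blast
    then show f: "?g v \<in> topspace (frame_space V k)"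
      unfolding topspace_frame mem_Collect_eq indep_def e using v' psi_in by auto
    have "\<phi> ` span (?g v ` {..<k}) = sp {..<k} v" using span_frame(2)[OF f] by (simp only: sp_def e)
    then show "\<psi> ` sp {..<k} v = span (?g v ` {..<k})" using psi_phi_image[OF span_frame(1)[OF f]] by simp
  qed
  have "continuous_map (frame_space (cn S) k) (frame_space V k) ?g"
    unfolding continuous_map_frame
  proof (intro conjI allI impI ballI)
    show "?g \<in> topspace (frame_space (cn S) k) \<rightarrow> topspace (frame_space V k)" using fr by blast
    fix m a assume m: "m < k" and a: "a \<in> S"
    have "continuous_map (frame_space (cn S) k) (frame_space (cn S) k) (\<lambda>v. v)" by simp
    then have "continuous_map (frame_space (cn S) k) euclidean (\<lambda>v. v m a)"
      unfolding c.continuous_map_frame using m a by auto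
    then show "continuous_map (frame_space (cn S) k) euclidean (\<lambda>v. \<phi> (?g v m) a)"
    proof (rule continuous_map_eq)
      fix v assume "v \<in> topspace (frame_space (cn S) k)"
      then have "v m \<in> Cn S" using m unfolding topspace_frame_cn[OF finS] by blast
      then show "v m a = \<phi> (?g v m) a" using m by (simp add: phi_psi)
    qed
  qed
  then have "continuous_map (frame_space (cn S) k) (grassmannian V k) ((\<lambda>v. span (v ` {..<k})) \<circ> ?g)"
    by (rule continuous_map_compose[OF _ quotient_imp_continuous_map[OF grassmannian_quotient(1)]])
  then have "continuous_map (frame_space (cn S) k) (grassmannian V k) ((`) \<psi> \<circ> sp {..<k})"
    by (rule continuous_map_eq) (simp add: fr)
  then show "continuous_map (grassmannian (cn S) k) (grassmannian V k) ((`) \<psi>)"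
    by (rule continuous_compose_quotient_map[OF Gr_quotient[OF finS]])
next
  fix W assume "W \<in> topspace (grassmannian V k)"
  then show "\<psi> ` \<phi> ` W = W" unfolding topspace_grassmannian by (simp add: psi_phi_image)
next
  fix W assume "W \<in> topspace (grassmannian (cn S) k)"
  then show "\<phi> ` \<psi> ` W = W" unfolding topspace_Gr[OF finS] by (simp add: phi_psi_image Gs_def)
qed

lemma flags_iff: "F \<in> flags V \<longleftrightarrow> F \<in> extensional {0..card S} \<and>
    (\<forall>l\<le>card S. F l \<subseteq> carrier V \<and> \<phi> ` F l \<in> Gs S l) \<and> (\<forall>l<card S. F l \<subseteq> F (Suc l))"
  unfolding flags_def coords_dim(2) using grassmannian_iff by auto

lemma topspace_flag_variety: "topspace (flag_variety V) = flags V"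
proof -
  have "flags V \<subseteq> (\<Pi>\<^sub>E l\<in>{0..card S}. {W. W \<subseteq> carrier V \<and> \<phi> ` W \<in> Gs S l})"
  proof
    fix F assume "F \<in> flags V"
    then show "F \<in> (\<Pi>\<^sub>E l\<in>{0..card S}. {W. W \<subseteq> carrier V \<and> \<phi> ` W \<in> Gs S l})"
      unfolding flags_iff PiE_iff by simp
  qed
  then show ?thesis
    unfolding flag_variety_def coords_dim(2) topspace_subtopology topspace_product_topology
      topspace_grassmannian by blast
qed

lemma continuous_map_flag_variety:
  "continuous_map Z (flag_variety V) f \<longleftrightarrow> f \<in> topspace Z \<rightarrow> flags V \<and>
    (\<forall>l\<le>card S. continuous_map Z (grassmannian V l) (\<lambda>z. f z l))"
  unfolding flag_variety_def coords_dim(2) continuous_map_in_subtopology continuous_map_componentwise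
  by (auto simp: flags_iff image_subset_iff)

definition flag_to_coords :: "(nat \<Rightarrow> 'v set) \<Rightarrow> nat \<Rightarrow> cvec set"
  where "flag_to_coords F = (\<lambda>l\<in>{0..card S}. \<phi> ` F l)"

definition flag_of_coords :: "(nat \<Rightarrow> cvec set) \<Rightarrow> nat \<Rightarrow> 'v set"
  where "flag_of_coords F = (\<lambda>l\<in>{0..card S}. \<psi> ` F l)"

end

definition Fls :: "nat set \<Rightarrow> (nat \<Rightarrow> cvec set) set"
  where "Fls S = {F \<in> extensional {0..card S}. (\<forall>l\<le>card S. F l \<in> Gs S l) \<and> (\<forall>l<card S. F l \<subseteq> F (Suc l))}"

abbreviation Fl :: "nat set \<Rightarrow> (nat \<Rightarrow> cvec set) topology"
  where "Fl S \<equiv> flag_variety (cn S)"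

abbreviation Gr :: "nat set \<Rightarrow> nat \<Rightarrow> cvec set topology"
  where "Gr S k \<equiv> grassmannian (cn S) k"

lemma flags_cn:
  assumes "finite S"
  shows "flags (cn S) = Fls S"
proof -
  have eq: "(W \<subseteq> carrier (cn S) \<and> (\<lambda>x. x) ` W \<in> Gs S l) = (W \<in> Gs S l)" for W l
    by (auto simp: cn_def Gs_def)
  have "F \<in> flags (cn S) \<longleftrightarrow> F \<in> Fls S" for F
    unfolding coords.flags_iff[OF coords_cn[OF assms]] Fls_def by (simp only: eq mem_Collect_eq)
  then show ?thesis by blast
qed

lemma topspace_Fl: "finite S \<Longrightarrow> topspace (Fl S) = Fls S"
  using coords.topspace_flag_variety[OF coords_cn] flags_cn by simp

lemma continuous_map_Fl:
  "finite S \<Longrightarrow> continuous_map Z (Fl S) f \<longleftrightarrow> f \<in> topspace Z \<rightarrow> Fls S \<and>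
    (\<forall>l\<le>card S. continuous_map Z (Gr S l) (\<lambda>z. f z l))"
  using coords.continuous_map_flag_variety[OF coords_cn] flags_cn by simp

lemma Fls_mono:
  assumes "F \<in> Fls S" "l \<le> m" "m \<le> card S"
  shows "F l \<subseteq> F m"
  using assms(2,3)
proof (induction m rule: dec_induct)
  case (step i)
  have "F i \<subseteq> F (Suc i)" using assms(1) step.prems by (simp add: Fls_def)
  then show ?case using step by auto
qed simp

context coords
begin

lemma flag_to_coords: "F \<in> flags V \<Longrightarrow> flag_to_coords F \<in> Fls S"
  unfolding flags_iff Fls_def flag_to_coords_def by (simp add: image_mono)

lemma flag_of_coords:
  assumes "F \<in> Fls S"
  shows "flag_of_coords F \<in> flags V"
proof -
  have c: "F l \<subseteq> Cn S" if "l \<le> card S" for l using assms that by (auto simp: Fls_def Gs_def)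
  have "\<psi> ` F l \<subseteq> carrier V \<and> \<phi> ` \<psi> ` F l \<in> Gs S l" if "l \<le> card S" for l
    using c[OF that] psi_in phi_psi_image[OF c[OF that]] assms that by (auto simp: Fls_def)
  then show ?thesis using assms unfolding flags_iff Fls_def flag_of_coords_def by (simp add: image_mono)
qed

lemma flag_to_of_coords:
  assumes "F \<in> Fls S"
  shows "flag_to_coords (flag_of_coords F) = F"
proof
  fix l show "flag_to_coords (flag_of_coords F) l = F l"
    using assms phi_psi_image[of "F l"]
    by (auto simp: flag_to_coords_def flag_of_coords_def Fls_def Gs_def extensional_def)
qed

lemma flag_of_to_coords:
  assumes "F \<in> flags V"
  shows "flag_of_coords (flag_to_coords F) = F"
proof
  fix l show "flag_of_coords (flag_to_coords F) l = F l"
    using assms psi_phi_image[of "F l"] unfolding flags_iff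
    by (auto simp: flag_to_coords_def flag_of_coords_def extensional_def)
qed

lemma flag_variety_homeo:
  "homeomorphic_maps (flag_variety V) (Fl S) flag_to_coords flag_of_coords"
  unfolding homeomorphic_maps_def topspace_flag_variety topspace_Fl[OF finS]
proof (intro conjI ballI flag_to_of_coords flag_of_to_coords)
  have 1: "continuous_map (flag_variety V) (grassmannian V l) (\<lambda>F. F l)" if "l \<le> card S" for l
  proof -
    have "continuous_map (flag_variety V) (flag_variety V) (\<lambda>F. F)" by simp
    then show ?thesis unfolding continuous_map_flag_variety using that by simp
  qed
  have 2: "continuous_map (Fl S) (Gr S l) (\<lambda>F. F l)" if "l \<le> card S" for l
  proof -
    have "continuous_map (Fl S) (Fl S) (\<lambda>F. F)" by simp
    then show ?thesis unfolding continuous_map_Fl[OF finS] using that by simp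
  qed
  show "continuous_map (flag_variety V) (Fl S) flag_to_coords"
    unfolding continuous_map_Fl[OF finS] topspace_flag_variety
  proof (intro conjI allI impI)
    show "flag_to_coords \<in> flags V \<rightarrow> Fls S" using flag_to_coords by blast
    fix l assume l: "l \<le> card S"
    have "continuous_map (flag_variety V) (Gr S l) ((`) \<phi> \<circ> (\<lambda>F. F l))"
      using continuous_map_compose[OF 1[OF l]] grassmannian_homeo unfolding homeomorphic_maps_def by blast
    then show "continuous_map (flag_variety V) (Gr S l) (\<lambda>F. flag_to_coords F l)"
      using l by (simp add: flag_to_coords_def comp_def)
  qed
  show "continuous_map (Fl S) (flag_variety V) flag_of_coords"
    unfolding continuous_map_flag_variety topspace_Fl[OF finS]
  proof (intro conjI allI impI)
    show "flag_of_coords \<in> Fls S \<rightarrow> flags V" using flag_of_coords by blast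
    fix l assume l: "l \<le> card S"
    have "continuous_map (Fl S) (grassmannian V l) ((`) \<psi> \<circ> (\<lambda>F. F l))"
      using continuous_map_compose[OF 2[OF l]] grassmannian_homeo unfolding homeomorphic_maps_def by blast
    then show "continuous_map (Fl S) (grassmannian V l) (\<lambda>F. flag_of_coords F l)"
      using l by (simp add: flag_of_coords_def comp_def)
  qed
qed

end

section \<open>Continuous operations on subspaces\<close>

lemma Gs_chartE:
  assumes "finite S" "W \<in> Gs S k"
  obtains I where "I \<subseteq> S" "card I = k" "chart I W" "finite I" "lsub W" "W \<subseteq> Cn S"
  using assms finite_subset[of _ S] by (auto simp: Gs_def)

lemma Gs_card:
  assumes "finite S" "W \<in> Gs S k" "chart I W" "I \<subseteq> S"
  shows "card I = k"
proof -
  interpret coords "cn S" "\<lambda>x. x" S by (rule coords_cn[OF assms(1)])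
  have "W \<in> Gs S (card I)" using assms by (auto simp: Gs_def)
  then show ?thesis using dim_Gs(2)[of W k] dim_Gs(2)[of W "card I"] assms(2)
    by (simp add: cn_def Gs_def)
qed

lemma chart_preimage_openin:
  assumes "finite S" "continuous_map Z (Gr S k) f" "I \<subseteq> S" "card I = k"
  shows "openin Z {z \<in> topspace Z. chart I (f z)}"
proof -
  have "openin Z {z \<in> topspace Z. f z \<in> {W \<in> Gs S k. chart I W}}"
    by (rule openin_continuous_map_preimage[OF assms(2) chart_openin[OF assms(1,3,4)]])
  moreover have "f z \<in> Gs S k" if "z \<in> topspace Z" for z
    using assms(2) that topspace_Gr[OF assms(1)] by (auto simp: continuous_map_def)
  ultimately show ?thesis by (simp cong: conj_cong)
qed

lemma rr_continuous_comp:
  assumes "finite S" "continuous_map Z (Gr S k) f" "I \<subseteq> S" "card I = k" "a \<in> I"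
  shows "continuous_map (subtopology Z {z \<in> topspace Z. chart I (f z)}) euclidean (\<lambda>z. rr I (f z) a b)"
proof -
  have "f z \<in> Gs S k" if "z \<in> topspace Z" for z
    using assms(2) that topspace_Gr[OF assms(1)] by (auto simp: continuous_map_def)
  then have "continuous_map (subtopology Z {z \<in> topspace Z. chart I (f z)})
      (subtopology (Gr S k) {W \<in> Gs S k. chart I W}) f"
    by (intro continuous_map_into_subtopology continuous_map_from_subtopology assms(2)) auto
  from continuous_map_compose[OF this rr_continuous[OF assms(1,3,4,5)]] show ?thesis
    by (simp add: comp_def)
qed

lemma chart_cover:
  assumes "finite S" "continuous_map Z (Gr S k) f"
    and "\<And>I. I \<subseteq> S \<Longrightarrow> card I = k \<Longrightarrow> continuous_map (subtopology Z {z \<in> topspace Z. chart I (f z)}) Y h"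
  shows "continuous_map Z Y h"
proof (rule continuous_map_locally)
  fix z assume z: "z \<in> topspace Z"
  then have "f z \<in> Gs S k" using assms(2) topspace_Gr[OF assms(1)] by (auto simp: continuous_map_def)
  then obtain I where "I \<subseteq> S" "card I = k" "chart I (f z)" by (auto simp: Gs_def)
  then show "\<exists>U. openin Z U \<and> z \<in> U \<and> continuous_map (subtopology Z U) Y h"
    using chart_preimage_openin[OF assms(1,2)] assms(3) z by (intro exI[of _ "{z \<in> topspace Z. chart I (f z)}"]) auto
qed

lemma lc_lc: "finite I \<Longrightarrow> lc S (lc I c v) g = lc I c (\<lambda>a. lc S (v a) g)"
  unfolding lc_def by (rule ext) (simp add: sum_distrib_left sum_distrib_right mult.assoc, rule sum.swap)

lemma image_sp: "finite I \<Longrightarrow> (\<lambda>x. lc S x g) ` sp I v = sp I (\<lambda>a. lc S (v a) g)"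
  unfolding sp_def by (auto simp: lc_lc image_iff)

text \<open>Locally the image has the basis \<open>g (rr I (f z))\<close>, which is continuous. The linear map is given by
  the images \<open>g z a\<close> of the unit vectors, so that its continuous dependence on z is a condition on
  these vectors only.\<close>

lemma continuous_action:
  assumes fin: "finite S" "finite S'" and f: "continuous_map Z (Gr S k) f"
    and g: "\<And>z a. z \<in> topspace Z \<Longrightarrow> a \<in> S \<Longrightarrow> g z a \<in> Cn S'"
    and inj: "\<And>z. z \<in> topspace Z \<Longrightarrow> inj_on (\<lambda>x. lc S x (g z)) (Cn S)"
    and cont: "\<And>a b. a \<in> S \<Longrightarrow> b \<in> S' \<Longrightarrow> continuous_map Z euclidean (\<lambda>z. g z a b)"
  shows "continuous_map Z (Gr S' k) (\<lambda>z. (\<lambda>x. lc S x (g z)) ` f z)"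
proof (rule chart_cover[OF fin(1) f])
  fix I assume I: "I \<subseteq> S" "card I = k"
  have finI: "finite I" using I fin finite_subset by blast
  let ?Z = "subtopology Z {z \<in> topspace Z. chart I (f z)}"
  show "continuous_map ?Z (Gr S' k) (\<lambda>z. (\<lambda>x. lc S x (g z)) ` f z)"
  proof (rule continuous_map_into_Gr[OF fin(2) finI I(2), where v = "\<lambda>z a. lc S (rr I (f z) a) (g z)"])
    fix z assume "z \<in> topspace ?Z"
    then have z: "z \<in> topspace Z" and ch: "chart I (f z)" by auto
    have "f z \<in> Gs S k" using f z topspace_Gr[OF fin(1)] by (auto simp: continuous_map_def)
    then have l: "lsub (f z)" "f z \<subseteq> Cn S" by (auto simp: Gs_def)
    have "indep I (\<lambda>a. lc S (rr I (f z) a) (g z))"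
      unfolding indep_def
    proof (intro allI impI)
      fix c assume "\<forall>b. lc I c (\<lambda>a. lc S (rr I (f z) a) (g z)) b = 0"
      then have "lc S (lc I c (rr I (f z))) (g z) = lc S (\<lambda>_. 0) (g z)"
        unfolding lc_lc[OF finI] by (auto simp: lc_def)
      moreover have "lc I c (rr I (f z)) \<in> Cn S" using l lsub_lc[OF l(1)] rr(1)[OF ch] by blast
      ultimately have "lc I c (rr I (f z)) = (\<lambda>_. 0)"
        using inj_onD[OF inj[OF z]] by (simp add: Cn_def)
      then show "\<forall>a\<in>I. c a = 0" using chart_indep[OF ch finI] by (simp add: indep_def)
    qed
    moreover have "lc S (rr I (f z) a) (g z) \<in> Cn S'" for a
      using g[OF z] by (intro lsub_lc lsub_Cn) auto
    moreover have "(\<lambda>x. lc S x (g z)) ` f z = sp I (\<lambda>a. lc S (rr I (f z) a) (g z))"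
      using image_sp[OF finI, of S "g z" "rr I (f z)"] chart_sp[OF l(1) ch finI] by simp
    ultimately show "(\<lambda>x. lc S x (g z)) ` f z = sp I (\<lambda>a. lc S (rr I (f z) a) (g z)) \<and>
        indep I (\<lambda>a. lc S (rr I (f z) a) (g z)) \<and> (\<forall>a\<in>I. lc S (rr I (f z) a) (g z) \<in> Cn S')" by blast
  next
    fix a b assume a: "a \<in> I" and b: "b \<in> S'"
    show "continuous_map ?Z euclidean (\<lambda>z. lc S (rr I (f z) a) (g z) b)"
      unfolding lc_def
      by (intro continuous_map_sum continuous_map_complex_mult fin(1)
          rr_continuous_comp[OF fin(1) f I a] continuous_map_from_subtopology cont b)
  qed
qed

lemma image_Gs:
  assumes fin: "finite S" "finite S'" and W: "W \<in> Gs S k"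
    and g: "\<And>a. a \<in> S \<Longrightarrow> g a \<in> Cn S'" and inj: "inj_on (\<lambda>x. lc S x g) (Cn S)"
  shows "(\<lambda>x. lc S x g) ` W \<in> Gs S' k"
proof -
  have "continuous_map (Gr S k) (Gr S' k) (\<lambda>W. (\<lambda>x. lc S x g) ` W)"
    by (rule continuous_action[OF fin]) (use g inj in auto)
  then show ?thesis using W topspace_Gr fin by (auto simp: continuous_map_def)
qed

text \<open>Within a chart, w lies in P if and only if w equals the combination of the reduced basis of P with
  the coordinates of w as coefficients; both sides are continuous in P.\<close>

lemma closedin_Gr_mem:
  assumes fin: "finite S"
  shows "closedin (Gr S k) {P \<in> Gs S k. w \<in> P}"
proof (rule open_cover_closedin)
  fix P assume P: "P \<in> topspace (Gr S k)" "P \<notin> {P \<in> Gs S k. w \<in> P}"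
  then have PG: "P \<in> Gs S k" using topspace_Gr[OF fin] by blast
  from Gs_chartE[OF fin this] obtain I where
    I: "I \<subseteq> S" "card I = k" "chart I P" "finite I" "lsub P" by metis
  then obtain b where b: "lc I w (rr I P) b \<noteq> w b"
    using P PG chart_mem_iff[OF I(5,3,4)] by blast
  let ?U = "{W \<in> Gs S k. chart I W}"
  have sub: "topspace (subtopology (Gr S k) ?U) = ?U" using topspace_Gr[OF fin] by auto
  have "continuous_map (subtopology (Gr S k) ?U) euclidean (\<lambda>W. lc I w (rr I W) b)"
    unfolding lc_def
    by (intro continuous_map_sum continuous_map_complex_mult I(4) rr_continuous[OF fin I(1,2)]) auto
  then have "openin (subtopology (Gr S k) ?U) {W \<in> ?U. lc I w (rr I W) b \<noteq> w b}"
    using openin_nonzero_set[of "subtopology (Gr S k) ?U"] unfolding sub by blast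
  then have "openin (Gr S k) {W \<in> ?U. lc I w (rr I W) b \<noteq> w b}"
    using openin_open_subtopology[OF chart_openin[OF fin I(1,2)]] by blast
  moreover have "w \<notin> W" if "W \<in> ?U" "lc I w (rr I W) b \<noteq> w b" for W
    using that chart_mem_iff[of W I w] I(4) by (auto simp: Gs_def)
  ultimately show "\<exists>U. openin (Gr S k) U \<and> P \<in> U \<and> U \<inter> {P \<in> Gs S k. w \<in> P} = {}"
    using PG I(3) b by (intro exI[of _ "{W \<in> ?U. lc I w (rr I W) b \<noteq> w b}"]) auto
qed (auto simp: topspace_Gr[OF fin])

lemma closedin_Gr_subset:
  assumes fin: "finite S"
  shows "closedin (Gr S k) {P \<in> Gs S k. P \<subseteq> Cn Y}"
proof (rule open_cover_closedin)
  fix P assume P: "P \<in> topspace (Gr S k)" "P \<notin> {P \<in> Gs S k. P \<subseteq> Cn Y}"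
  then have PG: "P \<in> Gs S k" using topspace_Gr[OF fin] by blast
  from Gs_chartE[OF fin this] obtain I where
    I: "I \<subseteq> S" "card I = k" "chart I P" "finite I" "lsub P" by metis
  have "\<not> sp I (rr I P) \<subseteq> Cn Y" using P PG chart_sp[OF I(5,3,4)] by blast
  then obtain a where "a \<in> I" "rr I P a \<notin> Cn Y" using sp_subset[OF lsub_Cn, of I "rr I P" Y] by blast
  then obtain b where ab: "a \<in> I" "b \<notin> Y" "rr I P a b \<noteq> 0" by (auto simp: Cn_def)
  let ?U = "{W \<in> Gs S k. chart I W}"
  have sub: "topspace (subtopology (Gr S k) ?U) = ?U" using topspace_Gr[OF fin] by auto
  have "openin (subtopology (Gr S k) ?U) {W \<in> ?U. rr I W a b \<noteq> 0}"
    using openin_nonzero_set[OF rr_continuous[OF fin I(1,2) ab(1)]] unfolding sub by blast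
  then have "openin (Gr S k) {W \<in> ?U. rr I W a b \<noteq> 0}"
    using openin_open_subtopology[OF chart_openin[OF fin I(1,2)]] by blast
  moreover have "\<not> W \<subseteq> Cn Y" if "W \<in> ?U" "rr I W a b \<noteq> 0" for W
    using that rr(1)[of I W a] ab by (auto simp: Cn_def)
  ultimately show "\<exists>U. openin (Gr S k) U \<and> P \<in> U \<and> U \<inter> {P \<in> Gs S k. P \<subseteq> Cn Y} = {}"
    using PG I(3) ab by (intro exI[of _ "{W \<in> ?U. rr I W a b \<noteq> 0}"]) auto
qed (auto simp: topspace_Gr[OF fin])

text \<open>Subspaces between \<open>Cn A\<close> and \<open>Cn (A \<union> D)\<close> with A and D disjoint are the same thing
  as subspaces of \<open>Cn D\<close>: one direction is \<open>ext A\<close>, the other one is the intersection with \<open>Cn D\<close>.\<close>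

definition ext :: "nat set \<Rightarrow> cvec set \<Rightarrow> cvec set"
  where "ext A Q = {\<lambda>b. x b + y b | x y. x \<in> Q \<and> y \<in> Cn A}"

lemma extI: "x \<in> Q \<Longrightarrow> y \<in> Cn A \<Longrightarrow> w = (\<lambda>b. x b + y b) \<Longrightarrow> w \<in> ext A Q"
  by (auto simp: ext_def)

lemma lsub_ext: "lsub Q \<Longrightarrow> lsub (ext A Q)"
  unfolding lsub_def
proof (intro conjI ballI allI, goal_cases)
  case 1
  then show ?case unfolding ext_def by (intro CollectI exI[of _ "\<lambda>_. 0"]) (auto simp: Cn_def)
next
  case (2 x y)
  then obtain p q r s where "x = (\<lambda>b. p b + q b)" "y = (\<lambda>b. r b + s b)" "p \<in> Q" "r \<in> Q" "q \<in> Cn A" "s \<in> Cn A"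
    by (auto simp: ext_def)
  then show ?case using 2 unfolding ext_def
    by (intro CollectI exI[of _ "\<lambda>a. p a + r a"] exI[of _ "\<lambda>a. q a + s a"]) (auto simp: Cn_def)
next
  case (3 c x)
  then obtain p q where "x = (\<lambda>b. p b + q b)" "p \<in> Q" "q \<in> Cn A"
    by (auto simp: ext_def)
  then show ?case using 3 unfolding ext_def
    by (intro CollectI exI[of _ "\<lambda>a. c * p a"] exI[of _ "\<lambda>a. c * q a"]) (auto simp: Cn_def algebra_simps)
qed

lemma ext_superset: "lsub Q \<Longrightarrow> Q \<subseteq> ext A Q" "lsub Q \<Longrightarrow> Cn A \<subseteq> ext A Q"
proof -
  show "Q \<subseteq> ext A Q" if "lsub Q"
    unfolding ext_def by (intro subsetI CollectI, rule_tac x = x in exI, rule_tac x = "\<lambda>_. 0" in exI)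
      (auto simp: Cn_def)
  show "Cn A \<subseteq> ext A Q" if "lsub Q"
    unfolding ext_def using lsub_zero[OF that]
    by (intro subsetI CollectI, rule_tac x = "\<lambda>_. 0" in exI, rule_tac x = x in exI) auto
qed

lemma ext_subset: "lsub P \<Longrightarrow> Q \<subseteq> P \<Longrightarrow> Cn A \<subseteq> P \<Longrightarrow> ext A Q \<subseteq> P"
  unfolding ext_def by (auto intro: lsub_add)

lemma ext_mono: "Q \<subseteq> Q' \<Longrightarrow> ext A Q \<subseteq> ext A Q'"
  unfolding ext_def by blast

lemma ext_Cn: "ext A (Cn D) = Cn (A \<union> D)"
proof
  show "ext A (Cn D) \<subseteq> Cn (A \<union> D)" by (intro ext_subset lsub_Cn Cn_mono) auto
  show "Cn (A \<union> D) \<subseteq> ext A (Cn D)"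
  proof
    fix x assume x: "x \<in> Cn (A \<union> D)"
    have "x = (\<lambda>b. (if b \<in> A then 0 else x b) + (if b \<in> A then x b else 0))" by auto
    moreover have "(\<lambda>b. if b \<in> A then 0 else x b) \<in> Cn D" "(\<lambda>b. if b \<in> A then x b else 0) \<in> Cn A"
      using x by (auto simp: Cn_def)
    ultimately show "x \<in> ext A (Cn D)" by (rule extI[rotated 2])
  qed
qed

lemma ext_Int:
  assumes "lsub Q" "Q \<subseteq> Cn D" "A \<inter> D = {}"
  shows "ext A Q \<inter> Cn D = Q"
proof
  show "ext A Q \<inter> Cn D \<subseteq> Q"
  proof
    fix w assume "w \<in> ext A Q \<inter> Cn D"
    then obtain x y where w: "w = (\<lambda>b. x b + y b)" "x \<in> Q" "y \<in> Cn A" "w \<in> Cn D" by (auto simp: ext_def)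
    have "x b + y b = x b" for b
    proof (cases "b \<in> A")
      case True
      then have "b \<notin> D" using assms(3) by auto
      then have "w b = 0" "x b = 0" using w assms(2) by (auto simp: Cn_def)
      then show ?thesis using w(1) by simp
    qed (use w in \<open>auto simp: Cn_def\<close>)
    then show "w \<in> Q" using w by simp
  qed
qed (use assms ext_superset(1)[OF assms(1)] in auto)

lemma Int_ext:
  assumes "lsub P" "Cn A \<subseteq> P" "P \<subseteq> Cn (A \<union> D)"
  shows "ext A (P \<inter> Cn D) = P"
proof
  show "ext A (P \<inter> Cn D) \<subseteq> P" by (rule ext_subset) (use assms in auto)
  show "P \<subseteq> ext A (P \<inter> Cn D)"
  proof
    fix w assume w: "w \<in> P"
    let ?y = "\<lambda>b. if b \<in> A then w b else 0"
    have y: "?y \<in> Cn A" by (auto simp: Cn_def)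
    have "(\<lambda>b. w b - ?y b) \<in> P" using w y assms by (intro lsub_diff) auto
    moreover have "(\<lambda>b. w b - ?y b) \<in> Cn D" using w assms(3) by (auto simp: Cn_def)
    moreover have "w = (\<lambda>b. (w b - ?y b) + ?y b)" by auto
    ultimately show "w \<in> ext A (P \<inter> Cn D)" using y by (intro extI[of "\<lambda>b. w b - ?y b" _ ?y]) auto
  qed
qed

lemma lsub_Int: "lsub P \<Longrightarrow> lsub Q \<Longrightarrow> lsub (P \<inter> Q)"
  by (auto simp: lsub_def)

locale split_coords =
  fixes S A D :: "nat set"
  assumes fin: "finite S" and sub: "A \<subseteq> S" "D \<subseteq> S" and disj: "A \<inter> D = {}"
begin

lemma finA: "finite A" and finD: "finite D"
  using fin sub finite_subset by blast+

lemma chart_reduce: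
  assumes "lsub P" "Cn A \<subseteq> P" "P \<subseteq> Cn (A \<union> D)" "chart I (P \<inter> Cn D)" "I \<subseteq> D"
  shows "chart (I \<union> A) P"
  unfolding chart_def
proof (intro conjI ballI impI)
  fix a assume a: "a \<in> I \<union> A"
  show "\<exists>s\<in>P. \<forall>b\<in>I \<union> A. s b = unitv a b"
  proof (cases "a \<in> A")
    case True
    then show ?thesis using assms(2) unitv_Cn by blast
  next
    case False
    then have aI: "a \<in> I" using a by simp
    have "rr I (P \<inter> Cn D) a b = unitv a b" if "b \<in> A" for b
      using that rr(1)[OF assms(4) aI] disj False by (auto simp: Cn_def unitv_def)
    then show ?thesis using rr[OF assms(4) aI] by (intro bexI[of _ "rr I (P \<inter> Cn D) a"]) auto
  qed
next
  fix w assume w: "w \<in> P" "\<forall>b\<in>I \<union> A. w b = 0"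
  then have "w \<in> Cn D" using assms(3) by (auto simp: Cn_def)
  then show "\<forall>b. w b = 0" using w assms(4) by (auto simp: chart_def)
qed

lemma reduce_Gs:
  assumes "P \<in> Gs S (k + card A)" "Cn A \<subseteq> P" "P \<subseteq> Cn (A \<union> D)"
  shows "P \<inter> Cn D \<in> Gs D k"
proof -
  have l: "lsub P" using assms by (auto simp: Gs_def)
  then have l': "lsub (P \<inter> Cn D)" by (intro lsub_Int lsub_Cn)
  obtain I where I: "I \<subseteq> D" "chart I (P \<inter> Cn D)" using row_reduce[OF l' _ finD] by auto
  have "card (I \<union> A) = k + card A"
    by (rule Gs_card[OF fin assms(1) chart_reduce[OF l assms(2,3) I(2,1)]]) (use I sub in auto)
  moreover have "card (I \<union> A) = card I + card A"
    using I disj finA finD by (intro card_Un_disjoint) (auto intro: finite_subset)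
  ultimately show ?thesis using I l' by (auto simp: Gs_def)
qed

lemma ext_Gs:
  assumes "Q \<in> Gs D k"
  shows "ext A Q \<in> Gs S (k + card A)"
proof -
  obtain I where I: "I \<subseteq> D" "card I = k" "chart I Q" "finite I" "lsub Q" "Q \<subseteq> Cn D"
    using Gs_chartE[OF finD assms] by metis
  have e: "ext A Q \<inter> Cn D = Q" by (rule ext_Int[OF I(5,6) disj])
  have sub1: "ext A Q \<subseteq> Cn (A \<union> D)" using ext_mono[OF I(6)] ext_Cn by blast
  have "chart (I \<union> A) (ext A Q)"
    by (rule chart_reduce[OF lsub_ext[OF I(5)] ext_superset(2)[OF I(5)] sub1]) (use I e in auto)
  moreover have "card (I \<union> A) = k + card A"
    using I disj finA by (subst card_Un_disjoint) auto
  moreover have "ext A Q \<subseteq> Cn S" using sub1 Cn_mono[of "A \<union> D" S] sub by blast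
  moreover have "I \<union> A \<subseteq> S" using I sub by auto
  ultimately show ?thesis using lsub_ext[OF I(5)] unfolding Gs_def mem_Collect_eq
    by (intro conjI exI[of _ "I \<union> A"]) assumption+
qed

text \<open>A chart I of the intersection extends to the chart \<open>I \<union> A\<close> of \<open>f z\<close>; the members of its reduced
  basis that belong to I vanish on A and therefore form a basis of the intersection.\<close>

lemma continuous_reduce:
  assumes f: "continuous_map Z (Gr S (k + card A)) f"
    and b: "\<And>z. z \<in> topspace Z \<Longrightarrow> Cn A \<subseteq> f z \<and> f z \<subseteq> Cn (A \<union> D)"
  shows "continuous_map Z (Gr D k) (\<lambda>z. f z \<inter> Cn D)"
proof (rule continuous_map_locally)
  have fG: "f z \<in> Gs S (k + card A)" if "z \<in> topspace Z" for z
    using f that topspace_Gr[OF fin] by (auto simp: continuous_map_def)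
  fix z assume z: "z \<in> topspace Z"
  have Q: "f z \<inter> Cn D \<in> Gs D k" using reduce_Gs fG b z by blast
  then obtain I where I: "I \<subseteq> D" "card I = k" "chart I (f z \<inter> Cn D)" "finite I"
    using Gs_chartE[OF finD] by metis
  have cIA: "card (I \<union> A) = k + card A"
    using I disj finA by (subst card_Un_disjoint) auto
  let ?U = "{z \<in> topspace Z. chart (I \<union> A) (f z)}"
  have IAS: "I \<union> A \<subseteq> S" using I sub by auto
  have "chart (I \<union> A) (f z)"
    by (rule chart_reduce) (use fG[OF z] b[OF z] I in \<open>auto simp: Gs_def\<close>)
  moreover have "continuous_map (subtopology Z ?U) (Gr D k) (\<lambda>z. f z \<inter> Cn D)"
  proof (rule continuous_map_into_Gr[OF finD I(4,2), where v = "\<lambda>z. rr (I \<union> A) (f z)"])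
    fix z assume "z \<in> topspace (subtopology Z ?U)"
    then have z: "z \<in> topspace Z" "chart (I \<union> A) (f z)" by auto
    have r: "rr (I \<union> A) (f z) a \<in> f z \<inter> Cn D" if "a \<in> I" for a
    proof -
      have "rr (I \<union> A) (f z) a \<in> f z" using rr(1)[OF z(2)] that by auto
      moreover have "rr (I \<union> A) (f z) a c = 0" if "c \<in> A" for c
      proof -
        have "c \<noteq> a" using that \<open>a \<in> I\<close> I disj by auto
        then show ?thesis using rr(2)[OF z(2), of a c] that \<open>a \<in> I\<close> by (simp add: unitv_def)
      qed
      ultimately show ?thesis using b[OF z(1)] by (auto simp: Cn_def)
    qed
    have ind: "indep I (rr (I \<union> A) (f z))" by (rule indep_dual) (use I rr(2)[OF z(2)] in auto)
    have "f z \<inter> Cn D = sp I (rr (I \<union> A) (f z))"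
      by (rule Gs_sp_eq[OF finD I(4,2)]) (use reduce_Gs fG b z r ind in auto)
    then show "f z \<inter> Cn D = sp I (rr (I \<union> A) (f z)) \<and> indep I (rr (I \<union> A) (f z)) \<and>
        (\<forall>a\<in>I. rr (I \<union> A) (f z) a \<in> Cn D)" using r ind by auto
  next
    show "continuous_map (subtopology Z ?U) euclidean (\<lambda>z. rr (I \<union> A) (f z) a b)" if "a \<in> I" for a b
      by (rule rr_continuous_comp[OF fin f IAS cIA]) (use that in auto)
  qed
  ultimately show "\<exists>U. openin Z U \<and> z \<in> U \<and> continuous_map (subtopology Z U) (Gr D k) (\<lambda>z. f z \<inter> Cn D)"
    using chart_preimage_openin[OF fin f IAS cIA] z by (intro exI[of _ ?U]) auto
qed

lemma continuous_ext:
  assumes f: "continuous_map Z (Gr D k) f"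
  shows "continuous_map Z (Gr S (k + card A)) (\<lambda>z. ext A (f z))"
proof (rule chart_cover[OF finD f])
  have fG: "f z \<in> Gs D k" if "z \<in> topspace Z" for z
    using f that topspace_Gr[OF finD] by (auto simp: continuous_map_def)
  fix I assume I: "I \<subseteq> D" "card I = k"
  let ?Z = "subtopology Z {z \<in> topspace Z. chart I (f z)}"
  let ?v = "\<lambda>z a. if a \<in> A then unitv a else rr I (f z) a"
  have finI: "finite (I \<union> A)" using I finA finD finite_subset by blast
  have cIA: "card (I \<union> A) = k + card A"
    using I disj finI by (subst card_Un_disjoint) auto
  show "continuous_map ?Z (Gr S (k + card A)) (\<lambda>z. ext A (f z))"
  proof (rule continuous_map_into_Gr[OF fin finI cIA, where v = ?v])
    fix z assume "z \<in> topspace ?Z"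
    then have z: "z \<in> topspace Z" "chart I (f z)" by auto
    have l: "lsub (f z)" "f z \<subseteq> Cn D" using fG[OF z(1)] by (auto simp: Gs_def)
    have v: "?v z a \<in> ext A (f z)" if "a \<in> I \<union> A" for a
      using that ext_superset[OF l(1), of A] rr(1)[OF z(2)] by (auto simp: unitv_Cn)
    have dual: "?v z a b = unitv a b" if ab: "a \<in> I \<union> A" "b \<in> I \<union> A" for a b
    proof (cases "a \<in> A")
      case False
      then have aI: "a \<in> I" using ab by simp
      show ?thesis
      proof (cases "b \<in> I")
        case False
        then have "b \<in> A" using ab by simp
        moreover have "b \<notin> D" using \<open>b \<in> A\<close> disj by auto
        ultimately show ?thesis using rr(1)[OF z(2) aI] l(2) \<open>a \<notin> A\<close> by (auto simp: Cn_def unitv_def)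
      qed (use rr(2)[OF z(2) aI] \<open>a \<notin> A\<close> in auto)
    qed simp
    have ind: "indep (I \<union> A) (?v z)" by (rule indep_dual[OF finI dual])
    have "ext A (f z) = sp (I \<union> A) (?v z)"
      by (rule Gs_sp_eq[OF fin finI cIA ext_Gs[OF fG[OF z(1)]] ind v])
    moreover have "ext A (f z) \<subseteq> Cn S" using ext_Gs[OF fG[OF z(1)]] by (auto simp: Gs_def)
    ultimately show "ext A (f z) = sp (I \<union> A) (?v z) \<and> indep (I \<union> A) (?v z) \<and>
        (\<forall>a\<in>I \<union> A. ?v z a \<in> Cn S)" using v ind by blast
  next
    fix a b assume a: "a \<in> I \<union> A"
    show "continuous_map ?Z euclidean (\<lambda>z. ?v z a b)"
    proof (cases "a \<in> A")
      case False
      then show ?thesis using rr_continuous_comp[OF finD f I, of a b] a by simp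
    qed simp
  qed
qed

end

section \<open>Moving a subspace within its chart\<close>

lemma Cn_expand: "finite T \<Longrightarrow> x \<in> Cn T \<Longrightarrow> (\<Sum>a\<in>T. x a * unitv a c) = x c"
  by (auto simp: unitv_def Cn_def if_distrib[of "\<lambda>z. _ * z"] cong: if_cong)

text \<open>This fixes the coordinates in I and changes the others by a multiple of \<open>\<Sum>\<^sub>d y\<^sub>d r\<^sub>d\<close>, hence it is
  invertible with the inverse given by \<open>- \<epsilon>\<close>. The sign parameter avoids a second definition.\<close>

definition shear :: "complex \<Rightarrow> nat set \<Rightarrow> (nat \<Rightarrow> cvec) \<Rightarrow> cvec \<Rightarrow> cvec"
  where "shear \<epsilon> I r y = (\<lambda>e. if e \<in> I then y e else y e + \<epsilon> * (\<Sum>d\<in>I. y d * r d e))"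

lemma shear_inverse: "shear (- \<epsilon>) I r (shear \<epsilon> I r y) = y"
  by (auto simp: shear_def)

lemma shear_fixes: "(\<And>d. d \<in> I \<Longrightarrow> y d = 0) \<Longrightarrow> shear \<epsilon> I r y = y"
  by (auto simp: shear_def)

lemma shear_Cn:
  assumes "\<And>d. d \<in> I \<Longrightarrow> r d \<in> Cn X" "y \<in> Cn X"
  shows "shear \<epsilon> I r y \<in> Cn X"
  using assms by (auto simp: shear_def Cn_def intro!: sum.neutral)

locale chart_shear =
  fixes T D I J :: "nat set" and \<pi> :: "nat \<Rightarrow> nat"
  assumes finT: "finite T" and DT: "D \<subseteq> T" and ID: "I \<subseteq> D"
    and perm: "\<pi> permutes D" and piJ: "\<pi> ` J = I"
begin

text \<open>For a subspace Q of \<open>Cn D\<close> with index set I, the map \<open>fwd Q\<close> carries the coordinate subspace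
  \<open>Cn J\<close> to Q: the permutation carries it to \<open>Cn I\<close>, and the shear, which adds the part of the
  reduced basis of Q outside I, carries \<open>Cn I\<close> to Q.\<close>

definition fwd :: "cvec set \<Rightarrow> cvec \<Rightarrow> cvec"
  where "fwd Q x = shear 1 I (rr I Q) (x \<circ> inv_into UNIV \<pi>)"

definition bwd :: "cvec set \<Rightarrow> cvec \<Rightarrow> cvec"
  where "bwd Q x = shear (-1) I (rr I Q) x \<circ> \<pi>"

lemma finI: "finite I"
  by (rule finite_subset[OF ID finite_subset[OF DT finT]])

lemma bwd_fwd: "bwd Q (fwd Q x) = x"
proof -
  have "shear (-1) I (rr I Q) (shear 1 I (rr I Q) (x \<circ> inv_into UNIV \<pi>)) = x \<circ> inv_into UNIV \<pi>"
    by (rule shear_inverse)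
  then show ?thesis unfolding fwd_def bwd_def
    by (intro ext) (simp only: comp_apply permutes_inverses[OF perm])
qed

lemma fwd_bwd: "fwd Q (bwd Q x) = x"
proof -
  let ?y = "shear (-1) I (rr I Q) x"
  have "(?y \<circ> \<pi>) \<circ> inv_into UNIV \<pi> = ?y"
    by (intro ext) (simp only: comp_apply permutes_inverses[OF perm])
  moreover have "shear (- (-1)) I (rr I Q) ?y = x" by (rule shear_inverse)
  ultimately show ?thesis unfolding fwd_def bwd_def by (simp only: minus_minus)
qed

lemma bwd_add: "bwd Q (\<lambda>b. x b + y b) = (\<lambda>b. bwd Q x b + bwd Q y b)"
  by (auto simp: bwd_def shear_def sum.distrib algebra_simps)

lemma fixes_Cn:
  assumes "x \<in> Cn X" "X \<inter> D = {}"
  shows "fwd Q x = x" "bwd Q x = x"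
proof -
  have x0: "x d = 0" if "d \<in> D" for d using assms that by (auto simp: Cn_def)
  have "x (inv_into UNIV \<pi> b) = x b" for b
    using permutes_in_image[OF permutes_inv[OF perm], of b] permutes_not_in[OF permutes_inv[OF perm], of b] x0
    by (cases "b \<in> D") auto
  then have 1: "x \<circ> inv_into UNIV \<pi> = x" by auto
  have "x (\<pi> b) = x b" for b
    using permutes_in_image[OF perm, of b] permutes_not_in[OF perm, of b] x0 by (cases "b \<in> D") auto
  then have 2: "x \<circ> \<pi> = x" by auto
  have 3: "shear \<epsilon> I (rr I Q) x = x" for \<epsilon> by (rule shear_fixes) (use x0 ID in auto)
  show "fwd Q x = x" "bwd Q x = x" by (simp_all add: fwd_def bwd_def 1 2 3)
qed

lemma fixes_Cn_image:
  assumes "X \<inter> D = {}"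
  shows "fwd Q ` Cn X = Cn X" "bwd Q ` Cn X = Cn X"
  using fixes_Cn[OF _ assms] by (auto simp: image_iff)

lemma perm_Cn:
  assumes "\<sigma> permutes D" "D \<subseteq> X" "x \<in> Cn X"
  shows "x \<circ> \<sigma> \<in> Cn X"
  unfolding Cn_def
proof (intro CollectI allI impI)
  fix a assume "a \<notin> X"
  then have "\<sigma> a = a" using assms(2) by (intro permutes_not_in[OF assms(1)]) auto
  then show "(x \<circ> \<sigma>) a = 0" using assms(3) \<open>a \<notin> X\<close> by (simp add: Cn_def)
qed

lemma preserves_Cn:
  assumes Q: "chart I Q" "Q \<subseteq> Cn D" and X: "D \<subseteq> X" "x \<in> Cn X"
  shows "fwd Q x \<in> Cn X" "bwd Q x \<in> Cn X"
proof -
  have r: "rr I Q d \<in> Cn X" if "d \<in> I" for d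
    using rr(1)[OF Q(1) that] Q(2) Cn_mono[OF X(1)] by blast
  show "fwd Q x \<in> Cn X"
    unfolding fwd_def by (rule shear_Cn[OF r perm_Cn[OF permutes_inv[OF perm] X]])
  show "bwd Q x \<in> Cn X"
    unfolding bwd_def by (rule perm_Cn[OF perm X(1) shear_Cn[OF r X(2)]])
qed

text \<open>A vector x of Q is the combination of the reduced basis with its own coordinates in I, and the
  shear subtracts exactly this combination off I; the permutation then carries I back to J.\<close>

lemma bwd_Q:
  assumes Q: "lsub Q" "chart I Q" and x: "x \<in> Q"
  shows "bwd Q x \<in> Cn J"
  unfolding Cn_def
proof (intro CollectI allI impI)
  fix a assume a: "a \<notin> J"
  have "\<pi> a \<notin> I"
  proof
    assume "\<pi> a \<in> I"
    then obtain c where "c \<in> J" "\<pi> a = \<pi> c" using piJ by auto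
    then show False using a permutes_inj[OF perm] by (auto dest: injD)
  qed
  then have "bwd Q x a = x (\<pi> a) - lc I x (rr I Q) (\<pi> a)" by (simp add: bwd_def shear_def lc_def)
  then show "bwd Q x a = 0" using chart_expand[OF Q finI x] by simp
qed

lemma fwd_linear:
  assumes "x \<in> Cn T"
  shows "fwd Q x = lc T x (\<lambda>a. fwd Q (unitv a))"
proof
  fix e
  have x: "(\<Sum>a\<in>T. x a * unitv a c) = x c" for c by (rule Cn_expand[OF finT assms])
  have "(\<Sum>a\<in>T. x a * (\<Sum>d\<in>I. unitv a (inv_into UNIV \<pi> d) * rr I Q d e)) =
      (\<Sum>d\<in>I. (\<Sum>a\<in>T. x a * unitv a (inv_into UNIV \<pi> d)) * rr I Q d e)"
    by (simp add: sum_distrib_left sum_distrib_right mult.assoc) (rule sum.swap)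
  then show "fwd Q x e = lc T x (\<lambda>a. fwd Q (unitv a)) e"
    by (simp add: fwd_def shear_def lc_def x distrib_left sum.distrib)
qed

lemma bwd_linear:
  assumes "x \<in> Cn T"
  shows "bwd Q x = lc T x (\<lambda>a. bwd Q (unitv a))"
proof
  fix e
  have x: "(\<Sum>a\<in>T. x a * unitv a c) = x c" for c by (rule Cn_expand[OF finT assms])
  have "(\<Sum>a\<in>T. x a * (\<Sum>d\<in>I. unitv a d * rr I Q d (\<pi> e))) =
      (\<Sum>d\<in>I. (\<Sum>a\<in>T. x a * unitv a d) * rr I Q d (\<pi> e))"
    by (simp add: sum_distrib_left sum_distrib_right mult.assoc) (rule sum.swap)
  then show "bwd Q x e = lc T x (\<lambda>a. bwd Q (unitv a)) e"
    by (simp add: bwd_def shear_def lc_def x right_diff_distrib sum_subtractf)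
qed

lemma continuous_coeffs:
  assumes q: "continuous_map Z (Gr D (card I)) q" and ch: "\<And>z. z \<in> topspace Z \<Longrightarrow> chart I (q z)"
  shows "continuous_map Z euclidean (\<lambda>z. fwd (q z) x e)"
    "continuous_map Z euclidean (\<lambda>z. bwd (q z) x e)"
proof -
  have "{z \<in> topspace Z. chart I (q z)} = topspace Z" using ch by auto
  then have r: "continuous_map Z euclidean (\<lambda>z. rr I (q z) d c)" if "d \<in> I" for d c
    using rr_continuous_comp[OF finite_subset[OF DT finT] q ID refl that] by simp
  show "continuous_map Z euclidean (\<lambda>z. fwd (q z) x e)"
  proof (cases "e \<in> I")
    case False
    then show ?thesis unfolding fwd_def shear_def
      by (simp, intro continuous_map_add continuous_map_sum continuous_map_complex_mult r finI) auto
  qed (simp add: fwd_def shear_def)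
  show "continuous_map Z euclidean (\<lambda>z. bwd (q z) x e)"
  proof (cases "\<pi> e \<in> I")
    case False
    then show ?thesis unfolding bwd_def shear_def
      by (simp, intro continuous_map_diff continuous_map_sum continuous_map_complex_mult r finI) auto
  qed (simp add: bwd_def shear_def)
qed

lemma fwd_inj: "inj_on (\<lambda>x. lc T x (\<lambda>a. fwd Q (unitv a))) (Cn T)"
proof (rule inj_onI)
  fix x y assume "x \<in> Cn T" "y \<in> Cn T" "lc T x (\<lambda>a. fwd Q (unitv a)) = lc T y (\<lambda>a. fwd Q (unitv a))"
  then have "fwd Q x = fwd Q y" by (simp only: fwd_linear)
  then have "bwd Q (fwd Q x) = bwd Q (fwd Q y)" by (rule arg_cong)
  then show "x = y" by (simp only: bwd_fwd)
qed

lemma bwd_inj: "inj_on (\<lambda>x. lc T x (\<lambda>a. bwd Q (unitv a))) (Cn T)"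
proof (rule inj_onI)
  fix x y assume "x \<in> Cn T" "y \<in> Cn T" "lc T x (\<lambda>a. bwd Q (unitv a)) = lc T y (\<lambda>a. bwd Q (unitv a))"
  then have "bwd Q x = bwd Q y" by (simp only: bwd_linear)
  then have "fwd Q (bwd Q x) = fwd Q (bwd Q y)" by (rule arg_cong)
  then show "x = y" by (simp only: fwd_bwd)
qed

lemma fwd_image: "W \<subseteq> Cn T \<Longrightarrow> fwd Q ` W = (\<lambda>x. lc T x (\<lambda>a. fwd Q (unitv a))) ` W"
  using fwd_linear by (intro image_cong) auto

lemma bwd_image: "W \<subseteq> Cn T \<Longrightarrow> bwd Q ` W = (\<lambda>x. lc T x (\<lambda>a. bwd Q (unitv a))) ` W"
  using bwd_linear by (intro image_cong) auto

lemma unit_Cn: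
  assumes "chart I Q" "Q \<subseteq> Cn D" "a \<in> T"
  shows "fwd Q (unitv a) \<in> Cn T" "bwd Q (unitv a) \<in> Cn T"
  using preserves_Cn[OF assms(1,2) DT, of "unitv a"] assms(3) unitv_Cn by auto

lemma Gs_images:
  assumes Q: "chart I Q" "Q \<subseteq> Cn D" and W: "W \<in> Gs T k"
  shows "fwd Q ` W \<in> Gs T k" "bwd Q ` W \<in> Gs T k"
proof -
  have WT: "W \<subseteq> Cn T" using W by (auto simp: Gs_def)
  show "fwd Q ` W \<in> Gs T k"
    unfolding fwd_image[OF WT] by (rule image_Gs[OF finT finT W unit_Cn(1)[OF Q] fwd_inj])
  show "bwd Q ` W \<in> Gs T k"
    unfolding bwd_image[OF WT] by (rule image_Gs[OF finT finT W unit_Cn(2)[OF Q] bwd_inj])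
qed

lemma continuous_images:
  assumes q: "continuous_map Z (Gr D (card I)) q" and ch: "\<And>z. z \<in> topspace Z \<Longrightarrow> chart I (q z)"
    and f: "continuous_map Z (Gr T k) f"
  shows "continuous_map Z (Gr T k) (\<lambda>z. fwd (q z) ` f z)"
    "continuous_map Z (Gr T k) (\<lambda>z. bwd (q z) ` f z)"
proof -
  have finD: "finite D" by (rule finite_subset[OF DT finT])
  have qD: "q z \<subseteq> Cn D" if "z \<in> topspace Z" for z
    using q that topspace_Gr[OF finD] by (auto simp: continuous_map_def Gs_def)
  have fT: "f z \<subseteq> Cn T" if "z \<in> topspace Z" for z
    using f that topspace_Gr[OF finT] by (auto simp: continuous_map_def Gs_def)
  have "continuous_map Z (Gr T k) (\<lambda>z. (\<lambda>x. lc T x (\<lambda>a. fwd (q z) (unitv a))) ` f z)"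
    by (rule continuous_action[OF finT finT f unit_Cn(1)[OF ch qD] fwd_inj continuous_coeffs(1)[OF q ch]])
  then show "continuous_map Z (Gr T k) (\<lambda>z. fwd (q z) ` f z)"
    by (rule continuous_map_eq) (simp add: fwd_image[OF fT])
  have "continuous_map Z (Gr T k) (\<lambda>z. (\<lambda>x. lc T x (\<lambda>a. bwd (q z) (unitv a))) ` f z)"
    by (rule continuous_action[OF finT finT f unit_Cn(2)[OF ch qD] bwd_inj continuous_coeffs(2)[OF q ch]])
  then show "continuous_map Z (Gr T k) (\<lambda>z. bwd (q z) ` f z)"
    by (rule continuous_map_eq) (simp add: bwd_image[OF fT])
qed

end

lemma permutation_between:
  assumes "finite D" "J \<subseteq> D" "I \<subseteq> D" "card J = card I"
  obtains \<pi> where "\<pi> permutes D" "\<pi> ` J = I"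
proof -
  have fin: "finite I" "finite J" using assms finite_subset by blast+
  obtain f where f: "bij_betw f J I" using assms fin by (meson finite_same_card_bij)
  have "card (D - J) = card (D - I)" using assms fin by (simp add: card_Diff_subset)
  then obtain g where g: "bij_betw g (D - J) (D - I)"
    using assms by (meson finite_Diff finite_same_card_bij)
  let ?\<pi> = "\<lambda>x. if x \<in> J then f x else if x \<in> D then g x else x"
  have im: "?\<pi> ` J = I" using f by (auto simp: bij_betw_def)
  have "bij_betw ?\<pi> (J \<union> (D - J)) (I \<union> (D - I))"
  proof (rule bij_betw_combine)
    show "bij_betw ?\<pi> J I" using bij_betw_cong[of J ?\<pi> f I] f by simp
    show "bij_betw ?\<pi> (D - J) (D - I)" using bij_betw_cong[of "D - J" ?\<pi> g "D - I"] g by simp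
  qed auto
  then have "bij_betw ?\<pi> D D" using assms by (simp add: Un_absorb1)
  then have "?\<pi> permutes D" by (rule bij_imp_permutes) (use assms in auto)
  then show thesis using im that by blast
qed

section \<open>The tower over the coordinate flag\<close>

text \<open>The numbers \<open>i\<^sub>0 = 0 < i\<^sub>1 < \<dots> < i\<^sub>b = n\<close>. For \<open>n = 0\<close> the least positive exponent b is 1, and
  \<open>i\<^sub>0 = i\<^sub>1\<close>; in this case only, the sequence is not strictly increasing.\<close>

locale hook_data =
  fixes n b :: nat and i :: "nat \<Rightarrow> nat"
  assumes b1: "1 \<le> b" and i0: "i 0 = 0" and ib: "i b = n"
    and step: "j < b \<Longrightarrow> 0 < n \<Longrightarrow> i j < i (Suc j)"
    and n0: "n = 0 \<Longrightarrow> b = 1"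
begin

abbreviation T :: "nat set" where "T \<equiv> {1..n}"

text \<open>The coordinate flag, and the index sets of the images and kernels that bound the flags in K: in
  terms of N, the space \<open>Cn (low j)\<close> is \<open>im N\<^sup>b\<^sup>-\<^sup>j\<close> and \<open>Cn (high j)\<close> is \<open>ker N\<^sup>j\<close> for \<open>0 < j < b\<close>.\<close>

definition E :: "nat \<Rightarrow> cvec set" where "E l = Cn {1..l}"
definition low :: "nat \<Rightarrow> nat set" where "low j = i ` {1..j}"
definition high :: "nat \<Rightarrow> nat set" where "high j = T - i ` {j<..b}"

definition K :: "(nat \<Rightarrow> cvec set) set"
  where "K = {F \<in> Fls T. \<forall>j\<in>{1..<b}. Cn (low j) \<subseteq> F (i j) \<and> F (i j) \<subseteq> Cn (high j)}"

definition Zs :: "nat \<Rightarrow> (nat \<Rightarrow> cvec set) set"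
  where "Zs j = {F \<in> K. \<forall>l\<le>i j. F l = E l}"

definition Ys :: "nat \<Rightarrow> (nat \<Rightarrow> cvec set) set"
  where "Ys j = {F \<in> Zs j. F (i (Suc j)) = E (i (Suc j))}"

text \<open>The coordinates of \<open>ker N\<^sup>j\<^sup>+\<^sup>1\<close> modulo \<open>E(i\<^sub>j)\<close> and \<open>im N\<^sup>b\<^sup>-\<^sup>j\<^sup>-\<^sup>1\<close>. As \<open>i\<^sub>j\<^sub>+\<^sub>1\<close> is among the
  indices removed, these coordinates describe the subspaces between \<open>E(i\<^sub>j) + \<complex> e(i\<^sub>j\<^sub>+\<^sub>1)\<close> and
  \<open>ker N\<^sup>j\<^sup>+\<^sup>1\<close>.\<close>

definition odd_index :: "nat \<Rightarrow> nat set"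
  where "odd_index j = T - {1..i j} - i ` {j<..b}"

lemma strict: "j < k \<Longrightarrow> k \<le> b \<Longrightarrow> 0 < n \<Longrightarrow> i j < i k"
proof (induction k)
  case (Suc k)
  then show ?case using step[of k] by (cases "j = k") auto
qed simp

lemma pos_n: "1 < b \<Longrightarrow> 0 < n"
  using n0 by (cases "n = 0") auto

lemma mono: "j \<le> k \<Longrightarrow> k \<le> b \<Longrightarrow> i j \<le> i k"
proof (cases "0 < n")
  case True
  assume "j \<le> k" "k \<le> b"
  then show ?thesis using strict[of j k] True by (cases "j = k") auto
next
  case False
  assume jk: "j \<le> k" "k \<le> b"
  from False have "n = 0" "b = 1" using n0 by auto
  then have "k = 0 \<or> k = 1" "j = 0 \<or> j = 1" "i 1 = 0" using jk ib by auto
  then show ?thesis using i0 by auto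
qed

lemma i_le_n: "j \<le> b \<Longrightarrow> i j \<le> n"
  using mono[of j b] ib by simp

lemma i_pos: "1 \<le> j \<Longrightarrow> j \<le> b \<Longrightarrow> 0 < n \<Longrightarrow> 1 \<le> i j"
  using strict[of 0 j] i0 by simp

lemma i_eq: "j \<le> b \<Longrightarrow> k \<le> b \<Longrightarrow> 0 < n \<Longrightarrow> i j = i k \<longleftrightarrow> j = k"
  using strict[of j k] strict[of k j] by (cases j k rule: linorder_cases) auto

lemma low_sub: "j < b \<Longrightarrow> low j \<subseteq> {1..i j}"
  unfolding low_def using mono[of _ j] i_pos pos_n by (cases "j = 0") fastforce+

lemma sub_high: "j < b \<Longrightarrow> {1..i j} \<subseteq> high j"
proof
  fix a assume j: "j < b" and a: "a \<in> {1..i j}"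
  have "a \<noteq> i k" if "k \<in> {j<..b}" for k
  proof -
    have "0 < n" using a i_le_n[of j] j by auto
    then show ?thesis using strict[of j k] that a by auto
  qed
  then have "a \<notin> i ` {j<..b}" by blast
  then show "a \<in> high j" using a i_le_n[of j] j by (auto simp: high_def)
qed

lemma Cn_Gs: "finite S \<Longrightarrow> A \<subseteq> S \<Longrightarrow> Cn A \<in> Gs S (card A)"
proof -
  assume S: "finite S" "A \<subseteq> S"
  have "chart A (Cn A)"
    unfolding chart_def
  proof (intro conjI ballI impI)
    fix a assume "a \<in> A"
    then have "unitv a \<in> Cn A" by (simp add: unitv_Cn)
    then show "\<exists>s\<in>Cn A. \<forall>b\<in>A. s b = unitv a b" by blast
  next
    fix w assume w: "w \<in> Cn A" "\<forall>b\<in>A. w b = 0"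
    show "\<forall>b. w b = 0"
    proof
      fix b show "w b = 0" using w by (cases "b \<in> A") (auto simp: Cn_def)
    qed
  qed
  then show ?thesis using S(2) Cn_mono[OF S(2)] lsub_Cn[of A] unfolding Gs_def by blast
qed

lemma E_Gs: "l \<le> n \<Longrightarrow> E l \<in> Gs T l"
  using Cn_Gs[of T "{1..l}"] by (simp add: E_def)

lemma Gs_full: "finite S \<Longrightarrow> W \<in> Gs S (card S) \<Longrightarrow> W = Cn S"
  by (rule Gs_eqI[of S W "card S" "Cn S"]) (use Cn_Gs[of S S] in \<open>simp_all add: Gs_def\<close>)

lemma Gs_zero: "finite S \<Longrightarrow> W \<in> Gs S 0 \<Longrightarrow> W = Cn {}"
proof -
  assume S: "finite S" "W \<in> Gs S 0"
  have "Cn {} \<in> Gs S 0" using Cn_Gs[of S "{}"] S by simp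
  moreover have "Cn {} = {\<lambda>_. 0}" by (auto simp: Cn_def)
  then have "Cn {} \<subseteq> W" using S lsub_zero[of W] by (simp add: Gs_def)
  ultimately show ?thesis using Gs_eqI[OF S(1) _ S(2)] by metis
qed

lemma E_mono: "l \<le> m \<Longrightarrow> E l \<subseteq> E m"
  unfolding E_def by (rule Cn_mono) auto

lemma E_bounds: "j < b \<Longrightarrow> Cn (low j) \<subseteq> E (i j) \<and> E (i j) \<subseteq> Cn (high j)"
  unfolding E_def using low_sub sub_high Cn_mono by blast

definition Eflag :: "nat \<Rightarrow> cvec set" where "Eflag = (\<lambda>l\<in>{0..n}. E l)"

lemma Eflag_Fls: "Eflag \<in> Fls T"
  using E_Gs E_mono unfolding Fls_def Eflag_def by simp

lemma Eflag_K: "Eflag \<in> K"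
  unfolding K_def
proof (intro CollectI conjI Eflag_Fls ballI)
  fix j assume j: "j \<in> {1..<b}"
  then have "Eflag (i j) = E (i j)" using i_le_n[of j] by (simp add: Eflag_def)
  then show "Cn (low j) \<subseteq> Eflag (i j)" "Eflag (i j) \<subseteq> Cn (high j)" using E_bounds[of j] j by auto
qed

lemma Fls_zero: "F \<in> Fls T \<Longrightarrow> F 0 = E 0"
  using Gs_zero[of T "F 0"] by (auto simp: Fls_def E_def)

lemma Fls_top: "F \<in> Fls T \<Longrightarrow> F n = E n"
  using Gs_full[of T "F n"] by (auto simp: Fls_def E_def)

lemma Fls_undefined: "F \<in> Fls T \<Longrightarrow> n < l \<Longrightarrow> F l = undefined"
  by (auto simp: Fls_def extensional_def)

lemma Zs_0: "Zs 0 = K"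
  using Fls_zero by (auto simp: Zs_def K_def i0)

lemma Zs_b: "Zs b = {Eflag}"
proof -
  have "F = Eflag" if "F \<in> Zs b" for F
  proof
    fix l show "F l = Eflag l"
      using that by (cases "l \<le> n") (auto simp: Zs_def K_def Fls_def Eflag_def ib extensional_def)
  qed
  moreover have "Eflag \<in> Zs b" using Eflag_K by (auto simp: Zs_def Eflag_def ib)
  ultimately show ?thesis by blast
qed

lemma Ys_last: "Ys (b - 1) = Zs (b - 1)"
  using Fls_top b1 by (auto simp: Ys_def Zs_def K_def ib)

lemma Zs_sub: "Zs j \<subseteq> Fls T" and Ys_sub: "Ys j \<subseteq> Fls T"
  by (auto simp: Zs_def Ys_def K_def)

abbreviation ZX :: "nat \<Rightarrow> (nat \<Rightarrow> cvec set) topology" where "ZX j \<equiv> subtopology (Fl T) (Zs j)"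
abbreviation YX :: "nat \<Rightarrow> (nat \<Rightarrow> cvec set) topology" where "YX j \<equiv> subtopology (Fl T) (Ys j)"

lemma topspace_ZX: "topspace (ZX j) = Zs j"
  using Zs_sub topspace_Fl[of T] by auto

lemma topspace_YX: "topspace (YX j) = Ys j"
  using Ys_sub topspace_Fl[of T] by auto

lemma continuous_proj: "l \<le> n \<Longrightarrow> continuous_map (subtopology (Fl T) X) (Gr T l) (\<lambda>F. F l)"
proof -
  assume l: "l \<le> n"
  have "continuous_map (subtopology (Fl T) X) (Fl T) (\<lambda>F. F)"
    by (simp add: continuous_map_from_subtopology)
  then show ?thesis using l unfolding continuous_map_Fl[OF finite_atLeastAtMost] by simp
qed

lemma continuous_map_into_Fl_sub:
  assumes "\<And>z. z \<in> topspace Z \<Longrightarrow> f z \<in> X" "X \<subseteq> Fls T"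
    and "\<And>l. l \<le> n \<Longrightarrow> continuous_map Z (Gr T l) (\<lambda>z. f z l)"
  shows "continuous_map Z (subtopology (Fl T) X) f"
proof -
  have "continuous_map Z (Fl T) f"
    unfolding continuous_map_Fl[OF finite_atLeastAtMost] using assms by auto
  then show ?thesis using assms(1) by (auto simp: continuous_map_in_subtopology)
qed

lemma fiber_bundle_product:
  assumes "homeomorphic_maps X (prod_topology B Y) h h'" "\<And>x. x \<in> topspace X \<Longrightarrow> fst (h x) = p x"
  shows "fiber_bundle X B Y p"
proof (rule fiber_bundleI)
  have "continuous_map X B (fst \<circ> h)"
    using assms(1) by (auto simp: homeomorphic_maps_def intro: continuous_map_compose continuous_map_fst)
  then show p: "continuous_map X B p" by (rule continuous_map_eq) (simp add: assms(2))
  fix y assume "y \<in> topspace B"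
  have "{x \<in> topspace X. p x \<in> topspace B} = topspace X" using p by (auto simp: continuous_map_def)
  then show "\<exists>U h h'. openin B U \<and> y \<in> U \<and>
      homeomorphic_maps (subtopology X {x \<in> topspace X. p x \<in> U}) (prod_topology (subtopology B U) Y) h h' \<and>
      (\<forall>x\<in>topspace X. p x \<in> U \<longrightarrow> fst (h x) = p x)"
    using assms \<open>y \<in> topspace B\<close> by (intro exI[of _ "topspace B"] exI[of _ h] exI[of _ h']) auto
qed

subsection \<open>The flag bundles\<close>

definition even_index :: "nat \<Rightarrow> nat set"
  where "even_index j = {i j<..i (Suc j)}"

definition even_proj :: "nat \<Rightarrow> (nat \<Rightarrow> cvec set) \<Rightarrow> nat \<Rightarrow> cvec set"
  where "even_proj j F = (\<lambda>l\<in>{0..card (even_index j)}. F (i j + l) \<inter> Cn (even_index j))"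

text \<open>The total space is a product. The map to the fiber replaces the part of the flag below \<open>i\<^sub>j\<^sub>+\<^sub>1\<close> by
  that of E. This does not violate the conditions that define K, since they concern the dimensions
  \<open>i\<^sub>1, \<dots>, i\<^sub>b\<^sub>-\<^sub>1\<close> only, none of which lies strictly between \<open>i\<^sub>j\<close> and \<open>i\<^sub>j\<^sub>+\<^sub>1\<close>.\<close>

lemma even_bundle:
  assumes j: "j < b"
  shows "fiber_bundle (YX j) (Fl (even_index j)) (ZX (Suc j)) (even_proj j)"
proof -
  define A where "A = {1..i j}"
  define D where "D = even_index j"
  have ij: "i j \<le> i (Suc j)" "i (Suc j) \<le> n" using mono[of j "Suc j"] i_le_n[of "Suc j"] j by auto
  interpret sc: split_coords T A D
    by unfold_locales (use ij in \<open>auto simp: A_def D_def even_index_def\<close>)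
  have cards: "card A = i j" "card D = i (Suc j) - i j" by (auto simp: A_def D_def even_index_def)
  have AD: "A \<union> D = {1..i (Suc j)}" using ij by (auto simp: A_def D_def even_index_def)
  have finD: "finite D" by (rule sc.finD)
  \<comment> \<open>The map to the fiber, and the inverse g of the product decomposition.\<close>
  define q where "q F = (\<lambda>l\<in>{0..n}. if l \<le> i (Suc j) then E l else F l)" for F :: "nat \<Rightarrow> cvec set"
  define g where "g f F = (\<lambda>l\<in>{0..n}. if l < i j then E l else if l \<le> i (Suc j) then ext A (f (l - i j)) else F l)"
    for f F :: "nat \<Rightarrow> cvec set"
  have p: "even_proj j F = (\<lambda>l\<in>{0..card D}. F (i j + l) \<inter> Cn D)" for F
    by (simp add: even_proj_def D_def)
  have Y: "Cn A \<subseteq> F l" "F l \<subseteq> Cn (A \<union> D)" "lsub (F l)" if "F \<in> Ys j" "i j \<le> l" "l \<le> i (Suc j)" for F l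
  proof -
    have F: "F \<in> Fls T" "F (i j) = Cn A" "F (i (Suc j)) = Cn (A \<union> D)"
      using that unfolding AD by (simp_all add: Ys_def Zs_def K_def E_def A_def)
    show "Cn A \<subseteq> F l" "F l \<subseteq> Cn (A \<union> D)"
      using Fls_mono[OF F(1) that(2)] Fls_mono[OF F(1) that(3)] F that ij by auto
    show "lsub (F l)" using F(1) that ij by (auto simp: Fls_def Gs_def)
  qed
  have pFls: "even_proj j F \<in> Fls D" if F: "F \<in> Ys j" for F
    unfolding Fls_def p
  proof (intro CollectI conjI allI impI)
    have FF: "F \<in> Fls T" using F Ys_sub by auto
    fix l
    { assume l: "l \<le> card D"
      have "F (i j + l) \<in> Gs T (l + card A)"
        using FF l ij cards by (auto simp: Fls_def add.commute)
      then have "F (i j + l) \<inter> Cn D \<in> Gs D l"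
        using Y[OF F, of "i j + l"] l ij cards by (intro sc.reduce_Gs) auto
      then show "(\<lambda>l\<in>{0..card D}. F (i j + l) \<inter> Cn D) l \<in> Gs D l" using l by simp }
    { assume l: "l < card D"
      have "F (i j + l) \<subseteq> F (i j + Suc l)"
        using FF l ij cards by (auto simp: Fls_def)
      then show "(\<lambda>l\<in>{0..card D}. F (i j + l) \<inter> Cn D) l \<subseteq> (\<lambda>l\<in>{0..card D}. F (i j + l) \<inter> Cn D) (Suc l)"
        using l by auto }
  qed simp
  have qZ: "q F \<in> Zs (Suc j)" if F: "F \<in> Ys j" for F
  proof -
    have FK: "F \<in> K" "F (i (Suc j)) = E (i (Suc j))" using F by (auto simp: Ys_def Zs_def)
    then have FF: "F \<in> Fls T" by (simp add: K_def)
    have "q F l \<subseteq> q F (Suc l)" if "l < n" for l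
    proof -
      have "F l \<subseteq> F (Suc l)" using FF that by (simp add: Fls_def)
      moreover have "E l \<subseteq> F (Suc l)" if "l = i (Suc j)" using calculation FK that by simp
      ultimately show ?thesis using that E_mono[of l "Suc l"] by (auto simp: q_def not_less_eq_eq)
    qed
    then have qF: "q F \<in> Fls T" using FF E_Gs by (auto simp: Fls_def q_def)
    have "Cn (low k) \<subseteq> q F (i k) \<and> q F (i k) \<subseteq> Cn (high k)" if k: "k \<in> {1..<b}" for k
    proof (cases "i k \<le> i (Suc j)")
      case True
      then show ?thesis using E_bounds[of k] k i_le_n[of k] by (simp add: q_def)
    next
      case False
      then show ?thesis using FK(1) k i_le_n[of k] by (simp add: q_def K_def)
    qed
    then show ?thesis using qF ij unfolding Zs_def K_def by (auto simp: q_def)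
  qed
  have gY: "g f F \<in> Ys j" and g_top: "g f F (i (Suc j)) = E (i (Suc j))" and g_bot: "g f F (i j) = E (i j)"
    if f: "f \<in> Fls D" and F: "F \<in> Zs (Suc j)" for f F
  proof -
    have FK: "F \<in> K" "F (i (Suc j)) = E (i (Suc j))" using F by (auto simp: Zs_def)
    then have FF: "F \<in> Fls T" by (simp add: K_def)
    have fG: "f l \<in> Gs D l" if "l \<le> card D" for l using f that by (simp add: Fls_def)
    have f0: "f 0 = Cn {}" using Gs_zero[OF finD] fG by auto
    have fd: "f (card D) = Cn D" using Gs_full[OF finD] fG by auto
    have e0: "ext A (f 0) = E (i j)" unfolding f0 ext_Cn E_def A_def by simp
    have ed: "ext A (f (i (Suc j) - i j)) = E (i (Suc j))"
      using fd cards unfolding E_def AD[symmetric] ext_Cn[symmetric] by simp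
    show top: "g f F (i (Suc j)) = E (i (Suc j))" using ed ij by (simp add: g_def)
    show bot: "g f F (i j) = E (i j)" using e0 ij by (simp add: g_def)
    have gG: "g f F l \<in> Gs T l" if l: "l \<le> n" for l
    proof -
      consider "l < i j" | "i j \<le> l" "l \<le> i (Suc j)" | "i (Suc j) < l" by linarith
      then show ?thesis
      proof cases
        case 1
        then show ?thesis using E_Gs l by (simp add: g_def)
      next
        case 2
        have "ext A (f (l - i j)) \<in> Gs T ((l - i j) + card A)"
          by (rule sc.ext_Gs, rule fG) (use 2 cards in auto)
        then show ?thesis using 2 l cards by (simp add: g_def)
      next
        case 3
        then show ?thesis using FF l ij by (simp add: g_def Fls_def)
      qed
    qed
    have "g f F l \<subseteq> g f F (Suc l)" if l: "l < n" for l
    proof -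
      consider "Suc l < i j" | "Suc l = i j" | "i j \<le> l" "l < i (Suc j)" | "l = i (Suc j)" | "i (Suc j) < l" by linarith
      then show ?thesis
      proof cases
        case 1
        then show ?thesis using E_mono[of l "Suc l"] l by (simp add: g_def)
      next
        case 2
        then have "g f F l = E l" "g f F (Suc l) = E (Suc l)" using bot l by (auto simp: g_def)
        then show ?thesis using E_mono[of l "Suc l"] by simp
      next
        case 3
        then have "f (l - i j) \<subseteq> f (Suc (l - i j))" using f cards by (simp add: Fls_def)
        then have "ext A (f (l - i j)) \<subseteq> ext A (f (Suc l - i j))" using 3 by (simp add: ext_mono Suc_diff_le)
        then show ?thesis using 3 l by (simp add: g_def)
      next
        case 4
        have "F l \<subseteq> F (Suc l)" using FF l by (simp add: Fls_def)
        moreover have "g f F (Suc l) = F (Suc l)" using 4 l ij by (simp add: g_def)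
        ultimately show ?thesis using top FK(2) 4 by simp
      next
        case 5
        then show ?thesis using FF l ij by (simp add: g_def Fls_def)
      qed
    qed
    then have gF: "g f F \<in> Fls T" using gG by (auto simp: Fls_def g_def)
    have ge: "g f F l = E l" if "l \<le> i j" for l
      using that bot ij by (cases "l = i j") (auto simp: g_def)
    have "Cn (low k) \<subseteq> g f F (i k) \<and> g f F (i k) \<subseteq> Cn (high k)" if k: "k \<in> {1..<b}" for k
    proof -
      consider "k \<le> j" | "k = Suc j" | "Suc j < k" by linarith
      then show ?thesis
      proof cases
        case 1
        then show ?thesis using ge[OF mono[of k j]] j E_bounds[of k] k by simp
      next
        case 2
        then show ?thesis using top E_bounds[of k] k by simp
      next
        case 3
        then have "i (Suc j) < i k" using strict[of "Suc j" k] k pos_n by auto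
        then have "g f F (i k) = F (i k)" using i_le_n[of k] k ij by (simp add: g_def)
        then show ?thesis using FK(1) k by (simp add: K_def)
      qed
    qed
    then show "g f F \<in> Ys j" using gF ge top unfolding Ys_def Zs_def K_def by auto
  qed
  have "homeomorphic_maps (YX j) (prod_topology (Fl D) (ZX (Suc j)))
      (\<lambda>F. (even_proj j F, q F)) (\<lambda>(f, F). g f F)"
    unfolding homeomorphic_maps_def topspace_YX topspace_prod_topology topspace_ZX topspace_Fl[OF finD]
  proof (intro conjI ballI)
    show "continuous_map (YX j) (prod_topology (Fl D) (ZX (Suc j))) (\<lambda>F. (even_proj j F, q F))"
      unfolding continuous_map_paired
    proof
      show "continuous_map (YX j) (Fl D) (even_proj j)"
        unfolding continuous_map_Fl[OF finD] topspace_YX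
      proof (intro conjI allI impI)
        show "even_proj j \<in> Ys j \<rightarrow> Fls D" using pFls by blast
        fix l assume l: "l \<le> card D"
        have "continuous_map (YX j) (Gr T (l + card A)) (\<lambda>F. F (i j + l))"
          using continuous_proj[of "i j + l" "Ys j"] l ij cards by (simp add: add.commute)
        then have "continuous_map (YX j) (Gr D l) (\<lambda>F. F (i j + l) \<inter> Cn D)"
          by (rule sc.continuous_reduce) (use Y l ij cards topspace_YX in auto)
        then show "continuous_map (YX j) (Gr D l) (\<lambda>F. even_proj j F l)" using l by (simp add: p)
      qed
      show "continuous_map (YX j) (ZX (Suc j)) q"
      proof (rule continuous_map_into_Fl_sub)
        fix l assume l: "l \<le> n"
        show "continuous_map (YX j) (Gr T l) (\<lambda>F. q F l)"
          using l continuous_proj[OF l, of "Ys j"] E_Gs[OF l]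
          by (cases "l \<le> i (Suc j)") (auto simp: q_def topspace_Gr)
      qed (use qZ Zs_sub topspace_YX in auto)
    qed
    show "continuous_map (prod_topology (Fl D) (ZX (Suc j))) (YX j) (\<lambda>(f, F). g f F)"
    proof (rule continuous_map_into_Fl_sub)
      fix l assume l: "l \<le> n"
      let ?P = "prod_topology (Fl D) (ZX (Suc j))"
      consider "l < i j" | "i j \<le> l" "l \<le> i (Suc j)" | "i (Suc j) < l" by linarith
      then have "continuous_map ?P (Gr T l) (\<lambda>x. g (fst x) (snd x) l)"
      proof cases
        case 1
        then show ?thesis using E_Gs[OF l] l by (simp add: g_def topspace_Gr)
      next
        case 2
        have "continuous_map (Fl D) (Fl D) (\<lambda>f. f)" by simp
        then have "continuous_map (Fl D) (Gr D (l - i j)) (\<lambda>f. f (l - i j))"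
          unfolding continuous_map_Fl[OF finD] using 2 cards by simp
        then have "continuous_map ?P (Gr D (l - i j)) (\<lambda>x. fst x (l - i j))"
          using continuous_map_compose[OF continuous_map_fst] by (fastforce simp: comp_def)
        then have "continuous_map ?P (Gr T (l - i j + card A)) (\<lambda>x. ext A (fst x (l - i j)))"
          by (rule sc.continuous_ext)
        then show ?thesis using 2 l cards by (simp add: g_def)
      next
        case 3
        have "continuous_map ?P (Gr T l) (\<lambda>x. snd x l)"
          using continuous_map_compose[OF continuous_map_snd continuous_proj[OF l]] by (fastforce simp: comp_def)
        then show ?thesis using 3 l ij by (simp add: g_def)
      qed
      then show "continuous_map ?P (Gr T l) (\<lambda>x. (case x of (f, F) \<Rightarrow> g f F) l)"
        by (simp add: case_prod_unfold)
    qed (use gY Ys_sub topspace_ZX topspace_Fl[OF finD] in auto)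
    fix F assume F: "F \<in> Ys j"
    show "(case (even_proj j F, q F) of (f, F) \<Rightarrow> g f F) = F"
    proof
      fix l
      consider "l > n" | "l < i j" | "i j \<le> l" "l \<le> i (Suc j)" | "i (Suc j) < l" "l \<le> n" by linarith
      then show "(case (even_proj j F, q F) of (f, F) \<Rightarrow> g f F) l = F l"
      proof cases
        case 1
        then show ?thesis using Fls_undefined[OF subsetD[OF Ys_sub F]] by (simp add: g_def)
      next
        case 2
        then show ?thesis using F ij by (auto simp: g_def Ys_def Zs_def)
      next
        case 3
        then have "ext A (F l \<inter> Cn D) = F l" using Y[OF F 3] by (intro Int_ext) auto
        moreover have "l - i j \<le> card D" unfolding cards(2) by (rule diff_le_mono[OF 3(2)])
        then have "even_proj j F (l - i j) = F l \<inter> Cn D" using 3(1) by (simp add: p)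
        moreover have "l \<le> n" using 3 ij by simp
        ultimately show ?thesis using 3 by (simp add: g_def)
      next
        case 4
        then show ?thesis using ij by (simp add: g_def q_def)
      qed
    qed
  next
    fix x assume "x \<in> Fls D \<times> Zs (Suc j)"
    then obtain f F where x: "x = (f, F)" and f: "f \<in> Fls D" and F: "F \<in> Zs (Suc j)" by auto
    have "even_proj j (g f F) = f"
    proof
      fix l
      show "even_proj j (g f F) l = f l"
      proof (cases "l \<le> card D")
        case True
        then have "f l \<in> Gs D l" using f by (simp add: Fls_def)
        then have "ext A (f l) \<inter> Cn D = f l" using sc.disj by (intro ext_Int) (auto simp: Gs_def)
        moreover have "i j + l \<le> i (Suc j)" using True ij cards(2) by linarith
        ultimately show ?thesis using True ij by (simp add: p g_def)
      qed (use f in \<open>auto simp: p Fls_def extensional_def\<close>)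
    qed
    moreover have "q (g f F) = F"
    proof
      fix l
      consider "l > n" | "l \<le> i (Suc j)" | "i (Suc j) < l" "l \<le> n" by linarith
      then show "q (g f F) l = F l"
      proof cases
        case 1
        then show ?thesis using Fls_undefined[OF subsetD[OF Zs_sub F]] by (simp add: q_def)
      qed (use F ij in \<open>auto simp: q_def g_def Zs_def\<close>)
    qed
    ultimately show "(\<lambda>F. (even_proj j F, q F)) (case x of (f, F) \<Rightarrow> g f F) = x" by (simp add: x)
  qed
  then show ?thesis unfolding D_def by (rule fiber_bundle_product) simp
qed

end

context hook_data
begin

subsection \<open>The Grassmannian bundles\<close>

text \<open>One dimension is taken up by \<open>e(i\<^sub>j\<^sub>+\<^sub>1)\<close>, which lies in \<open>F(i\<^sub>j\<^sub>+\<^sub>1)\<close> for every flag in K.\<close>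

definition odd_rank :: "nat \<Rightarrow> nat"
  where "odd_rank j = i (Suc j) - i j - 1"

definition odd_proj :: "nat \<Rightarrow> (nat \<Rightarrow> cvec set) \<Rightarrow> cvec set"
  where "odd_proj j F = F (i (Suc j)) \<inter> Cn (odd_index j)"

lemma odd_index_decomp:
  assumes j: "Suc j < b"
  shows "({1..i j} \<union> {i (Suc j)}) \<union> odd_index j = high (Suc j)"
    and "({1..i j} \<union> {i (Suc j)}) \<inter> odd_index j = {}"
    and "{i j<..<i (Suc j)} \<subseteq> odd_index j"
    and "k < b \<Longrightarrow> low k \<inter> odd_index j = {}"
    and "Suc j \<le> k \<Longrightarrow> odd_index j \<subseteq> high k"
proof -
  have n: "0 < n" using pos_n j by auto
  have a: "{j<..b} = insert (Suc j) {Suc j<..b}" using j by auto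
  have s: "i (Suc j) < i k" if "k \<in> {Suc j<..b}" for k using strict[of "Suc j" k] that n by auto
  have h: "i (Suc j) \<in> high (Suc j)" using sub_high[of "Suc j"] i_pos[of "Suc j"] j n by auto
  have l: "{1..i j} \<subseteq> high (Suc j)"
    using sub_high[of "Suc j"] mono[of j "Suc j"] j by fastforce
  show "({1..i j} \<union> {i (Suc j)}) \<union> odd_index j = high (Suc j)"
    using h l unfolding odd_index_def high_def a by auto
  show "({1..i j} \<union> {i (Suc j)}) \<inter> odd_index j = {}"
    unfolding odd_index_def a by auto
  show "{i j<..<i (Suc j)} \<subseteq> odd_index j"
  proof
    fix c assume c: "c \<in> {i j<..<i (Suc j)}"
    have "c \<noteq> i k" if "k \<in> {j<..b}" for k
      using c s[of k] that by (cases "k = Suc j") auto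
    then have "c \<notin> i ` {j<..b}" by blast
    then show "c \<in> odd_index j" using c i_le_n[of "Suc j"] j by (auto simp: odd_index_def)
  qed
  show "low k \<inter> odd_index j = {}" if k: "k < b"
  proof -
    have "i m \<notin> odd_index j" if "m \<in> {1..k}" for m
    proof (cases "m \<le> j")
      case True
      then have "i m \<le> i j" "1 \<le> i m" using mono[of m j] i_pos[of m] n j that by auto
      then show ?thesis by (simp add: odd_index_def)
    next
      case False
      then show ?thesis using that k by (auto simp: odd_index_def)
    qed
    then show ?thesis by (auto simp: low_def)
  qed
  show "odd_index j \<subseteq> high k" if "Suc j \<le> k"
    using that by (auto simp: odd_index_def high_def)
qed

text \<open>Over the chart of an index set I, the automorphism \<open>bwd Q\<close> carries the flags with
  \<open>F(i\<^sub>j\<^sub>+\<^sub>1) = ext A Q\<close> to the flags with \<open>F(i\<^sub>j\<^sub>+\<^sub>1) = E(i\<^sub>j\<^sub>+\<^sub>1)\<close>, i.e. to the fiber \<open>Ys j\<close>. It fixes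
  all vectors supported off the index set D of the base, in particular \<open>E(i\<^sub>j)\<close> and every \<open>Cn (low m)\<close>,
  and it preserves \<open>Cn (high m)\<close> for \<open>m > j\<close>, which contains \<open>Cn D\<close>. So it does not leave K.\<close>

lemma odd_bundle:
  assumes j: "Suc j < b"
  shows "fiber_bundle (ZX j) (Gr (odd_index j) (odd_rank j)) (YX j) (odd_proj j)"
proof -
  define A where "A = {1..i j} \<union> {i (Suc j)}"
  define D where "D = odd_index j"
  define k where "k = odd_rank j"
  \<comment> \<open>In dimension \<open>i\<^sub>j\<^sub>+\<^sub>1\<close> the coordinate flag corresponds to the coordinate subspace \<open>Cn J\<close> of \<open>Cn D\<close>.\<close>
  define J where "J = {i j<..<i (Suc j)}"
  have n: "0 < n" using pos_n j by auto
  have ij: "i j < i (Suc j)" "i (Suc j) \<le> n" using strict[of j "Suc j"] i_le_n[of "Suc j"] j n by auto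
  have AD: "A \<union> D = high (Suc j)" "A \<inter> D = {}" "J \<subseteq> D"
    using odd_index_decomp[OF j] by (auto simp: A_def D_def J_def)
  have lowD: "low l \<inter> D = {}" if "l < b" for l using odd_index_decomp(4)[OF j that] by (simp add: D_def)
  have highD: "D \<subseteq> high l" if "Suc j \<le> l" for l using odd_index_decomp(5)[OF j that] by (simp add: D_def)
  have iniD: "{1..l} \<inter> D = {}" if "l \<le> i j" for l using that by (auto simp: D_def odd_index_def)
  interpret sc: split_coords T A D
    by unfold_locales (use ij AD in \<open>auto simp: A_def D_def odd_index_def\<close>)
  have finD: "finite D" by (rule sc.finD)
  have cA: "card A = Suc (i j)" using ij by (simp add: A_def)
  have ck: "k + card A = i (Suc j)" using ij by (simp add: cA k_def odd_rank_def)
  have cJ: "card J = k" by (simp add: J_def k_def odd_rank_def)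
  have AJ: "A \<union> J = {1..i (Suc j)}" using ij by (auto simp: A_def J_def)
  have p: "odd_proj j F = F (i (Suc j)) \<inter> Cn D" for F by (simp add: odd_proj_def D_def)
  have Z: "Cn A \<subseteq> F (i (Suc j))" "F (i (Suc j)) \<subseteq> Cn (A \<union> D)" "F (i (Suc j)) \<in> Gs T (k + card A)"
      "lsub (F (i (Suc j)))" if F: "F \<in> Zs j" for F
  proof -
    have FK: "F \<in> K" "F (i j) = E (i j)" using F by (auto simp: Zs_def)
    then have FF: "F \<in> Fls T" by (simp add: K_def)
    then show G: "F (i (Suc j)) \<in> Gs T (k + card A)" using ij by (simp add: ck Fls_def)
    then show l: "lsub (F (i (Suc j)))" by (simp add: Gs_def)
    have b: "Cn (low (Suc j)) \<subseteq> F (i (Suc j))" "F (i (Suc j)) \<subseteq> Cn (high (Suc j))"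
      using FK(1) j by (auto simp: K_def)
    then show "F (i (Suc j)) \<subseteq> Cn (A \<union> D)" by (simp add: AD)
    have "Cn {1..i j} \<subseteq> F (i (Suc j))" using Fls_mono[OF FF, of "i j" "i (Suc j)"] ij FK(2) by (simp add: E_def)
    moreover have "Cn {i (Suc j)} \<subseteq> F (i (Suc j))"
      using b(1) Cn_mono[of "{i (Suc j)}" "low (Suc j)"] by (auto simp: low_def)
    ultimately have "ext {1..i j} (Cn {i (Suc j)}) \<subseteq> F (i (Suc j))" by (intro ext_subset l)
    then show "Cn A \<subseteq> F (i (Suc j))" by (simp add: ext_Cn A_def)
  qed
  have pG: "odd_proj j F \<in> Gs D k" if F: "F \<in> Zs j" for F
    unfolding p by (rule sc.reduce_Gs) (use Z[OF F] in auto)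
  have pcont: "continuous_map (subtopology (ZX j) X) (Gr D k) (odd_proj j)" for X
  proof -
    have "continuous_map (ZX j) (Gr T (k + card A)) (\<lambda>F. F (i (Suc j)))"
      using continuous_proj[OF ij(2)] by (simp add: ck)
    then have "continuous_map (ZX j) (Gr D k) (\<lambda>F. F (i (Suc j)) \<inter> Cn D)"
      by (rule sc.continuous_reduce) (use Z topspace_ZX in auto)
    then show ?thesis unfolding p[abs_def] by (rule continuous_map_from_subtopology)
  qed
  show ?thesis
    unfolding D_def[symmetric] k_def[symmetric]
  proof (rule fiber_bundleI)
    show "continuous_map (ZX j) (Gr D k) (odd_proj j)" using pcont[of UNIV] by simp
    fix Q0 assume "Q0 \<in> topspace (Gr D k)"
    then have "Q0 \<in> Gs D k" by (simp add: topspace_Gr[OF finD])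
    then obtain I where I: "I \<subseteq> D" "card I = k" "chart I Q0" using Gs_chartE[OF finD] by metis
    \<comment> \<open>The chart of Q0 need not contain the base point \<open>Cn J\<close>; the permutation moves it there.\<close>
    obtain \<pi> where pi: "\<pi> permutes D" "\<pi> ` J = I"
      by (rule permutation_between[OF finD AD(3) I(1)]) (use cJ I in auto)
    interpret cs: chart_shear T D I J \<pi>
      by unfold_locales (use sc.sub I pi in auto)
    define U where "U = {W \<in> Gs D k. chart I W}"
    have U: "chart I Q" "Q \<subseteq> Cn D" "lsub Q" "Q \<in> Gs D k" if "Q \<in> U" for Q
      using that by (auto simp: U_def Gs_def)
    have opU: "openin (Gr D k) U" unfolding U_def by (rule chart_openin[OF finD I(1,2)])
    have bwd_ext: "cs.bwd Q ` ext A Q = E (i (Suc j))" if Q: "Q \<in> U" for Q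
    proof (rule Gs_eqI[of T])
      have e: "ext A Q \<in> Gs T (i (Suc j))" using sc.ext_Gs[OF U(4)[OF Q]] by (simp add: ck)
      then show "cs.bwd Q ` ext A Q \<in> Gs T (i (Suc j))" by (rule cs.Gs_images(2)[OF U(1,2)[OF Q]])
      show "E (i (Suc j)) \<in> Gs T (i (Suc j))" by (rule E_Gs[OF ij(2)])
      show "cs.bwd Q ` ext A Q \<subseteq> E (i (Suc j))"
      proof
        fix w assume "w \<in> cs.bwd Q ` ext A Q"
        then obtain x y where w: "w = cs.bwd Q (\<lambda>b. x b + y b)" "x \<in> Q" "y \<in> Cn A"
          by (auto simp: ext_def)
        have "cs.bwd Q y = y" by (rule cs.fixes_Cn(2)[OF w(3) AD(2)])
        then have "w = (\<lambda>b. cs.bwd Q x b + y b)" by (simp add: w(1) cs.bwd_add)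
        moreover have "cs.bwd Q x \<in> Cn J" by (rule cs.bwd_Q[OF U(3,1)[OF Q] w(2)])
        ultimately have "w \<in> ext A (Cn J)" using w(3) by (intro extI)
        then show "w \<in> E (i (Suc j))" by (simp add: ext_Cn AJ E_def)
      qed
    qed simp
    have image_id: "cs.fwd Q ` cs.bwd Q ` W = W" "cs.bwd Q ` cs.fwd Q ` W = W" for Q W
      by (simp_all add: image_image cs.fwd_bwd cs.bwd_fwd)
    have move: "(\<lambda>l\<in>{0..n}. g ` F l) \<in> K" "l \<le> i j \<Longrightarrow> (\<lambda>l\<in>{0..n}. g ` F l) l = E l"
      if F: "F \<in> Zs j" and g: "g = cs.fwd Q \<or> g = cs.bwd Q" and Q: "Q \<in> U" for F g Q l
    proof -
      have FK: "F \<in> K" "\<forall>l\<le>i j. F l = E l" using F by (auto simp: Zs_def)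
      then have FF: "F \<in> Fls T" by (simp add: K_def)
      have g_fix: "g ` Cn X = Cn X" if "X \<inter> D = {}" for X by (rule disjE[OF g]) (simp_all add: cs.fixes_Cn_image[OF that])
      have g_pres: "g ` Cn X \<subseteq> Cn X" if "D \<subseteq> X" for X
        using g cs.preserves_Cn[OF U(1,2)[OF Q] that] by auto
      have gG: "g ` F l \<in> Gs T l" if "l \<le> n" for l
        using g cs.Gs_images[OF U(1,2)[OF Q], of "F l" l] FF that by (auto simp: Fls_def)
      have le: "(\<lambda>l\<in>{0..n}. g ` F l) l = E l" if "l \<le> i j" for l
      proof -
        have "g ` F l = E l" using g_fix[OF iniD[OF that]] FK(2) that by (simp add: E_def)
        then show ?thesis using that ij by simp
      qed
      then show "l \<le> i j \<Longrightarrow> (\<lambda>l\<in>{0..n}. g ` F l) l = E l" .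
      have "(\<lambda>l\<in>{0..n}. g ` F l) \<in> Fls T"
        using gG FF by (simp add: Fls_def image_mono)
      moreover have "Cn (low m) \<subseteq> g ` F (i m) \<and> g ` F (i m) \<subseteq> Cn (high m)" if m: "m \<in> {1..<b}" for m
      proof (cases "m \<le> j")
        case True
        then have "i m \<le> i j" using mono j by simp
        then have "g ` F (i m) = E (i m)" using le[of "i m"] ij by simp
        then show ?thesis using E_bounds[of m] m by simp
      next
        case False
        have "Cn (low m) \<subseteq> F (i m)" "F (i m) \<subseteq> Cn (high m)" using FK(1) m by (auto simp: K_def)
        then have "g ` Cn (low m) \<subseteq> g ` F (i m)" "g ` F (i m) \<subseteq> g ` Cn (high m)" by auto
        then show ?thesis using g_fix[OF lowD[of m]] g_pres[OF highD[of m]] False m by auto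
      qed
      ultimately show "(\<lambda>l\<in>{0..n}. g ` F l) \<in> K" using i_le_n by (simp add: K_def)
    qed
    let ?X = "subtopology (ZX j) {F \<in> topspace (ZX j). odd_proj j F \<in> U}"
    let ?P = "prod_topology (subtopology (Gr D k) U) (YX j)"
    have tX: "topspace ?X = {F \<in> Zs j. odd_proj j F \<in> U}"
      unfolding topspace_subtopology[of "ZX j"] topspace_ZX by auto
    have tP: "topspace ?P = U \<times> Ys j"
      unfolding topspace_prod_topology topspace_YX topspace_subtopology[of "Gr D k"]
      using openin_subset[OF opU] by auto
    define h2 where "h2 Q F = (\<lambda>l\<in>{0..n}. cs.bwd Q ` F l)" for Q and F :: "nat \<Rightarrow> cvec set"
    define h' where "h' Q F = (\<lambda>l\<in>{0..n}. cs.fwd Q ` F l)" for Q and F :: "nat \<Rightarrow> cvec set"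
    have extp: "ext A (odd_proj j F) = F (i (Suc j))" if "F \<in> Zs j" for F
      unfolding p by (rule Int_ext) (use Z[OF that] in auto)
    have h2Y: "h2 (odd_proj j F) F \<in> Ys j" if F: "F \<in> Zs j" and Q: "odd_proj j F \<in> U" for F
    proof -
      have "h2 (odd_proj j F) F (i (Suc j)) = E (i (Suc j))"
        using bwd_ext[OF Q] extp[OF F] ij by (simp add: h2_def)
      moreover have "h2 (odd_proj j F) F \<in> Zs j"
        using move[OF F _ Q] unfolding h2_def Zs_def by blast
      ultimately show ?thesis by (simp add: Ys_def)
    qed
    have h'Z: "h' Q F \<in> Zs j" and ph': "odd_proj j (h' Q F) = Q" if Q: "Q \<in> U" and F: "F \<in> Ys j" for Q F
    proof -
      have FZ: "F \<in> Zs j" "F (i (Suc j)) = E (i (Suc j))" using F by (auto simp: Ys_def)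
      show "h' Q F \<in> Zs j" using move[OF FZ(1) _ Q] unfolding h'_def Zs_def by blast
      have "h' Q F (i (Suc j)) = cs.fwd Q ` cs.bwd Q ` ext A Q"
        using FZ(2) bwd_ext[OF Q] ij by (simp add: h'_def)
      then have "h' Q F (i (Suc j)) = ext A Q" by (simp add: image_id)
      then show "odd_proj j (h' Q F) = Q" unfolding p using ext_Int[OF U(3,2)[OF Q] AD(2)] by simp
    qed
    have q: "continuous_map ?P (Gr D (card I)) fst"
      using continuous_map_compose[OF continuous_map_fst
          continuous_map_from_subtopology[OF continuous_map_id, of "Gr D k" U]] I(2)
      by (fastforce simp: comp_def)
    have h'cont: "continuous_map ?P (ZX j) (\<lambda>x. case x of (Q, F) \<Rightarrow> h' Q F)"
    proof (rule continuous_map_into_Fl_sub)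
      fix l assume l: "l \<le> n"
      have "continuous_map ?P (Gr T l) (\<lambda>x. snd x l)"
        using continuous_map_compose[OF continuous_map_snd continuous_proj[OF l]] by (fastforce simp: comp_def)
      then have "continuous_map ?P (Gr T l) (\<lambda>x. cs.fwd (fst x) ` snd x l)"
        by (rule cs.continuous_images(1)[OF q, rotated]) (use tP U in auto)
      then show "continuous_map ?P (Gr T l) (\<lambda>x. (case x of (Q, F) \<Rightarrow> h' Q F) l)"
        using l by (simp add: h'_def case_prod_unfold)
    qed (use h'Z tP Zs_sub in auto)
    have "homeomorphic_maps ?X ?P (\<lambda>F. (odd_proj j F, h2 (odd_proj j F) F)) (\<lambda>(Q, F). h' Q F)"
      unfolding homeomorphic_maps_def tX tP
    proof (intro conjI ballI)
      show "continuous_map ?X ?P (\<lambda>F. (odd_proj j F, h2 (odd_proj j F) F))"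
        unfolding continuous_map_paired
      proof
        show "continuous_map ?X (subtopology (Gr D k) U) (odd_proj j)"
          by (rule continuous_map_into_subtopology[OF pcont]) (use tX in auto)
        have q: "continuous_map ?X (Gr D (card I)) (odd_proj j)" using pcont I(2) by simp
        show "continuous_map ?X (YX j) (\<lambda>F. h2 (odd_proj j F) F)"
        proof (rule continuous_map_into_Fl_sub)
          fix l assume l: "l \<le> n"
          have "continuous_map ?X (Gr T l) (\<lambda>F. F l)"
            by (rule continuous_map_from_subtopology[OF continuous_proj[OF l]])
          then have "continuous_map ?X (Gr T l) (\<lambda>F. cs.bwd (odd_proj j F) ` F l)"
            by (rule cs.continuous_images(2)[OF q, rotated]) (use tX U in auto)
          then show "continuous_map ?X (Gr T l) (\<lambda>F. h2 (odd_proj j F) F l)"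
            using l by (simp add: h2_def)
        qed (use h2Y tX Ys_sub in auto)
      qed
      show "continuous_map ?P ?X (\<lambda>x. case x of (Q, F) \<Rightarrow> h' Q F)"
        by (rule continuous_map_into_subtopology[OF h'cont]) (use h'Z ph' tP topspace_ZX in auto)
    next
      fix F assume "F \<in> {F \<in> Zs j. odd_proj j F \<in> U}"
      then have F: "F \<in> Zs j" by simp
      show "(case (odd_proj j F, h2 (odd_proj j F) F) of (Q, F) \<Rightarrow> h' Q F) = F"
      proof
        fix l show "(case (odd_proj j F, h2 (odd_proj j F) F) of (Q, F) \<Rightarrow> h' Q F) l = F l"
          using Fls_undefined[OF subsetD[OF Zs_sub F], of l]
          by (cases "l \<le> n") (simp_all add: h'_def h2_def image_id)
      qed
    next
      fix x assume "x \<in> U \<times> Ys j"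
      then obtain Q F where x: "x = (Q, F)" and Q: "Q \<in> U" and F: "F \<in> Ys j" by auto
      have "h2 Q (h' Q F) = F"
      proof
        fix l show "h2 Q (h' Q F) l = F l"
          using Fls_undefined[OF subsetD[OF Ys_sub F], of l]
          by (cases "l \<le> n") (simp_all add: h'_def h2_def image_id)
      qed
      then show "(\<lambda>F. (odd_proj j F, h2 (odd_proj j F) F)) (case x of (Q, F) \<Rightarrow> h' Q F) = x"
        by (simp add: x ph'[OF Q F])
    qed
    then show "\<exists>U h h'. openin (Gr D k) U \<and> Q0 \<in> U \<and>
        homeomorphic_maps (subtopology (ZX j) {F \<in> topspace (ZX j). odd_proj j F \<in> U})
          (prod_topology (subtopology (Gr D k) U) (YX j)) h h' \<and>
        (\<forall>F\<in>topspace (ZX j). odd_proj j F \<in> U \<longrightarrow> fst (h F) = odd_proj j F)"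
      using opU \<open>Q0 \<in> Gs D k\<close> I(3)
      by (intro exI[of _ U] exI[of _ "\<lambda>F. (odd_proj j F, h2 (odd_proj j F) F)"]
          exI[of _ "\<lambda>(Q, F). h' Q F"]) (auto simp: U_def)
  qed
qed

end

section \<open>The closure of the cell in coordinates\<close>

lemma Cn_insert_sub:
  assumes "lsub W" "Cn X \<subseteq> W" "unitv a \<in> W"
  shows "Cn (insert a X) \<subseteq> W"
proof
  fix z assume z: "z \<in> Cn (insert a X)"
  let ?y = "\<lambda>c. if c = a then 0 else z c"
  have "?y \<in> W" using z assms(2) by (auto simp: Cn_def)
  moreover have "(\<lambda>c. z a * unitv a c) \<in> W" by (rule lsub_scale[OF assms(1,3)])
  ultimately have "(\<lambda>c. ?y c + z a * unitv a c) \<in> W" by (rule lsub_add[OF assms(1)])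
  moreover have "(\<lambda>c. ?y c + z a * unitv a c) = z" by (auto simp: unitv_def)
  ultimately show "z \<in> W" by simp
qed

text \<open>A reduced basis of \<open>G l\<close> together with a vector x outside \<open>G l\<close> is a linearly independent family
  of \<open>l + 1\<close> vectors in \<open>G (l + 1)\<close>.\<close>

lemma Fls_step:
  assumes fin: "finite S" and G: "G \<in> Fls S" "l < card S"
  shows "\<exists>x. x \<in> G (Suc l) \<and> x \<notin> G l"
    and "x \<in> G (Suc l) \<Longrightarrow> x \<notin> G l \<Longrightarrow> y \<in> G (Suc l) \<Longrightarrow> \<exists>c. (\<lambda>a. y a - c * x a) \<in> G l"
proof -
  have GG: "G l \<in> Gs S l" "G (Suc l) \<in> Gs S (Suc l)" "G l \<subseteq> G (Suc l)" using G by (auto simp: Fls_def)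
  obtain I where I: "I \<subseteq> S" "card I = l" "chart I (G l)" "finite I" "lsub (G l)"
    using Gs_chartE[OF fin GG(1)] by metis
  show "\<exists>x. x \<in> G (Suc l) \<and> x \<notin> G l"
  proof (rule ccontr)
    assume "\<not> (\<exists>x. x \<in> G (Suc l) \<and> x \<notin> G l)"
    then have "G (Suc l) = G l" using GG by auto
    then have "card I = Suc l" using Gs_card[OF fin GG(2)] I by simp
    then show False using I by simp
  qed
  assume x: "x \<in> G (Suc l)" "x \<notin> G l" and y: "y \<in> G (Suc l)"
  let ?I = "insert None (Some ` I)"
  let ?v = "case_option x (rr I (G l))"
  have lcI: "lc ?I c ?v = (\<lambda>a. c None * x a + lc I (c \<circ> Some) (rr I (G l)) a)" for c
    using I(4) by (auto simp: lc_def sum.reindex)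
  have mem: "lc I c (rr I (G l)) \<in> G l" for c by (rule lsub_lc[OF I(5) rr(1)[OF I(3)]])
  have ind: "indep ?I ?v"
    unfolding indep_def
  proof (intro allI impI)
    fix c assume "\<forall>b. lc ?I c ?v b = 0"
    then have z: "c None * x a + lc I (c \<circ> Some) (rr I (G l)) a = 0" for a by (simp add: lcI)
    have "c None = 0"
    proof (rule ccontr)
      assume c: "c None \<noteq> 0"
      have "(\<lambda>a. (- 1 / c None) * lc I (c \<circ> Some) (rr I (G l)) a) \<in> G l" by (rule lsub_scale[OF I(5) mem])
      moreover have "(- 1 / c None) * lc I (c \<circ> Some) (rr I (G l)) a = x a" for a
      proof -
        have "lc I (c \<circ> Some) (rr I (G l)) a = - (c None * x a)" using z[of a] by (simp add: add_eq_0_iff)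
        then show ?thesis using c by simp
      qed
      ultimately show False using x(2) by simp
    qed
    then have "\<forall>a\<in>I. (c \<circ> Some) a = 0"
      using z chart_indep[OF I(3,4), unfolded indep_def, rule_format, of "c \<circ> Some"] by simp
    then show "\<forall>a\<in>?I. c a = 0" using \<open>c None = 0\<close> by auto
  qed
  have "G (Suc l) = sp ?I ?v"
  proof (rule Gs_sp_eq[OF fin _ _ GG(2) ind])
    show "card ?I = Suc l" using I(2,4) by (simp add: card_image)
    show "?v a \<in> G (Suc l)" if "a \<in> ?I" for a using that x(1) rr(1)[OF I(3)] GG(3) by auto
  qed (use I(4) in simp)
  then obtain c where "y = lc ?I c ?v" using y by (auto simp: sp_def)
  then have "(\<lambda>a. y a - c None * x a) = lc I (c \<circ> Some) (rr I (G l))" unfolding lcI by auto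
  then show "\<exists>c. (\<lambda>a. y a - c * x a) \<in> G l" using mem by metis
qed

context hook_data
begin

text \<open>The map N in coordinates, which shifts the top row, and the images of its powers.\<close>

definition Nc :: "cvec \<Rightarrow> cvec"
  where "Nc x = (\<lambda>a. \<Sum>k\<in>{1..<b}. x (i (Suc k)) * unitv (i k) a)"

definition Imc :: "nat \<Rightarrow> cvec set"
  where "Imc e = (if e = 0 then Cn T else Cn (low (b - e)))"

lemma Nc_i: 
  assumes "k \<in> {1..<b}"
  shows "Nc x (i k) = x (i (Suc k))"
proof -
  have n: "0 < n" using pos_n assms by auto
  have "Nc x (i k) = (\<Sum>m\<in>{1..<b}. if m = k then x (i (Suc k)) else 0)"
    unfolding Nc_def by (rule sum.cong) (use assms i_eq[of k _] n in \<open>auto simp: unitv_def\<close>)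
  then show ?thesis using assms by simp
qed

lemma Nc_low: "Nc x \<in> Cn (low (b - 1))"
  unfolding Cn_def
proof (intro CollectI allI impI)
  fix a assume a: "a \<notin> low (b - 1)"
  have "unitv (i k) a = 0" if "k \<in> {1..<b}" for k
  proof -
    have "k \<in> {1..b - 1}" using that by auto
    then have "i k \<in> low (b - 1)" by (simp add: low_def)
    then show ?thesis using a by (auto simp: unitv_def)
  qed
  then show "Nc x a = 0" by (simp add: Nc_def)
qed

lemma low_Suc: "low (Suc j) = insert (i (Suc j)) (low j)"
  by (auto simp: low_def atLeastAtMostSuc_conv)

lemma low_mono: "j \<le> k \<Longrightarrow> low j \<subseteq> low k"
  by (auto simp: low_def)

lemma i_low: "k \<le> b \<Longrightarrow> j \<le> b \<Longrightarrow> 0 < n \<Longrightarrow> 1 \<le> k \<Longrightarrow> i k \<in> low j \<longleftrightarrow> k \<le> j"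
  unfolding low_def using i_eq by fastforce

lemma i_high: "k \<le> b \<Longrightarrow> j \<le> b \<Longrightarrow> 0 < n \<Longrightarrow> 1 \<le> k \<Longrightarrow> i k \<in> high j \<longleftrightarrow> k \<le> j"
  unfolding high_def using i_eq[of k] i_le_n[of k] i_pos[of k] by fastforce

lemma low_Int_high: "Cn (low (b - 1)) \<inter> Cn (high j) \<subseteq> Cn (low j)"
proof
  fix w assume w: "w \<in> Cn (low (b - 1)) \<inter> Cn (high j)"
  show "w \<in> Cn (low j)"
    unfolding Cn_def
  proof (intro CollectI allI impI)
    fix a assume a: "a \<notin> low j"
    show "w a = 0"
    proof (cases "a \<in> low (b - 1)")
      case True
      then obtain k where k: "k \<in> {1..b - 1}" "a = i k" by (auto simp: low_def)
      then have "\<not> k \<le> j" using a by (auto simp: low_def)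
      then have "a \<notin> high j" using k by (auto simp: high_def)
      then show ?thesis using w by (simp add: Cn_def)
    qed (use w in \<open>simp add: Cn_def\<close>)
  qed
qed

text \<open>The preimage of \<open>im N\<^sup>b\<^sup>-\<^sup>j\<close> under N is \<open>ker N\<^sup>j\<^sup>+\<^sup>1\<close>.\<close>

lemma Nc_low_iff:
  assumes "x \<in> Cn T" "j < b"
  shows "Nc x \<in> Cn (low j) \<longleftrightarrow> x \<in> Cn (high (Suc j))"
proof (cases "0 < n")
  case n: True
  show ?thesis
  proof
    assume L: "Nc x \<in> Cn (low j)"
    have "x (i k) = 0" if k: "k \<in> {Suc j<..b}" for k
    proof -
      have k': "k - 1 \<in> {1..<b}" "Suc (k - 1) = k" using k by auto
      have "k - 1 \<le> b" "1 \<le> k - 1" "\<not> k - 1 \<le> j" "j \<le> b" using k assms(2) by auto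
      then have "i (k - 1) \<notin> low j" using i_low[of "k - 1" j] n by simp
      then have "Nc x (i (k - 1)) = 0" using L by (simp add: Cn_def)
      then show ?thesis using Nc_i[OF k'(1)] k'(2) by simp
    qed
    then show "x \<in> Cn (high (Suc j))" using assms(1) by (auto simp: Cn_def high_def)
  next
    assume R: "x \<in> Cn (high (Suc j))"
    show "Nc x \<in> Cn (low j)"
      unfolding Cn_def
    proof (intro CollectI allI impI)
      fix a assume a: "a \<notin> low j"
      show "Nc x a = 0"
      proof (cases "a \<in> low (b - 1)")
        case True
        then obtain k where k: "k \<in> {1..b - 1}" "a = i k" by (auto simp: low_def)
        then have k': "k \<in> {1..<b}" by auto
        have "\<not> k \<le> j" using a k i_low[of k j] n assms(2) by auto
        then have "i (Suc k) \<notin> high (Suc j)" using i_high[of "Suc k" "Suc j"] k' n assms(2) by auto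
        then show ?thesis using R Nc_i[OF k'] k(2) by (simp add: Cn_def)
      qed (use Nc_low[of x] in \<open>simp add: Cn_def\<close>)
    qed
  qed
next
  case False
  then have "b = 1" using n0 by simp
  then have "{1..<b} = {}" by simp
  then have "Nc x = (\<lambda>_. 0)" by (simp only: Nc_def sum.empty)
  moreover have "x = (\<lambda>_. 0)" using assms(1) False by (auto simp: Cn_def)
  ultimately show ?thesis by (simp add: Cn_def)
qed

lemma K_Fls: "G \<in> K \<Longrightarrow> G \<in> Fls T"
  by (simp add: K_def)

lemma Fls_lsub: "G \<in> Fls T \<Longrightarrow> l \<le> n \<Longrightarrow> lsub (G l)"
  by (auto simp: Fls_def Gs_def)

lemma Fls_Cn: "G \<in> Fls T \<Longrightarrow> l \<le> n \<Longrightarrow> G l \<subseteq> Cn T"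
  by (auto simp: Fls_def Gs_def)

lemma K_bounds:
  assumes G: "G \<in> K" and j: "j \<le> b"
  shows "j < b \<Longrightarrow> Cn (low j) \<subseteq> G (i j)" "G (i j) \<subseteq> Cn (high j)"
proof -
  have FG: "G \<in> Fls T" by (rule K_Fls[OF G])
  consider "j = 0" | "1 \<le> j" "j < b" | "j = b" using j by linarith
  then have "(j < b \<longrightarrow> Cn (low j) \<subseteq> G (i j)) \<and> G (i j) \<subseteq> Cn (high j)"
  proof cases
    case 1
    have "G 0 = Cn {}" using Fls_zero[OF FG] by (simp add: E_def)
    then show ?thesis using 1 i0 Cn_mono[of "{}" "high 0"] by (simp add: low_def)
  next
    case 2
    then show ?thesis using G by (simp add: K_def)
  next
    case 3
    have "G n = Cn T" using Fls_top[OF FG] by (simp add: E_def)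
    then show ?thesis using 3 ib by (simp add: high_def)
  qed
  then show "j < b \<Longrightarrow> Cn (low j) \<subseteq> G (i j)" "G (i j) \<subseteq> Cn (high j)" by auto
qed

lemma block:
  assumes "1 \<le> l" "l \<le> n"
  obtains j where "j < b" "i j < l" "l \<le> i (Suc j)"
proof -
  have "\<exists>k. k \<le> b \<and> l \<le> i k" using assms ib by auto
  then obtain k where k: "k \<le> b" "l \<le> i k" and least: "\<And>m. m < k \<Longrightarrow> \<not> (m \<le> b \<and> l \<le> i m)"
    using exists_least_iff[of "\<lambda>k. k \<le> b \<and> l \<le> i k"] by auto
  have "k \<noteq> 0" using k assms i0 by (cases k) auto
  then obtain j where j: "k = Suc j" by (cases k) auto
  then have "i j < l" using least[of j] k by auto
  then show thesis by (intro that[of j]) (use j k in auto)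
qed

text \<open>For l between \<open>i\<^sub>j\<close> and \<open>i\<^sub>j\<^sub>+\<^sub>1\<close>, N maps \<open>F\<^sub>l \<subseteq> ker N\<^sup>j\<^sup>+\<^sup>1\<close> into the intersection of \<open>ker N\<^sup>j\<close> and
  \<open>im N\<close>. This is \<open>im N\<^sup>b\<^sup>-\<^sup>j\<close>, which is contained in \<open>F(i\<^sub>j) \<subseteq> F\<^sub>l\<^sub>-\<^sub>1\<close>.\<close>

lemma K_springer:
  assumes G: "G \<in> K" and l: "1 \<le> l" "l \<le> n"
  shows "Nc ` G l \<subseteq> G (l - 1)"
proof -
  obtain j where j: "j < b" "i j < l" "l \<le> i (Suc j)" by (rule block[OF l])
  have FG: "G \<in> Fls T" by (rule K_Fls[OF G])
  have "G l \<subseteq> G (i (Suc j))" using Fls_mono[OF FG j(3)] i_le_n[of "Suc j"] j by simp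
  then have h: "G l \<subseteq> Cn (high (Suc j))" using K_bounds(2)[OF G, of "Suc j"] j by auto
  have "Cn (low j) \<subseteq> G (i j)" using K_bounds(1)[OF G, of j] j by simp
  moreover have "G (i j) \<subseteq> G (l - 1)" using Fls_mono[OF FG, of "i j" "l - 1"] j l by simp
  ultimately show ?thesis using h Nc_low_iff[OF _ j(1)] Fls_Cn[OF FG l(2)] by blast
qed

text \<open>This turns out to be \<open>SV(A)\<close> in coordinates.\<close>

definition cell :: "(nat \<Rightarrow> cvec set) set"
  where "cell = {G \<in> K. \<forall>j\<in>{1..<b}. unitv (i j) \<notin> G (i j - 1)}"

lemma proj_closed:
  assumes "l \<le> n" "closedin (Gr T l) C"
  shows "closedin (Fl T) {G \<in> Fls T. G l \<in> C}"
proof -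
  have "continuous_map (Fl T) (Gr T l) (\<lambda>G. G l)" using continuous_proj[OF assms(1), of UNIV] by simp
  from closedin_continuous_map_preimage[OF this assms(2)] show ?thesis by (simp add: topspace_Fl)
qed

lemma K_closed: "closedin (Fl T) K"
proof -
  let ?C = "\<lambda>j. \<Inter>w\<in>Cn (low j). {G \<in> Fls T. w \<in> G (i j)}"
  have 1: "closedin (Fl T) {G \<in> Fls T. w \<in> G (i j)}" if "j \<in> {1..<b}" for j w
  proof -
    have "i j \<le> n" using that i_le_n by simp
    then have "closedin (Fl T) {G \<in> Fls T. G (i j) \<in> {P \<in> Gs T (i j). w \<in> P}}"
      by (rule proj_closed[OF _ closedin_Gr_mem]) simp
    moreover have "{G \<in> Fls T. G (i j) \<in> {P \<in> Gs T (i j). w \<in> P}} = {G \<in> Fls T. w \<in> G (i j)}"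
      using \<open>i j \<le> n\<close> by (auto simp: Fls_def)
    ultimately show ?thesis by simp
  qed
  have 2: "closedin (Fl T) {G \<in> Fls T. G (i j) \<subseteq> Cn (high j)}" if "j \<in> {1..<b}" for j
  proof -
    have "i j \<le> n" using that i_le_n by simp
    then have "closedin (Fl T) {G \<in> Fls T. G (i j) \<in> {P \<in> Gs T (i j). P \<subseteq> Cn (high j)}}"
      by (rule proj_closed[OF _ closedin_Gr_subset]) simp
    moreover have "{G \<in> Fls T. G (i j) \<in> {P \<in> Gs T (i j). P \<subseteq> Cn (high j)}} = {G \<in> Fls T. G (i j) \<subseteq> Cn (high j)}"
      using \<open>i j \<le> n\<close> by (auto simp: Fls_def)
    ultimately show ?thesis by simp
  qed
  have 3: "closedin (Fl T) (?C j)" if "j \<in> {1..<b}" for j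
    using 1[OF that] lsub_zero[OF lsub_Cn] by (intro closedin_INT) auto
  let ?A = "insert (Fls T) ((\<lambda>j. ?C j) ` {1..<b} \<union> (\<lambda>j. {G \<in> Fls T. G (i j) \<subseteq> Cn (high j)}) ` {1..<b})"
  have "closedin (Fl T) (\<Inter>?A)"
    using 2 3 closedin_topspace[of "Fl T"] by (intro closedin_Inter) (auto simp: topspace_Fl)
  moreover have "\<Inter>?A = K" unfolding K_def by auto
  ultimately show ?thesis by simp
qed

lemma split_last:
  assumes "z \<in> Cn (low (Suc j))"
  obtains y where "y \<in> Cn (low j)" "z = (\<lambda>a. y a + z (i (Suc j)) * unitv (i (Suc j)) a)"
    | "i (Suc j) \<in> low j"
proof (cases "i (Suc j) \<in> low j")
  case False
  show thesis
  proof (rule that(1))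
    show "(\<lambda>a. if a = i (Suc j) then 0 else z a) \<in> Cn (low j)"
      using assms by (auto simp: Cn_def low_Suc)
  qed (auto simp: unitv_def)
qed (rule that(2))

text \<open>The flag F fails to lie in the cell for those j with \<open>e(i\<^sub>j) \<in> F(i\<^sub>j - 1)\<close>. For these, choose
  \<open>u\<^sub>j\<close> in \<open>F(i\<^sub>j)\<close> but not in \<open>F(i\<^sub>j - 1)\<close>, with no coordinates in the top row, and put \<open>u\<^sub>j = 0\<close> for the
  others. The map \<open>\<eta>\<close> with \<open>\<eta> e(i\<^sub>j) = u\<^sub>j\<close> that kills the other unit vectors satisfies \<open>\<eta>\<^sup>2 = 0\<close>, hence
  \<open>1 - t \<eta>\<close> has the inverse \<open>1 + t \<eta>\<close>. It maps K to K, because \<open>u\<^sub>1, \<dots>, u\<^sub>m\<close> lie in \<open>F(i\<^sub>m)\<close> and all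
  \<open>u\<^sub>j\<close> lie in \<open>ker N\<close>. If \<open>e(i\<^sub>j)\<close> were in \<open>(1 - t \<eta>) F(i\<^sub>j - 1)\<close> with \<open>t \<noteq> 0\<close>, then
  \<open>e(i\<^sub>j) + t u\<^sub>j \<in> F(i\<^sub>j - 1)\<close>, contrary to the choice of \<open>u\<^sub>j\<close>.\<close>

lemma cell_dense:
  assumes F: "F \<in> K"
  shows "F \<in> Fl T closure_of cell"
proof -
  have FF: "F \<in> Fls T" by (rule K_Fls[OF F])
  have "\<exists>u. u \<in> F (i j) \<and> u \<in> Cn (T - i ` {1..b}) \<and>
      (if unitv (i j) \<in> F (i j - 1) then u \<notin> F (i j - 1) else u = (\<lambda>_. 0))" if j: "j \<in> {1..<b}" for j
  proof (cases "unitv (i j) \<in> F (i j - 1)")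
    case False
    have "i j \<le> n" using i_le_n j by simp
    then show ?thesis using False lsub_zero[OF Fls_lsub[OF FF]] by (intro exI[of _ "\<lambda>_. 0"]) (auto simp: Cn_def)
  next
    case True
    have n: "0 < n" using pos_n j by auto
    obtain j' where j': "j = Suc j'" using j by (cases j) auto
    have lt: "i j' < i j" "i j \<le> n" using strict[of j' j] i_le_n[of j] j n j' by auto
    have l: "lsub (F (i j - 1))" "lsub (F (i j))" using Fls_lsub[OF FF] lt by auto
    have "Cn (low j') \<subseteq> F (i j')" using K_bounds(1)[OF F, of j'] j j' by simp
    also have "\<dots> \<subseteq> F (i j - 1)" using Fls_mono[OF FF, of "i j'" "i j - 1"] lt by simp
    finally have "Cn (insert (i j) (low j')) \<subseteq> F (i j - 1)" by (rule Cn_insert_sub[OF l(1) _ True])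
    then have lowF: "Cn (low j) \<subseteq> F (i j - 1)" unfolding j' low_Suc .
    have sub: "F (i j - 1) \<subseteq> F (i j)" using Fls_mono[OF FF, of "i j - 1" "i j"] lt by simp
    obtain w where w: "w \<in> F (i j)" "w \<notin> F (i j - 1)"
    proof -
      have "i j - 1 < card T" "Suc (i j - 1) = i j" using lt by auto
      then show thesis using Fls_step(1)[OF _ FF, of "i j - 1"] that by auto
    qed
    \<comment> \<open>The part of w in the top row is supported on \<open>low j\<close> and can be removed, because
    \<open>Cn (low j)\<close> is contained in \<open>F(i\<^sub>j - 1)\<close> in the present case.\<close>
    let ?y = "\<lambda>a. if a \<in> low j then w a else 0"
    let ?u = "\<lambda>a. w a - ?y a"
    have y: "?y \<in> F (i j - 1)" using lowF by (auto simp: Cn_def)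
    have "?u \<in> F (i j)" using lsub_diff[OF l(2) w(1)] y sub by blast
    moreover have "?u \<notin> F (i j - 1)"
    proof
      assume "?u \<in> F (i j - 1)"
      from lsub_add[OF l(1) this y] have "w \<in> F (i j - 1)" by simp
      then show False using w by simp
    qed
    moreover have "?u \<in> Cn (T - i ` {1..b})"
    proof -
      have wh: "w \<in> Cn (high j)" using K_bounds(2)[OF F, of j] j w(1) by auto
      have "?u a = 0" if "a \<notin> T - i ` {1..b}" for a
      proof (cases "a \<in> low j")
        case False
        have "a \<notin> high j"
        proof
          assume "a \<in> high j"
          then have "a \<in> T" "a \<notin> i ` {j<..b}" by (auto simp: high_def)
          then have "a \<in> i ` {1..b}" using that by blast
          then obtain k where k: "k \<in> {1..b}" "a = i k" by blast
          then have "k \<le> j" using \<open>a \<notin> i ` {j<..b}\<close> by (metis greaterThanAtMost_iff atLeastAtMost_iff imageI not_le)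
          then show False using False k by (auto simp: low_def)
        qed
        then show ?thesis using wh False by (simp add: Cn_def)
      qed simp
      then show ?thesis unfolding Cn_def by blast
    qed
    ultimately show ?thesis using True by (intro exI[of _ ?u]) auto
  qed
  then obtain u where u: "\<And>j. j \<in> {1..<b} \<Longrightarrow> u j \<in> F (i j) \<and> u j \<in> Cn (T - i ` {1..b}) \<and>
      (if unitv (i j) \<in> F (i j - 1) then u j \<notin> F (i j - 1) else u j = (\<lambda>_. 0))" by metis
  define eta where "eta x = (\<lambda>a. \<Sum>j\<in>{1..<b}. x (i j) * u j a)" for x :: cvec
  define g where "g t x = (\<lambda>a. x a - t * eta x a)" for t :: complex and x :: cvec
  have u0: "u j (i k) = 0" if "j \<in> {1..<b}" "k \<in> {1..<b}" for j k
  proof -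
    have "i k \<notin> T - i ` {1..b}" using that by auto
    then show ?thesis using u[OF that(1)] by (simp add: Cn_def)
  qed
  have eta0: "eta x (i k) = 0" if "k \<in> {1..<b}" for x k
    unfolding eta_def by (rule sum.neutral) (use u0 that in auto)
  have eta_g: "eta (g t x) = eta x" for t x
    unfolding eta_def[of "g t x"] eta_def[of x] by (intro ext sum.cong refl) (simp add: g_def eta0)
  have g_inv: "g t (g (- t) x) = x" for t x
  proof -
    have "g t (g (- t) x) = (\<lambda>a. g (- t) x a - t * eta x a)" by (subst g_def) (simp add: eta_g)
    then show ?thesis by (simp add: g_def)
  qed
  have g_unit: "g t (unitv (i m)) = (\<lambda>a. unitv (i m) a - t * u m a)" if m: "m \<in> {1..<b}" for t m
  proof -
    have n: "0 < n" using pos_n m by auto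
    have "eta (unitv (i m)) a = (\<Sum>j\<in>{1..<b}. if j = m then u m a else 0)" for a
      unfolding eta_def by (rule sum.cong) (use m i_eq[of _ m] n in \<open>auto simp: unitv_def\<close>)
    then show ?thesis using m by (simp add: g_def)
  qed
  have eta_Cn: "eta x \<in> Cn (T - i ` {1..b})" for x
    using lsub_lc[OF lsub_Cn, of "{1..<b}" u "T - i ` {1..b}" "\<lambda>j. x (i j)"] u
    by (auto simp: lc_def eta_def)
  have g_lin: "g t x = lc T x (\<lambda>a. g t (unitv a))" if x: "x \<in> Cn T" for t x
  proof
    fix e
    have xx: "(\<Sum>a\<in>T. x a * unitv a c) = x c" for c by (rule Cn_expand[OF _ x]) simp
    have "(\<Sum>a\<in>T. x a * (\<Sum>j\<in>{1..<b}. unitv a (i j) * u j e)) =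
        (\<Sum>j\<in>{1..<b}. (\<Sum>a\<in>T. x a * unitv a (i j)) * u j e)"
      by (simp add: sum_distrib_left sum_distrib_right mult.assoc) (rule sum.swap)
    then have E: "(\<Sum>a\<in>T. x a * eta (unitv a) e) = eta x e" by (simp only: eta_def xx)
    have "(\<Sum>a\<in>T. x a * (t * eta (unitv a) e)) = t * (\<Sum>a\<in>T. x a * eta (unitv a) e)"
      by (simp add: sum_distrib_left mult.left_commute)
    then show "g t x e = lc T x (\<lambda>a. g t (unitv a)) e"
      unfolding lc_def g_def right_diff_distrib sum_subtractf xx E by simp
  qed
  have g_Cn: "g t x \<in> Cn X" if "x \<in> Cn X" "T - i ` {1..b} \<subseteq> X" for t x X
  proof -
    have "eta x \<in> Cn X" using eta_Cn Cn_mono[OF that(2)] by blast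
    then show ?thesis unfolding g_def using that(1) by (intro lsub_diff lsub_scale lsub_Cn)
  qed
  have g_inj: "inj_on (\<lambda>x. lc T x (\<lambda>a. g t (unitv a))) (Cn T)" for t
  proof (rule inj_onI)
    fix x y assume "x \<in> Cn T" "y \<in> Cn T" "lc T x (\<lambda>a. g t (unitv a)) = lc T y (\<lambda>a. g t (unitv a))"
    then have "g t x = g t y" by (simp only: g_lin)
    then have "g (- t) (g (- (- t)) x) = g (- t) (g (- (- t)) y)" by simp
    then show "x = y" by (simp only: g_inv)
  qed
  have g_image: "g t ` W = (\<lambda>x. lc T x (\<lambda>a. g t (unitv a))) ` W" if "W \<subseteq> Cn T" for t W
    using g_lin that by (intro image_cong) auto
  have unitT: "g t (unitv a) \<in> Cn T" if "a \<in> T" for t a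
    using that by (intro g_Cn) (auto simp: unitv_Cn)
  define G where "G t = (\<lambda>l\<in>{0..n}. g t ` F l)" for t
  have Gcont_l: "continuous_map euclidean (Gr T l) (\<lambda>t. g t ` F l)" if l: "l \<le> n" for l
    unfolding g_image[OF Fls_Cn[OF FF l]]
  proof (rule continuous_action)
    show "continuous_map euclidean (Gr T l) (\<lambda>t. F l)" using FF l by (simp add: topspace_Gr Fls_def)
    show "continuous_map euclidean euclidean (\<lambda>t. g t (unitv a) c)" for a c
      unfolding g_def by (intro continuous_map_diff continuous_map_complex_mult) auto
  qed (use unitT g_inj in auto)
  have gG: "g t ` F l \<in> Gs T l" if "l \<le> n" for t l
    using Gcont_l[OF that] topspace_Gr[of T l] by (auto simp: continuous_map_def)
  have GFls: "G t \<in> Fls T" for t using gG FF by (simp add: Fls_def G_def image_mono)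
  have Gcont: "continuous_map euclidean (Fl T) G"
    unfolding continuous_map_Fl[OF finite_atLeastAtMost] using GFls Gcont_l by (simp add: G_def)
  have GK: "G t \<in> K" for t
    unfolding K_def
  proof (intro CollectI conjI GFls ballI)
    fix m assume m: "m \<in> {1..<b}"
    have im: "i m \<le> n" using m i_le_n by simp
    have l: "lsub (F (i m))" by (rule Fls_lsub[OF FF im])
    show "Cn (low m) \<subseteq> G t (i m)"
    proof
      fix x assume x: "x \<in> Cn (low m)"
      \<comment> \<open>A vector of \<open>Cn (low m)\<close> involves only \<open>e(i\<^sub>1), \<dots>, e(i\<^sub>m)\<close>, so its image under \<open>\<eta>\<close> involves only
      \<open>u\<^sub>1, \<dots>, u\<^sub>m\<close>.\<close>
      have x0: "x (i j) = (if j \<le> m then x (i j) else 0)" if "j \<in> {1..<b}" for j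
        using i_low[of j m] x that m pos_n by (auto simp: Cn_def)
      have "eta x = lc {1..<b} (\<lambda>j. if j \<le> m then x (i j) else 0) u"
        unfolding eta_def lc_def
        by (intro ext sum.cong refl, rule arg_cong[where f = "\<lambda>v. v * _"], rule x0)
      also have "\<dots> = lc {1..m} (\<lambda>j. x (i j)) u"
        unfolding lc_def using m by (intro ext sum.mono_neutral_cong_right) auto
      also have "\<dots> \<in> F (i m)"
      proof (rule lsub_lc[OF l])
        fix j assume "j \<in> {1..m}"
        then have "u j \<in> F (i j)" "i j \<le> i m" using u[of j] mono[of j m] m by auto
        then show "u j \<in> F (i m)" using Fls_mono[OF FF, of "i j" "i m"] im by auto
      qed
      finally have "eta x \<in> F (i m)" .
      moreover have "x \<in> F (i m)" using x K_bounds(1)[OF F, of m] m by auto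
      ultimately have "g (- t) x \<in> F (i m)" unfolding g_def by (intro lsub_diff[OF l] lsub_scale[OF l])
      then have "g t (g (- t) x) \<in> g t ` F (i m)" by (rule imageI)
      then show "x \<in> G t (i m)" using im by (simp add: G_def g_inv)
    qed
    have "T - i ` {1..b} \<subseteq> high m" by (auto simp: high_def)
    then show "G t (i m) \<subseteq> Cn (high m)"
      using K_bounds(2)[OF F, of m] m g_Cn im by (auto simp: G_def)
  qed
  have Gcell: "G t \<in> cell" if t: "t \<noteq> 0" for t
    unfolding cell_def
  proof (intro CollectI conjI GK ballI notI)
    fix m assume m: "m \<in> {1..<b}" and e: "unitv (i m) \<in> G t (i m - 1)"
    have im: "i m - 1 \<le> n" using m i_le_n[of m] by simp
    have l: "lsub (F (i m - 1))" by (rule Fls_lsub[OF FF im])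
    obtain x where x: "x \<in> F (i m - 1)" "unitv (i m) = g t x" using e im by (auto simp: G_def)
    have "g (- t) (g (- (- t)) x) = x" by (rule g_inv)
    then have "x = g (- t) (unitv (i m))" using x(2) by simp
    then have xe: "x = (\<lambda>a. unitv (i m) a + t * u m a)" using g_unit[OF m] by simp
    show False
    proof (cases "unitv (i m) \<in> F (i m - 1)")
      case True
      then have "(\<lambda>a. x a - unitv (i m) a) \<in> F (i m - 1)" using x by (intro lsub_diff[OF l])
      then have "(\<lambda>a. (1 / t) * (x a - unitv (i m) a)) \<in> F (i m - 1)" by (rule lsub_scale[OF l])
      moreover have "(\<lambda>a. (1 / t) * (x a - unitv (i m) a)) = u m" using t by (auto simp: xe)
      ultimately show False using u[OF m] True by simp
    next
      case False
      then show False using u[OF m] x(1) xe by simp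
    qed
  qed
  have G0: "G 0 = F"
  proof
    fix l show "G 0 l = F l"
      using Fls_undefined[OF FF, of l] by (cases "l \<le> n") (simp_all add: G_def g_def)
  qed
  show ?thesis
    unfolding in_closure_of
  proof (intro conjI allI impI)
    show "F \<in> topspace (Fl T)" using FF by (simp add: topspace_Fl)
    fix O' assume O': "F \<in> O' \<and> openin (Fl T) O'"
    have "open {t. G t \<in> O'}"
      using openin_continuous_map_preimage[OF Gcont, of O'] O' by (simp add: open_openin[symmetric])
    moreover have "0 \<in> {t. G t \<in> O'}" using O' G0 by simp
    ultimately obtain \<epsilon> where "\<epsilon> > 0" "ball 0 \<epsilon> \<subseteq> {t. G t \<in> O'}" using open_contains_ball by blast
    moreover have "complex_of_real (\<epsilon> / 2) \<in> ball 0 \<epsilon>"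
      using \<open>\<epsilon> > 0\<close> unfolding mem_ball dist_norm by (simp add: norm_divide)
    ultimately have "complex_of_real (\<epsilon> / 2) \<in> {t. G t \<in> O'}" "complex_of_real (\<epsilon> / 2) \<noteq> 0"
      by (blast, simp)
    then show "\<exists>y. y \<in> cell \<and> y \<in> O'" using Gcell by blast
  qed
qed

lemma closure_cell:
  assumes "cell \<subseteq> C" "C \<subseteq> K"
  shows "Fl T closure_of C = K"
proof
  show "Fl T closure_of C \<subseteq> K" by (rule closure_of_minimal[OF assms(2) K_closed])
  show "K \<subseteq> Fl T closure_of C" using cell_dense closure_of_mono[OF assms(1)] by blast
qed

end

section \<open>The cell in terms of the columns of the tableau\<close>

text \<open>In a hook all boxes outside the top row lie in the first column.\<close>

locale hook_columns = hook_data +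
  fixes col :: "nat \<Rightarrow> nat"
  assumes col_i: "0 < n \<Longrightarrow> 1 \<le> j \<Longrightarrow> j \<le> b \<Longrightarrow> col (i j) = b + 1 - j"
    and col_other: "l \<in> T \<Longrightarrow> l \<notin> i ` {1..b} \<Longrightarrow> col l = 1"
begin

text \<open>The conditions on the lines \<open>F\<^sub>l / F\<^sub>l\<^sub>-\<^sub>1\<close> that define \<open>SV(A)\<close>, with the quotients written out: a line
  lies in the image of the induced power of N if each vector of \<open>F\<^sub>l\<close> is congruent modulo \<open>F\<^sub>l\<^sub>-\<^sub>1\<close> to a
  vector in the image of the power itself.\<close>

definition springer_cell :: "(nat \<Rightarrow> cvec set) set"
  where "springer_cell = {G \<in> Fls T. \<forall>l\<in>{1..n}. Nc ` G l \<subseteq> G (l - 1) \<and>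
    (\<forall>x\<in>G l. \<exists>y\<in>Imc (col l - 1). (\<lambda>a. x a - y a) \<in> G (l - 1)) \<and>
    \<not> (\<forall>x\<in>G l. \<exists>y\<in>Imc (col l). (\<lambda>a. x a - y a) \<in> G (l - 1))}"

lemma col_between:
  assumes "j < b" "i j < l" "l < i (Suc j)"
  shows "col l = 1"
proof (rule col_other)
  show "l \<in> T" using assms i_le_n[of "Suc j"] by auto
  have n: "0 < n" using assms i_le_n[of "Suc j"] by auto
  show "l \<notin> i ` {1..b}"
  proof
    assume "l \<in> i ` {1..b}"
    then obtain k where "k \<in> {1..b}" "l = i k" by auto
    then show False using assms mono[of k j] mono[of "Suc j" k] by (cases "k \<le> j") auto
  qed
qed

lemma low_decompose:
  assumes "lsub W" "Cn (low j) \<subseteq> W" "y \<in> Cn (low (Suc j))"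
  shows "(\<lambda>a. y a - y (i (Suc j)) * unitv (i (Suc j)) a) \<in> W"
proof (cases rule: split_last[OF assms(3)])
  case (1 z)
  have "y a - y (i (Suc j)) * unitv (i (Suc j)) a = z a" for a
    using fun_cong[OF 1(2), of a] by (simp only: diff_eq_eq)
  then have "(\<lambda>a. y a - y (i (Suc j)) * unitv (i (Suc j)) a) = z" by (rule ext)
  then show ?thesis using 1 assms(2) by auto
next
  case 2
  then have "unitv (i (Suc j)) \<in> W" using assms(2) by (auto simp: unitv_Cn)
  moreover have "y \<in> W" using assms 2 unfolding low_Suc by (auto simp: insert_absorb)
  ultimately show ?thesis by (intro lsub_diff lsub_scale assms(1))
qed

text \<open>At a step \<open>l = i\<^sub>j\<^sub>+\<^sub>1\<close> with \<open>j + 1 < b\<close> the line is spanned by \<open>e(i\<^sub>j\<^sub>+\<^sub>1)\<close>. At the other steps the claim is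
  that \<open>F\<^sub>l\<close> contains no vector of \<open>im N\<close> outside \<open>F\<^sub>l\<^sub>-\<^sub>1\<close>: such a vector would lie in \<open>ker N\<^sup>j\<^sup>+\<^sup>1 \<inter> im N\<close>
  and thus make \<open>e(i\<^sub>j\<^sub>+\<^sub>1)\<close> an element of \<open>F\<^sub>l\<close> too early. For \<open>j + 1 = b\<close>, all of \<open>im N\<close> is contained in \<open>F(i\<^sub>j)\<close>.\<close>

lemma cell_subset_springer_cell: "cell \<subseteq> springer_cell"
proof
  fix G assume "G \<in> cell"
  then have GK: "G \<in> K" and e: "\<And>j. j \<in> {1..<b} \<Longrightarrow> unitv (i j) \<notin> G (i j - 1)" by (auto simp: cell_def)
  have FG: "G \<in> Fls T" by (rule K_Fls[OF GK])
  have "(\<forall>x\<in>G l. \<exists>y\<in>Imc (col l - 1). (\<lambda>a. x a - y a) \<in> G (l - 1)) \<and>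
    \<not> (\<forall>x\<in>G l. \<exists>y\<in>Imc (col l). (\<lambda>a. x a - y a) \<in> G (l - 1))" if l: "l \<in> {1..n}" for l
  proof -
    have n: "0 < n" and l1: "1 \<le> l" "l \<le> n" using l by auto
    obtain j where j: "j < b" "i j < l" "l \<le> i (Suc j)" by (rule block[OF l1])
    have L: "lsub (G l)" "lsub (G (l - 1))" using Fls_lsub[OF FG] l1 by auto
    have sub: "G (l - 1) \<subseteq> G l" using Fls_mono[OF FG, of "l - 1" l] l1 by simp
    have "Cn (low j) \<subseteq> G (i j)" using K_bounds(1)[OF GK] j(1) by simp
    also have "\<dots> \<subseteq> G (l - 1)" using Fls_mono[OF FG, of "i j" "l - 1"] j l1 by simp
    finally have low: "Cn (low j) \<subseteq> G (l - 1)" .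
    have lS: "l - 1 < card T" "Suc (l - 1) = l" using l1 by auto
    obtain z where z: "z \<in> G l" "z \<notin> G (l - 1)" using Fls_step(1)[OF _ FG lS(1)] lS(2) by auto
    have not_low: "\<not> (\<forall>x\<in>G l. \<exists>y\<in>Cn (low j). (\<lambda>a. x a - y a) \<in> G (l - 1))"
    proof
      assume "\<forall>x\<in>G l. \<exists>y\<in>Cn (low j). (\<lambda>a. x a - y a) \<in> G (l - 1)"
      then obtain y where y: "y \<in> Cn (low j)" "(\<lambda>a. z a - y a) \<in> G (l - 1)" using z by blast
      then have "y \<in> G (l - 1)" using low by blast
      from lsub_add[OF L(2) y(2) this] show False using z by simp
    qed
    show ?thesis
    proof (cases "l = i (Suc j) \<and> Suc j < b")
      case True
      have c: "col l = b - j" using col_i[OF n, of "Suc j"] True by simp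
      have e1: "Imc (col l - 1) = Cn (low (Suc j))" "Imc (col l) = Cn (low j)"
      proof -
        have "b - j - 1 \<noteq> 0" "b - (b - j - 1) = Suc j" "b - j \<noteq> 0" "b - (b - j) = j" using True by auto
        then show "Imc (col l - 1) = Cn (low (Suc j))" "Imc (col l) = Cn (low j)"
          by (simp_all only: Imc_def c if_False)
      qed
      have eG: "unitv (i (Suc j)) \<in> G l" "unitv (i (Suc j)) \<notin> G (l - 1)"
      proof -
        have "unitv (i (Suc j)) \<in> Cn (low (Suc j))" by (simp add: unitv_Cn low_Suc)
        then show "unitv (i (Suc j)) \<in> G l" using K_bounds(1)[OF GK, of "Suc j"] True by auto
        show "unitv (i (Suc j)) \<notin> G (l - 1)" using e[of "Suc j"] True by simp
      qed
      have "\<exists>y\<in>Cn (low (Suc j)). (\<lambda>a. x a - y a) \<in> G (l - 1)" if x: "x \<in> G l" for x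
      proof -
        obtain c where c: "(\<lambda>a. x a - c * unitv (i (Suc j)) a) \<in> G (l - 1)"
          using Fls_step(2)[OF _ FG lS(1), unfolded lS(2)] eG x by auto
        have "(\<lambda>a. c * unitv (i (Suc j)) a) \<in> Cn (low (Suc j))"
          by (rule lsub_scale[OF lsub_Cn]) (simp add: unitv_Cn low_Suc)
        then show ?thesis using c by (intro bexI[of _ "\<lambda>a. c * unitv (i (Suc j)) a"])
      qed
      then show ?thesis using not_low unfolding e1 by blast
    next
      case False
      have c: "col l = 1"
      proof (cases "l = i (Suc j)")
        case True
        then have "Suc j = b" using False j by simp
        then show ?thesis using col_i[OF n, of b] b1 True by simp
      next
        case False
        then show ?thesis using col_between[OF j(1,2)] j(3) by simp
      qed
      have T1: "\<forall>x\<in>G l. \<exists>y\<in>Imc (col l - 1). (\<lambda>a. x a - y a) \<in> G (l - 1)"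
      proof
        fix x assume x: "x \<in> G l"
        then have "x \<in> Imc (col l - 1)" using Fls_Cn[OF FG l1(2)] by (auto simp: c Imc_def)
        then show "\<exists>y\<in>Imc (col l - 1). (\<lambda>a. x a - y a) \<in> G (l - 1)"
          using lsub_zero[OF L(2)] by (intro bexI[of _ x]) auto
      qed
      have "\<not> (\<forall>x\<in>G l. \<exists>y\<in>Imc (col l). (\<lambda>a. x a - y a) \<in> G (l - 1))"
      proof
        assume A: "\<forall>x\<in>G l. \<exists>y\<in>Imc (col l). (\<lambda>a. x a - y a) \<in> G (l - 1)"
        have "Imc (col l) = Cn (low (b - 1))" by (simp add: c Imc_def)
        with A z obtain y where y: "y \<in> Cn (low (b - 1))" "(\<lambda>a. z a - y a) \<in> G (l - 1)" by metis
        have yl: "y \<notin> G (l - 1)"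
        proof
          assume "y \<in> G (l - 1)"
          from lsub_add[OF L(2) y(2) this] show False using z by simp
        qed
        have yG: "y \<in> G l"
        proof -
          have "(\<lambda>a. z a - y a) \<in> G l" using y(2) sub by blast
          from lsub_diff[OF L(1) z(1) this] show ?thesis by simp
        qed
        show False
        proof (cases "Suc j = b")
          case True
          then have "b - 1 = j" by simp
          then show False using y(1) low yl by auto
        next
          case Sj: False
          then have Sjb: "Suc j < b" using j by simp
          then have lt: "l < i (Suc j)" using False j(3) by auto
          have im: "i (Suc j) \<le> n" using i_le_n Sjb by simp
          have "G l \<subseteq> G (i (Suc j))" using Fls_mono[OF FG j(3)] im by simp
          then have yh: "y \<in> Cn (high (Suc j))" using K_bounds(2)[OF GK, of "Suc j"] Sjb yG by auto
          have "y \<in> Cn (low (Suc j))" using low_Int_high y(1) yh by blast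
          from low_decompose[OF L(2) low this]
          have d: "(\<lambda>a. y a - y (i (Suc j)) * unitv (i (Suc j)) a) \<in> G (l - 1)" .
          have y0: "y (i (Suc j)) \<noteq> 0"
          proof
            assume "y (i (Suc j)) = 0"
            then show False using d yl by simp
          qed
          have "(\<lambda>a. y a - y (i (Suc j)) * unitv (i (Suc j)) a) \<in> G l" using d sub by blast
          from lsub_diff[OF L(1) yG this]
          have "(\<lambda>a. (1 / y (i (Suc j))) * (y a - (y a - y (i (Suc j)) * unitv (i (Suc j)) a))) \<in> G l"
            by (rule lsub_scale[OF L(1)])
          then have "unitv (i (Suc j)) \<in> G l" using y0 by simp
          moreover have "G l \<subseteq> G (i (Suc j) - 1)" using Fls_mono[OF FG, of l "i (Suc j) - 1"] lt im by simp
          ultimately show False using e[of "Suc j"] Sjb by auto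
        qed
      qed
      then show ?thesis using T1 by blast
    qed
  qed
  then show "G \<in> springer_cell" using FG K_springer[OF GK] by (simp add: springer_cell_def)
qed

text \<open>Induction on j, together with \<open>F(i\<^sub>j) \<inter> im N = im N\<^sup>b\<^sup>-\<^sup>j\<close>. No vector of \<open>im N\<close> is added between
  \<open>i\<^sub>j\<close> and \<open>i\<^sub>j\<^sub>+\<^sub>1\<close>, as the column there is the first one. So \<open>N F(i\<^sub>j\<^sub>+\<^sub>1)\<close> lies in \<open>im N\<^sup>b\<^sup>-\<^sup>j\<close>, which gives
  the condition on the kernel, while the condition on the image at the step \<open>i\<^sub>j\<^sub>+\<^sub>1\<close> forces the new
  line to be spanned by \<open>e(i\<^sub>j\<^sub>+\<^sub>1)\<close>.\<close>

lemma springer_cell_subset_cell: "springer_cell \<subseteq> cell"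
proof
  fix G assume "G \<in> springer_cell"
  then have FG: "G \<in> Fls T"
    and N: "\<And>l. l \<in> {1..n} \<Longrightarrow> Nc ` G l \<subseteq> G (l - 1)"
    and c1: "\<And>l x. l \<in> {1..n} \<Longrightarrow> x \<in> G l \<Longrightarrow> \<exists>y\<in>Imc (col l - 1). (\<lambda>a. x a - y a) \<in> G (l - 1)"
    and c2: "\<And>l. l \<in> {1..n} \<Longrightarrow> \<not> (\<forall>x\<in>G l. \<exists>y\<in>Imc (col l). (\<lambda>a. x a - y a) \<in> G (l - 1))"
    unfolding springer_cell_def by blast+
  let ?P = "\<lambda>j. Cn (low j) \<subseteq> G (i j) \<and> G (i j) \<subseteq> Cn (high j) \<and> G (i j) \<inter> Cn (low (b - 1)) \<subseteq> Cn (low j) \<and>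
    (0 < j \<longrightarrow> unitv (i j) \<notin> G (i j - 1))"
  have P: "j < b \<Longrightarrow> ?P j" for j
  proof (induction j)
    case 0
    have "G 0 = Cn {}" using Fls_zero[OF FG] by (simp add: E_def)
    then show ?case using i0 Cn_mono[of "{}" "high 0"] by (simp add: low_def)
  next
    case (Suc j)
    then have jb: "j < b" "Suc j < b" and IH: "?P j" by auto
    have n: "0 < n" using pos_n jb by simp
    let ?l = "i (Suc j)"
    have ij: "i j < ?l" "?l \<le> n" using strict[of j "Suc j"] i_le_n jb n by auto
    have below: "l < ?l \<longrightarrow> G l \<inter> Cn (low (b - 1)) \<subseteq> Cn (low j)" if "i j \<le> l" for l
      using that
    proof (induction l rule: dec_induct)
      case base
      then show ?case using IH by simp
    next
      case (step l)
      show ?case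
      proof
        assume lt: "Suc l < ?l"
        then have lT: "Suc l \<in> {1..n}" "l \<le> n" using ij by auto
        have col: "col (Suc l) = 1" by (rule col_between[OF jb(1)]) (use step lt in auto)
        have L: "lsub (G (Suc l))" "lsub (G l)" using Fls_lsub[OF FG] lT by auto
        show "G (Suc l) \<inter> Cn (low (b - 1)) \<subseteq> Cn (low j)"
        proof
          fix w assume w: "w \<in> G (Suc l) \<inter> Cn (low (b - 1))"
          have "w \<in> G l"
          proof (rule ccontr)
            assume nw: "w \<notin> G l"
            have "\<exists>y\<in>Imc (col (Suc l)). (\<lambda>a. x a - y a) \<in> G (Suc l - 1)" if x: "x \<in> G (Suc l)" for x
            proof -
              obtain c where c: "(\<lambda>a. x a - c * w a) \<in> G l"
                using Fls_step(2)[OF _ FG, of l w x] w nw x lT by auto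
              have "(\<lambda>a. c * w a) \<in> Cn (low (b - 1))" using w by (intro lsub_scale[OF lsub_Cn]) auto
              then have "(\<lambda>a. c * w a) \<in> Imc (col (Suc l))" by (simp add: col Imc_def)
              then show ?thesis using c by (intro bexI[of _ "\<lambda>a. c * w a"]) simp_all
            qed
            then show False using c2[OF lT(1)] by blast
          qed
          then show "w \<in> Cn (low j)" using w step.IH lt by auto
        qed
      qed
    qed
    let ?L = "?l - 1"
    have lT: "?l \<in> {1..n}" "?L \<le> n" using ij by auto
    have L: "lsub (G ?l)" "lsub (G ?L)" using Fls_lsub[OF FG] ij by auto
    have sub: "G ?L \<subseteq> G ?l" using Fls_mono[OF FG, of ?L ?l] ij by simp
    have bL: "G ?L \<inter> Cn (low (b - 1)) \<subseteq> Cn (low j)" using below[of ?L] ij by simp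
    have "G (i j) \<subseteq> G ?L" using Fls_mono[OF FG, of "i j" ?L] ij by simp
    then have lowL: "Cn (low j) \<subseteq> G ?L" using IH by auto
    have high: "G ?l \<subseteq> Cn (high (Suc j))"
    proof
      fix x assume x: "x \<in> G ?l"
      then have "Nc x \<in> G ?L" using N[OF lT(1)] by auto
      then have "Nc x \<in> Cn (low j)" using Nc_low[of x] bL by auto
      then show "x \<in> Cn (high (Suc j))" using Nc_low_iff[OF _ jb(1), of x] x Fls_Cn[OF FG ij(2)] by auto
    qed
    have "i (Suc j) \<notin> low j" using i_low[of "Suc j" j] jb n by simp
    then have "unitv ?l \<notin> Cn (low j)" by (simp add: unitv_Cn)
    moreover have "Suc j \<le> b - 1" using jb by simp
    then have "low (Suc j) \<subseteq> low (b - 1)" by (rule low_mono)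
    then have "unitv ?l \<in> Cn (low (b - 1))" by (auto simp: unitv_Cn low_Suc)
    ultimately have eL: "unitv ?l \<notin> G ?L" using bL by auto
    have "?L < card T" "Suc ?L = ?l" using ij by auto
    then obtain x where x: "x \<in> G ?l" "x \<notin> G ?L" using Fls_step(1)[OF _ FG, of ?L] by auto
    have col: "col ?l = b - j" using col_i[OF n, of "Suc j"] jb by simp
    have "Imc (col ?l - 1) = Cn (low (Suc j))" using jb by (simp add: col Imc_def)
    with c1[OF lT(1) x(1)] obtain y where y: "y \<in> Cn (low (Suc j))" "(\<lambda>a. x a - y a) \<in> G ?L" by auto
    let ?c = "y ?l"
    have "(\<lambda>a. y a - ?c * unitv ?l a) \<in> G ?L" by (rule low_decompose[OF L(2) lowL y(1)])
    from lsub_add[OF L(2) y(2) this] have d: "(\<lambda>a. x a - ?c * unitv ?l a) \<in> G ?L" by simp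
    have c0: "?c \<noteq> 0"
    proof
      assume "?c = 0"
      then show False using d x(2) by simp
    qed
    have "(\<lambda>a. x a - ?c * unitv ?l a) \<in> G ?l" using d sub by blast
    from lsub_diff[OF L(1) x(1) this]
    have "(\<lambda>a. (1 / ?c) * (x a - (x a - ?c * unitv ?l a))) \<in> G ?l" by (rule lsub_scale[OF L(1)])
    then have el: "unitv ?l \<in> G ?l" using c0 by simp
    have low': "Cn (low (Suc j)) \<subseteq> G ?l"
      unfolding low_Suc by (rule Cn_insert_sub[OF L(1) _ el]) (use lowL sub in auto)
    have "G ?l \<inter> Cn (low (b - 1)) \<subseteq> Cn (low (Suc j))"
    proof
      fix w assume w: "w \<in> G ?l \<inter> Cn (low (b - 1))"
      then have wh: "w \<in> Cn (high (Suc j))" using high by auto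
      show "w \<in> Cn (low (Suc j))" using low_Int_high w wh by blast
    qed
    then show ?case using low' high eL by simp
  qed
  then show "G \<in> cell" using FG unfolding cell_def K_def by simp
qed

lemma springer_cell: "springer_cell = cell"
  using cell_subset_springer_cell springer_cell_subset_cell by blast

end

section \<open>Coordinates on subspaces and quotient spaces\<close>

text \<open>All vector space axioms other than closure are pulled back from \<open>Cn S\<close> along the injection \<open>\<phi>\<close>.\<close>

lemma coordsI:
  fixes Q :: "'q cvs"
  assumes fin: "finite S" and inj: "inj_on \<phi> (carrier Q)" and surj: "\<phi> ` carrier Q = Cn S"
    and zero: "\<zero>\<^bsub>Q\<^esub> \<in> carrier Q" "\<phi> \<zero>\<^bsub>Q\<^esub> = (\<lambda>_. 0)"
    and add: "\<And>x y. x \<in> carrier Q \<Longrightarrow> y \<in> carrier Q \<Longrightarrow> x \<oplus>\<^bsub>Q\<^esub> y \<in> carrier Q"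
      "\<And>x y. x \<in> carrier Q \<Longrightarrow> y \<in> carrier Q \<Longrightarrow> \<phi> (x \<oplus>\<^bsub>Q\<^esub> y) = (\<lambda>a. \<phi> x a + \<phi> y a)"
    and smult: "\<And>c x. x \<in> carrier Q \<Longrightarrow> c \<odot>\<^bsub>Q\<^esub> x \<in> carrier Q"
      "\<And>c x. x \<in> carrier Q \<Longrightarrow> \<phi> (c \<odot>\<^bsub>Q\<^esub> x) = (\<lambda>a. c * \<phi> x a)"
  shows "coords Q \<phi> S"
proof -
  have eqI: "x = y" if "x \<in> carrier Q" "y \<in> carrier Q" "\<phi> x = \<phi> y" for x y
    using inj_onD[OF inj that(3)] that by simp
  have neg: "\<exists>y\<in>carrier Q. x \<oplus>\<^bsub>Q\<^esub> y = \<zero>\<^bsub>Q\<^esub>" if x: "x \<in> carrier Q" for x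
  proof (rule bexI)
    show y: "(-1) \<odot>\<^bsub>Q\<^esub> x \<in> carrier Q" by (rule smult(1)[OF x])
    show "x \<oplus>\<^bsub>Q\<^esub> (-1) \<odot>\<^bsub>Q\<^esub> x = \<zero>\<^bsub>Q\<^esub>"
      by (rule eqI) (simp_all add: add[OF x y] zero smult[OF x])
  qed
  let ?K = "class_ring :: complex ring"
  have "vectorspace ?K Q"
  proof (rule vs_criteria[OF class_field])
    show "\<zero>\<^bsub>Q\<^esub> \<in> carrier Q" by (rule zero)
    show "\<forall>v w. v \<in> carrier Q \<and> w \<in> carrier Q \<longrightarrow> v \<oplus>\<^bsub>Q\<^esub> w \<in> carrier Q" using add(1) by blast
    show "\<forall>v\<in>carrier Q. \<exists>neg_v\<in>carrier Q. v \<oplus>\<^bsub>Q\<^esub> neg_v = \<zero>\<^bsub>Q\<^esub>" using neg by blast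
    show "\<forall>c v. c \<in> carrier ?K \<and> v \<in> carrier Q \<longrightarrow> c \<odot>\<^bsub>Q\<^esub> v \<in> carrier Q" using smult(1) by blast
    show "\<forall>v w. v \<in> carrier Q \<and> w \<in> carrier Q \<longrightarrow> v \<oplus>\<^bsub>Q\<^esub> w = w \<oplus>\<^bsub>Q\<^esub> v"
    proof (intro allI impI)
      fix v w assume "v \<in> carrier Q \<and> w \<in> carrier Q"
      then show "v \<oplus>\<^bsub>Q\<^esub> w = w \<oplus>\<^bsub>Q\<^esub> v" by (intro eqI) (simp_all add: add add.commute)
    qed
    show "\<forall>v w x. v \<in> carrier Q \<and> w \<in> carrier Q \<and> x \<in> carrier Q \<longrightarrow> v \<oplus>\<^bsub>Q\<^esub> w \<oplus>\<^bsub>Q\<^esub> x = v \<oplus>\<^bsub>Q\<^esub> (w \<oplus>\<^bsub>Q\<^esub> x)"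
    proof (intro allI impI)
      fix v w x assume "v \<in> carrier Q \<and> w \<in> carrier Q \<and> x \<in> carrier Q"
      then show "v \<oplus>\<^bsub>Q\<^esub> w \<oplus>\<^bsub>Q\<^esub> x = v \<oplus>\<^bsub>Q\<^esub> (w \<oplus>\<^bsub>Q\<^esub> x)" by (intro eqI) (simp_all add: add add.assoc)
    qed
    show "\<forall>v\<in>carrier Q. v \<oplus>\<^bsub>Q\<^esub> \<zero>\<^bsub>Q\<^esub> = v"
    proof
      fix v assume "v \<in> carrier Q"
      then show "v \<oplus>\<^bsub>Q\<^esub> \<zero>\<^bsub>Q\<^esub> = v" by (intro eqI) (simp_all add: add zero)
    qed
    show "\<forall>a b v. a \<in> carrier ?K \<and> b \<in> carrier ?K \<and> v \<in> carrier Q \<longrightarrow>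
        (a \<otimes>\<^bsub>?K\<^esub> b) \<odot>\<^bsub>Q\<^esub> v = a \<odot>\<^bsub>Q\<^esub> (b \<odot>\<^bsub>Q\<^esub> v)"
    proof (intro allI impI)
      fix a b v assume "a \<in> carrier ?K \<and> b \<in> carrier ?K \<and> v \<in> carrier Q"
      then have "v \<in> carrier Q" by simp
      then show "(a \<otimes>\<^bsub>?K\<^esub> b) \<odot>\<^bsub>Q\<^esub> v = a \<odot>\<^bsub>Q\<^esub> (b \<odot>\<^bsub>Q\<^esub> v)"
        by (intro eqI) (simp_all add: smult mult.assoc)
    qed
    show "\<forall>v\<in>carrier Q. \<one>\<^bsub>?K\<^esub> \<odot>\<^bsub>Q\<^esub> v = v"
    proof
      fix v assume "v \<in> carrier Q"
      then show "\<one>\<^bsub>?K\<^esub> \<odot>\<^bsub>Q\<^esub> v = v" by (intro eqI) (simp_all add: smult)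
    qed
    show "\<forall>a b v. a \<in> carrier ?K \<and> b \<in> carrier ?K \<and> v \<in> carrier Q \<longrightarrow>
        (a \<oplus>\<^bsub>?K\<^esub> b) \<odot>\<^bsub>Q\<^esub> v = a \<odot>\<^bsub>Q\<^esub> v \<oplus>\<^bsub>Q\<^esub> b \<odot>\<^bsub>Q\<^esub> v"
    proof (intro allI impI)
      fix a b v assume "a \<in> carrier ?K \<and> b \<in> carrier ?K \<and> v \<in> carrier Q"
      then have "v \<in> carrier Q" by simp
      then show "(a \<oplus>\<^bsub>?K\<^esub> b) \<odot>\<^bsub>Q\<^esub> v = a \<odot>\<^bsub>Q\<^esub> v \<oplus>\<^bsub>Q\<^esub> b \<odot>\<^bsub>Q\<^esub> v"
        by (intro eqI) (simp_all add: add smult distrib_right)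
    qed
    show "\<forall>a v w. a \<in> carrier ?K \<and> v \<in> carrier Q \<and> w \<in> carrier Q \<longrightarrow>
        a \<odot>\<^bsub>Q\<^esub> (v \<oplus>\<^bsub>Q\<^esub> w) = a \<odot>\<^bsub>Q\<^esub> v \<oplus>\<^bsub>Q\<^esub> a \<odot>\<^bsub>Q\<^esub> w"
    proof (intro allI impI)
      fix a v w assume "a \<in> carrier ?K \<and> v \<in> carrier Q \<and> w \<in> carrier Q"
      then have "v \<in> carrier Q" "w \<in> carrier Q" by simp_all
      then show "a \<odot>\<^bsub>Q\<^esub> (v \<oplus>\<^bsub>Q\<^esub> w) = a \<odot>\<^bsub>Q\<^esub> v \<oplus>\<^bsub>Q\<^esub> a \<odot>\<^bsub>Q\<^esub> w"
        by (intro eqI) (simp_all add: add smult distrib_left)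
    qed
  qed
  then show ?thesis
    by (intro coords.intro lin_inj.intro lin_inj_axioms.intro coords_axioms.intro inj fin surj add(2) smult(2))
qed

context lin_inj
begin

lemma subspaceD:
  assumes "is_subspace W V"
  shows "W \<subseteq> carrier V" "lsub (\<phi> ` W)"
proof -
  show W: "W \<subseteq> carrier V" using assms by (simp add: subspace_def submodule_def)
  show "lsub (\<phi> ` W)" using assms subspace_iff[OF W] by simp
qed

lemma coset_eq_Collect:
  assumes W: "is_subspace W V" and x: "x \<in> carrier V"
  shows "W +> x = {z \<in> carrier V. (\<lambda>a. \<phi> z a - \<phi> x a) \<in> \<phi> ` W}"
proof (intro equalityI subsetI)
  fix z assume "z \<in> W +> x"
  then obtain w where w: "w \<in> W" "z = w \<oplus> x" unfolding a_r_coset_def' by auto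
  then have "w \<in> carrier V" using subspaceD(1)[OF W] by auto
  then show "z \<in> {z \<in> carrier V. (\<lambda>a. \<phi> z a - \<phi> x a) \<in> \<phi> ` W}"
    using w x by (simp add: phi_add)
next
  fix z assume "z \<in> {z \<in> carrier V. (\<lambda>a. \<phi> z a - \<phi> x a) \<in> \<phi> ` W}"
  then obtain w where w: "w \<in> W" "(\<lambda>a. \<phi> z a - \<phi> x a) = \<phi> w" and z: "z \<in> carrier V" by auto
  then have wc: "w \<in> carrier V" using subspaceD(1)[OF W] by auto
  have "\<phi> z a = \<phi> w a + \<phi> x a" for a using fun_cong[OF w(2), of a] by (simp only: diff_eq_eq)
  then have "\<phi> z = \<phi> (w \<oplus> x)" unfolding phi_add[OF wc x] by (rule ext)
  then have "z = w \<oplus> x" using inj_onD[OF inj] z wc x by simp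
  then show "z \<in> W +> x" using w(1) unfolding a_r_coset_def' by blast
qed

lemma coset_eq_iff:
  assumes W: "is_subspace W V" and x: "x \<in> carrier V" and y: "y \<in> carrier V"
  shows "W +> x = W +> y \<longleftrightarrow> (\<lambda>a. \<phi> x a - \<phi> y a) \<in> \<phi> ` W"
proof
  assume "W +> x = W +> y"
  moreover have "x \<in> W +> x"
    unfolding coset_eq_Collect[OF W x] using x lsub_zero[OF subspaceD(2)[OF W]] by simp
  ultimately show "(\<lambda>a. \<phi> x a - \<phi> y a) \<in> \<phi> ` W" unfolding coset_eq_Collect[OF W y] by simp
next
  assume d: "(\<lambda>a. \<phi> x a - \<phi> y a) \<in> \<phi> ` W"
  note L = subspaceD(2)[OF W]
  have "(\<lambda>a. \<phi> z a - \<phi> x a) \<in> \<phi> ` W \<longleftrightarrow> (\<lambda>a. \<phi> z a - \<phi> y a) \<in> \<phi> ` W" for z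
  proof
    assume "(\<lambda>a. \<phi> z a - \<phi> x a) \<in> \<phi> ` W"
    from lsub_add[OF L this d] show "(\<lambda>a. \<phi> z a - \<phi> y a) \<in> \<phi> ` W" by simp
  next
    assume "(\<lambda>a. \<phi> z a - \<phi> y a) \<in> \<phi> ` W"
    from lsub_diff[OF L this d] show "(\<lambda>a. \<phi> z a - \<phi> x a) \<in> \<phi> ` W" by simp
  qed
  then show "W +> x = W +> y" unfolding coset_eq_Collect[OF W x] coset_eq_Collect[OF W y] by simp
qed

lemma coset_zero:
  assumes W: "is_subspace W V"
  shows "W +> \<zero> = W"
proof -
  have "W +> \<zero> = {z \<in> carrier V. \<phi> z \<in> \<phi> ` W}"
    using coset_eq_Collect[OF W zero_closed] by (simp add: phi_zero)
  also have "\<dots> = W" using subspaceD(1)[OF W] inj by (auto dest: inj_onD)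
  finally show ?thesis .
qed

lemma carrier_quotient: "carrier (quotient_space V W) = (\<lambda>x. W +> x) ` carrier V"
  by (auto simp: quotient_space_def A_RCOSETS_def')

lemma quotient_add:
  assumes W: "is_subspace W V" and x: "x \<in> carrier V" and y: "y \<in> carrier V"
  shows "(W +> x) \<oplus>\<^bsub>quotient_space V W\<^esub> (W +> y) = W +> (x \<oplus> y)"
proof -
  have "set_add V (W +> x) (W +> y) = W +> (x \<oplus> y)"
  proof (intro equalityI subsetI)
    fix z assume "z \<in> set_add V (W +> x) (W +> y)"
    then obtain h k where hk: "h \<in> W +> x" "k \<in> W +> y" "z = h \<oplus> k" unfolding set_add_def' by auto
    then have h: "h \<in> carrier V" "(\<lambda>a. \<phi> h a - \<phi> x a) \<in> \<phi> ` W" "k \<in> carrier V" "(\<lambda>a. \<phi> k a - \<phi> y a) \<in> \<phi> ` W"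
      unfolding coset_eq_Collect[OF W x] coset_eq_Collect[OF W y] by auto
    have "\<phi> z a - \<phi> (x \<oplus> y) a = (\<phi> h a - \<phi> x a) + (\<phi> k a - \<phi> y a)" for a
      using h x y by (simp add: hk(3) phi_add)
    then have "(\<lambda>a. \<phi> z a - \<phi> (x \<oplus> y) a) \<in> \<phi> ` W"
      using lsub_add[OF subspaceD(2)[OF W] h(2,4)] by presburger
    then show "z \<in> W +> (x \<oplus> y)" using h x y hk(3) by (subst coset_eq_Collect[OF W]) auto
  next
    fix z assume "z \<in> W +> (x \<oplus> y)"
    then obtain w where w: "w \<in> W" "z = w \<oplus> (x \<oplus> y)" unfolding a_r_coset_def' by auto
    have wc: "w \<in> carrier V" using w subspaceD(1)[OF W] by auto
    have "w \<oplus> x \<in> W +> x" using w(1) unfolding a_r_coset_def' by blast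
    moreover have "y \<in> W +> y"
      unfolding coset_eq_Collect[OF W y] using y lsub_zero[OF subspaceD(2)[OF W]] by simp
    moreover have "z = (w \<oplus> x) \<oplus> y" using w(2) wc x y by (simp add: a_assoc)
    ultimately show "z \<in> set_add V (W +> x) (W +> y)" unfolding set_add_def' by blast
  qed
  then show ?thesis by (simp add: quotient_space_def)
qed

lemma coset_Union_const:
  assumes W: "is_subspace W V" and x: "x \<in> carrier V" and "\<And>u. u \<in> W +> x \<Longrightarrow> f u = C"
  shows "(\<Union>u\<in>W +> x. f u) = C"
proof -
  have "x \<in> W +> x"
    unfolding coset_eq_Collect[OF W x] using x lsub_zero[OF subspaceD(2)[OF W]] by simp
  then show ?thesis using assms(3) by blast
qed

lemma quotient_smult:
  assumes W: "is_subspace W V" and x: "x \<in> carrier V"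
  shows "c \<odot>\<^bsub>quotient_space V W\<^esub> (W +> x) = W +> (c \<odot> x)"
proof -
  have "W +> (c \<odot> u) = W +> (c \<odot> x)" if "u \<in> W +> x" for u
  proof -
    have u: "u \<in> carrier V" "(\<lambda>a. \<phi> u a - \<phi> x a) \<in> \<phi> ` W"
      using that unfolding coset_eq_Collect[OF W x] by auto
    have "\<phi> (c \<odot> u) a - \<phi> (c \<odot> x) a = c * (\<phi> u a - \<phi> x a)" for a
      using u x by (simp add: phi_smult right_diff_distrib)
    then have "(\<lambda>a. \<phi> (c \<odot> u) a - \<phi> (c \<odot> x) a) \<in> \<phi> ` W"
      using lsub_scale[OF subspaceD(2)[OF W] u(2)] by presburger
    then show ?thesis by (subst coset_eq_iff[OF W smult_in[OF u(1)] smult_in[OF x]])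
  qed
  then have "(\<Union>u\<in>W +> x. W +> (c \<odot> u)) = W +> (c \<odot> x)" by (rule coset_Union_const[OF W x])
  then show ?thesis by (simp add: quotient_space_def)
qed

end

context coords
begin

text \<open>For a chart I of W the remaining coordinates are coordinates on the quotient: subtract from a vector
  the element of W with the same coordinates in I.\<close>

lemma coords_quotient:
  assumes W: "is_subspace W V" and I: "I \<subseteq> S" "chart I (\<phi> ` W)"
  shows "\<exists>\<Phi>. coords (quotient_space V W) \<Phi> (S - I)"
proof -
  let ?r = "rr I (\<phi> ` W)"
  have L: "lsub (\<phi> ` W)" and Wc: "W \<subseteq> carrier V" using subspaceD[OF W] by auto
  have finI: "finite I" by (rule finite_subset[OF I(1) finS])
  \<comment> \<open>The projection to \<open>Cn (S - I)\<close> along the image of W.\<close>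
  define \<tau> where "\<tau> w = (\<lambda>a. w a - lc I w ?r a)" for w
  have rS: "?r d \<in> Cn S" if "d \<in> I" for d
    using rr(1)[OF I(2) that] Wc phi_in by auto
  have tau_diff: "\<tau> (\<lambda>a. w a - w' a) = (\<lambda>a. \<tau> w a - \<tau> w' a)" for w w'
    by (auto simp: \<tau>_def lc_def left_diff_distrib sum_subtractf)
  have tau_add: "\<tau> (\<lambda>a. w a + w' a) = (\<lambda>a. \<tau> w a + \<tau> w' a)" for w w'
    by (auto simp: \<tau>_def lc_def distrib_right sum.distrib)
  have tau_scale: "\<tau> (\<lambda>a. c * w a) = (\<lambda>a. c * \<tau> w a)" for c w
    by (auto simp: \<tau>_def lc_def right_diff_distrib sum_distrib_left mult.assoc)
  have tau_zero: "\<tau> (\<lambda>_. 0) = (\<lambda>_. 0)" by (auto simp: \<tau>_def lc_def)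
  have tau_ker: "w \<in> \<phi> ` W \<longleftrightarrow> \<tau> w = (\<lambda>_. 0)" for w
  proof -
    have "\<tau> w = (\<lambda>_. 0) \<longleftrightarrow> lc I w ?r = w" by (auto simp: \<tau>_def fun_eq_iff)
    then show ?thesis using chart_mem_iff[OF L I(2) finI] by simp
  qed
  have tau_eq: "\<tau> w = \<tau> w' \<longleftrightarrow> (\<lambda>a. w a - w' a) \<in> \<phi> ` W" for w w'
    unfolding tau_ker tau_diff by (auto simp: fun_eq_iff)
  have tau_in: "\<tau> w \<in> Cn (S - I)" if "w \<in> Cn S" for w
    unfolding Cn_def
  proof (intro CollectI allI impI)
    fix a assume a: "a \<notin> S - I"
    show "\<tau> w a = 0"
    proof (cases "a \<in> I")
      case True
      then show ?thesis using lc_rr_coord[OF finI I(2), of a w] by (simp add: \<tau>_def)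
    next
      case False
      then have "a \<notin> S" using a by simp
      moreover have "lc I w ?r \<in> Cn S" by (rule lsub_lc[OF lsub_Cn rS])
      ultimately show ?thesis using that by (simp add: \<tau>_def Cn_def)
    qed
  qed
  have tau_id: "\<tau> w = w" if "w \<in> Cn (S - I)" for w
  proof -
    have "w d = 0" if "d \<in> I" for d using that \<open>w \<in> Cn (S - I)\<close> by (simp add: Cn_def)
    then show ?thesis by (simp add: \<tau>_def lc_def)
  qed
  define \<Phi> where "\<Phi> C = \<tau> (\<phi> (SOME x. x \<in> C))" for C
  have Phi: "\<Phi> (W +> x) = \<tau> (\<phi> x)" if x: "x \<in> carrier V" for x
  proof -
    have "x \<in> W +> x" unfolding coset_eq_Collect[OF W x] using x lsub_zero[OF L] by simp
    then have "(SOME x'. x' \<in> W +> x) \<in> W +> x" by (rule someI)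
    then show ?thesis unfolding \<Phi>_def tau_eq by (simp add: coset_eq_Collect[OF W x])
  qed
  have "coords (quotient_space V W) \<Phi> (S - I)"
  proof (rule coordsI)
    show "finite (S - I)" using finS by simp
    show "inj_on \<Phi> (carrier (quotient_space V W))"
      unfolding carrier_quotient
    proof (rule inj_onI)
      fix C D assume "C \<in> (+>) W ` carrier V" "D \<in> (+>) W ` carrier V" "\<Phi> C = \<Phi> D"
      then obtain x y where xy: "x \<in> carrier V" "y \<in> carrier V" "C = W +> x" "D = W +> y" by auto
      then have "\<tau> (\<phi> x) = \<tau> (\<phi> y)" using \<open>\<Phi> C = \<Phi> D\<close> Phi by simp
      then show "C = D" unfolding xy(3,4) coset_eq_iff[OF W xy(1,2)] tau_eq .
    qed
    show "\<Phi> ` carrier (quotient_space V W) = Cn (S - I)"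
      unfolding carrier_quotient
    proof (intro equalityI subsetI)
      fix w assume "w \<in> \<Phi> ` (+>) W ` carrier V"
      then show "w \<in> Cn (S - I)" using Phi tau_in phi_in by auto
    next
      fix w assume w: "w \<in> Cn (S - I)"
      then have wS: "w \<in> Cn S" using Cn_mono[of "S - I" S] by auto
      have "\<Phi> (W +> \<psi> w) = w" using Phi[OF psi_in[OF wS]] phi_psi[OF wS] tau_id[OF w] by simp
      then show "w \<in> \<Phi> ` (+>) W ` carrier V" using psi_in[OF wS] by (metis imageI)
    qed
    have z: "\<zero>\<^bsub>quotient_space V W\<^esub> = W +> \<zero>" by (simp add: quotient_space_def coset_zero[OF W])
    show "\<zero>\<^bsub>quotient_space V W\<^esub> \<in> carrier (quotient_space V W)" unfolding z carrier_quotient by simp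
    show "\<Phi> \<zero>\<^bsub>quotient_space V W\<^esub> = (\<lambda>_. 0)" unfolding z Phi[OF zero_closed] by (simp add: phi_zero tau_zero)
  next
    fix C D assume "C \<in> carrier (quotient_space V W)" "D \<in> carrier (quotient_space V W)"
    then obtain x y where xy: "x \<in> carrier V" "y \<in> carrier V" "C = W +> x" "D = W +> y"
      unfolding carrier_quotient by auto
    then show "C \<oplus>\<^bsub>quotient_space V W\<^esub> D \<in> carrier (quotient_space V W)"
      unfolding carrier_quotient by (simp add: quotient_add[OF W])
    show "\<Phi> (C \<oplus>\<^bsub>quotient_space V W\<^esub> D) = (\<lambda>a. \<Phi> C a + \<Phi> D a)"
      using xy by (simp add: quotient_add[OF W] Phi phi_add tau_add)
  next
    fix c C assume "C \<in> carrier (quotient_space V W)"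
    then obtain x where x: "x \<in> carrier V" "C = W +> x" unfolding carrier_quotient by auto
    then show "c \<odot>\<^bsub>quotient_space V W\<^esub> C \<in> carrier (quotient_space V W)"
      unfolding carrier_quotient using smult_in by (simp add: quotient_smult[OF W])
    show "\<Phi> (c \<odot>\<^bsub>quotient_space V W\<^esub> C) = (\<lambda>a. c * \<Phi> C a)"
      using x smult_in[OF x(1)] by (simp add: quotient_smult[OF W] Phi phi_smult tau_scale)
  qed
  then show ?thesis by blast
qed

lemma coords_subspace:
  assumes W: "is_subspace W V" and I: "I \<subseteq> S" "chart I (\<phi> ` W)"
  shows "\<exists>\<Phi>. coords (V\<lparr>carrier := W\<rparr>) \<Phi> I"
proof -
  have L: "lsub (\<phi> ` W)" and Wc: "W \<subseteq> carrier V" using subspaceD[OF W] by auto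
  have finI: "finite I" by (rule finite_subset[OF I(1) finS])
  interpret sub: lin_inj "V\<lparr>carrier := W\<rparr>" \<phi> by (rule lin_inj_subspace[OF W])
  let ?\<Phi> = "\<lambda>w a. if a \<in> I then \<phi> w a else 0"
  have "coords (V\<lparr>carrier := W\<rparr>) ?\<Phi> I"
  proof (intro coords.intro lin_inj.intro lin_inj_axioms.intro coords_axioms.intro finI subspace_is_vs[OF W])
    show "inj_on ?\<Phi> (carrier (V\<lparr>carrier := W\<rparr>))"
    proof (rule inj_onI)
      fix x y assume xy: "x \<in> carrier (V\<lparr>carrier := W\<rparr>)" "y \<in> carrier (V\<lparr>carrier := W\<rparr>)" "?\<Phi> x = ?\<Phi> y"
      have "\<phi> x = \<phi> y"
      proof (rule chart_eqI[OF L I(2)])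
        show "\<phi> x b = \<phi> y b" if "b \<in> I" for b using fun_cong[OF xy(3), of b] that by simp
      qed (use xy in auto)
      then show "x = y" using inj_onD[OF sub.inj] xy by blast
    qed
    show "?\<Phi> ` carrier (V\<lparr>carrier := W\<rparr>) = Cn I"
    proof (intro equalityI subsetI)
      fix w assume w: "w \<in> Cn I"
      have "lc I w (rr I (\<phi> ` W)) \<in> \<phi> ` W" by (rule lsub_lc[OF L rr(1)[OF I(2)]])
      then obtain v where v: "v \<in> W" "\<phi> v = lc I w (rr I (\<phi> ` W))" by auto
      have "?\<Phi> v = w"
      proof
        fix a show "?\<Phi> v a = w a"
          using lc_rr_coord[OF finI I(2), of a w] w by (cases "a \<in> I") (simp_all add: v(2) Cn_def)
      qed
      then show "w \<in> ?\<Phi> ` carrier (V\<lparr>carrier := W\<rparr>)" using v(1) by auto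
    qed (auto simp: Cn_def)
  qed (use sub.phi_add sub.phi_smult in \<open>auto simp: fun_eq_iff\<close>)
  then show ?thesis by blast
qed

lemma coords_reindex:
  assumes "finite S'" "card S' = card S"
  shows "\<exists>\<Phi>. coords V \<Phi> S'"
proof -
  obtain e where e: "bij_betw e S' S" using finite_same_card_bij[OF assms(1) finS assms(2)] by blast
  have eS: "e a \<in> S" if "a \<in> S'" for a using bij_betwE[OF e] that by auto
  let ?\<Phi> = "\<lambda>v a. if a \<in> S' then \<phi> v (e a) else 0"
  have "coords V ?\<Phi> S'"
  proof (intro coords.intro lin_inj.intro lin_inj_axioms.intro coords_axioms.intro assms(1) vectorspace_axioms)
    show "inj_on ?\<Phi> (carrier V)"
    proof (rule inj_onI)
      fix x y assume xy: "x \<in> carrier V" "y \<in> carrier V" "?\<Phi> x = ?\<Phi> y"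
      have "\<phi> x c = \<phi> y c" for c
      proof (cases "c \<in> S")
        case True
        then obtain a where "a \<in> S'" "c = e a" using e by (auto simp: bij_betw_def)
        then show ?thesis using fun_cong[OF xy(3), of a] by simp
      next
        case False
        then show ?thesis using phi_in[OF xy(1)] phi_in[OF xy(2)] by (simp add: Cn_def)
      qed
      then show "x = y" using inj_onD[OF inj] xy by blast
    qed
    show "?\<Phi> ` carrier V = Cn S'"
    proof (intro equalityI subsetI)
      fix w assume w: "w \<in> Cn S'"
      let ?w = "\<lambda>c. if c \<in> S then w (inv_into S' e c) else 0"
      have wS: "?w \<in> Cn S" by (simp add: Cn_def)
      have eq: "?\<Phi> (\<psi> ?w) = w"
      proof
        fix a show "?\<Phi> (\<psi> ?w) a = w a"
          using phi_psi[OF wS] w eS[of a] bij_betw_inv_into_left[OF e, of a]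
          by (cases "a \<in> S'") (simp_all add: Cn_def)
      qed
      have "?\<Phi> (\<psi> ?w) \<in> ?\<Phi> ` carrier V" by (rule imageI[OF psi_in[OF wS]])
      then show "w \<in> ?\<Phi> ` carrier V" by (simp only: eq)
    qed (auto simp: Cn_def)
  qed (auto simp: phi_add phi_smult fun_eq_iff)
  then show ?thesis by blast
qed

end

text \<open>Dimension without a choice of coordinates. This is inherited by subspaces and
  quotients, and it suffices to determine Grassmannians and flag varieties up to homeomorphism.\<close>

definition has_dim :: "'v cvs \<Rightarrow> nat \<Rightarrow> bool"
  where "has_dim V m \<longleftrightarrow> (\<exists>\<phi> S. coords V \<phi> S \<and> card S = m)"

lemma has_dim_coords:
  assumes "has_dim V m" "finite S" "card S = m"
  shows "\<exists>\<phi>. coords V \<phi> S"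
proof -
  obtain \<phi> S0 where "coords V \<phi> S0" "card S0 = m" using assms(1) by (auto simp: has_dim_def)
  then show ?thesis using coords.coords_reindex[of V \<phi> S0 S] assms(2,3) by simp
qed

lemma has_dim_grassmannian:
  assumes "has_dim V m" "finite S" "card S = m"
  shows "Gr S k homeomorphic_space grassmannian V k"
proof -
  obtain \<phi> where "coords V \<phi> S" using has_dim_coords[OF assms] by blast
  then show ?thesis
    using coords.grassmannian_homeo[of V \<phi> S k] homeomorphic_maps_sym unfolding homeomorphic_space_def by blast
qed

lemma has_dim_flag_variety:
  assumes "has_dim V m" "finite S" "card S = m"
  shows "Fl S homeomorphic_space flag_variety V"
proof -
  obtain \<phi> where "coords V \<phi> S" using has_dim_coords[OF assms] by blast
  then show ?thesis
    using coords.flag_variety_homeo[of V \<phi> S] homeomorphic_maps_sym unfolding homeomorphic_space_def by blast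
qed

lemma has_dim_subspace_aux:
  assumes "coords V \<phi> S" "is_subspace W V"
  obtains I where "I \<subseteq> S" "chart I (\<phi> ` W)" "card I = cvs_dim (V\<lparr>carrier := W\<rparr>)" "finite S"
proof -
  interpret coords V \<phi> S by fact
  have "\<phi> ` W \<in> Gs S (cvs_dim (V\<lparr>carrier := W\<rparr>))"
    using grassmannian_iff[of W "cvs_dim (V\<lparr>carrier := W\<rparr>)"] assms(2) by simp
  then show thesis using that finS by (auto simp: Gs_def)
qed

lemma has_dim_subspace:
  assumes "has_dim V m" "is_subspace W V"
  shows "has_dim (V\<lparr>carrier := W\<rparr>) (cvs_dim (V\<lparr>carrier := W\<rparr>))"
proof -
  obtain \<phi> S where c: "coords V \<phi> S" using assms(1) by (auto simp: has_dim_def)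
  obtain I where I: "I \<subseteq> S" "chart I (\<phi> ` W)" "card I = cvs_dim (V\<lparr>carrier := W\<rparr>)"
    by (rule has_dim_subspace_aux[OF c assms(2)])
  show ?thesis using coords.coords_subspace[OF c assms(2) I(1,2)] I(3) unfolding has_dim_def by blast
qed

lemma has_dim_quotient:
  assumes "has_dim V m" "is_subspace W V"
  shows "has_dim (quotient_space V W) (m - cvs_dim (V\<lparr>carrier := W\<rparr>))"
proof -
  obtain \<phi> S where c: "coords V \<phi> S" "card S = m" using assms(1) by (auto simp: has_dim_def)
  obtain I where I: "I \<subseteq> S" "chart I (\<phi> ` W)" "card I = cvs_dim (V\<lparr>carrier := W\<rparr>)" "finite S"
    by (rule has_dim_subspace_aux[OF c(1) assms(2)])
  have "card (S - I) = m - cvs_dim (V\<lparr>carrier := W\<rparr>)"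
    using I c(2) by (simp add: card_Diff_subset finite_subset)
  then show ?thesis using coords.coords_quotient[OF c(1) assms(2) I(1,2)] unfolding has_dim_def by blast
qed

text \<open>The coordinates are the inverse of \<open>w \<mapsto> \<Sum>\<^sub>a w\<^sub>a x\<^sub>a\<close>.\<close>

lemma coords_of_basis:
  fixes V :: "'v cvs" (structure)
  assumes vs: "vectorspace class_ring V" and finS: "finite S"
    and x: "inj_on x S" "vectorspace.basis class_ring V (x ` S)"
  shows "\<exists>\<phi>. coords V \<phi> S \<and> (\<forall>a\<in>S. \<phi> (x a) = unitv a)"
proof -
  interpret vectorspace "class_ring :: complex ring" V by (rule vs)
  have b: "lin_indpt (x ` S)" "span (x ` S) = carrier V" "x ` S \<subseteq> carrier V" using x(2) by (auto simp: basis_def)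
  have xc: "x a \<in> carrier V" if "a \<in> S" for a using b(3) that by auto
  have sm: "c \<odot> v \<in> carrier V" if "v \<in> carrier V" for c v using smult_closed[of c v] that by simp
  define L where "L w = (\<Oplus>a\<in>S. w a \<odot> x a)" for w :: cvec
  have Lc: "L w \<in> carrier V" for w unfolding L_def by (rule finsum_closed) (use xc sm in auto)
  have Ladd: "L (\<lambda>a. w a + w' a) = L w \<oplus> L w'" for w w'
  proof -
    have "L (\<lambda>a. w a + w' a) = (\<Oplus>a\<in>S. w a \<odot> x a \<oplus> w' a \<odot> x a)"
      unfolding L_def by (rule finsum_cong') (use xc sm smult_l_distr in auto)
    also have "\<dots> = L w \<oplus> L w'" unfolding L_def by (rule finsum_addf) (use xc sm in auto)
    finally show ?thesis .
  qed
  have Lsm: "L (\<lambda>a. c * w a) = c \<odot> L w" for c w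
  proof -
    have "L (\<lambda>a. c * w a) = (\<Oplus>a\<in>S. c \<odot> (w a \<odot> x a))"
      unfolding L_def by (rule finsum_cong') (use xc sm smult_assoc1[of c] in auto)
    also have "\<dots> = c \<odot> L w" unfolding L_def using finsum_smult[of c "\<lambda>a. w a \<odot> x a" S] xc sm finS by auto
    finally show ?thesis .
  qed
  have Llin: "L w = lincomb (w \<circ> inv_into S x) (x ` S)" for w
  proof -
    have "lincomb (w \<circ> inv_into S x) (x ` S) = (\<Oplus>a\<in>S. (w \<circ> inv_into S x) (x a) \<odot> x a)"
      unfolding lincomb_def by (rule finsum_reindex[OF _ x(1)]) (use xc sm in auto)
    also have "\<dots> = L w" unfolding L_def by (rule finsum_cong') (use xc sm x(1) in auto)
    finally show ?thesis by simp
  qed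
  have Lsurj: "\<exists>w\<in>Cn S. L w = v" if v: "v \<in> carrier V" for v
  proof -
    obtain c where c: "lincomb c (x ` S) = v"
      using finite_in_span[OF _ b(3), of v] finS v b(2) by auto
    let ?w = "\<lambda>a. if a \<in> S then c (x a) else 0"
    have "L ?w = lincomb c (x ` S)"
      unfolding Llin by (rule lincomb_cong) (use b(3) x(1) in auto)
    then show ?thesis using c by (intro bexI[of _ ?w]) (auto simp: Cn_def)
  qed
  have Linj: "w = w'" if w: "w \<in> Cn S" "w' \<in> Cn S" and e: "L w = L w'" for w w'
  proof -
    let ?d = "\<lambda>a. w a + (-1) * w' a"
    have "L ?d = L w \<oplus> (-1) \<odot> L w'" using Ladd[of w "\<lambda>a. (-1) * w' a"] Lsm[of "-1" w'] by simp
    also have "\<dots> = L (\<lambda>a. w' a + (-1) * w' a)" using e Ladd[of w' "\<lambda>a. (-1) * w' a"] Lsm[of "-1" w'] by simp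
    also have "\<dots> = L (\<lambda>a. 0 * w' a)" by simp
    also have "\<dots> = \<zero>" using Lsm[of 0 w'] smult_l_null[OF Lc, of w'] by simp
    finally have z: "lincomb (?d \<circ> inv_into S x) (x ` S) = \<zero>" unfolding Llin .
    have "?d a = 0" if a: "a \<in> S" for a
    proof (rule ccontr)
      assume "?d a \<noteq> 0"
      then have "(?d \<circ> inv_into S x) (x a) \<noteq> \<zero>\<^bsub>class_ring\<^esub>" using a x(1) by simp
      then have "lin_dep (x ` S)"
        by (intro lin_dep_crit[OF _ subset_refl _ _ _ z]) (use a finS in auto)
      then show False using b(1) by simp
    qed
    then have "w a = w' a" for a using w by (cases "a \<in> S") (auto simp: Cn_def)
    then show ?thesis by (rule ext)
  qed
  define \<phi> where "\<phi> v = (THE w. w \<in> Cn S \<and> L w = v)" for v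
  have phi: "\<phi> v \<in> Cn S \<and> L (\<phi> v) = v" if "v \<in> carrier V" for v
  proof -
    have "\<exists>!w. w \<in> Cn S \<and> L w = v" using Lsurj[OF that] Linj by blast
    from theI'[OF this] show ?thesis unfolding \<phi>_def .
  qed
  have phi_eq: "\<phi> v = w" if "w \<in> Cn S" "L w = v" for v w
  proof -
    have "\<phi> v \<in> Cn S \<and> L (\<phi> v) = v" using phi[of v] that(2) Lc[of w] by simp
    then show ?thesis using Linj[of "\<phi> v" w] that by simp
  qed
  have "coords V \<phi> S"
  proof (rule coordsI[OF finS])
    show "inj_on \<phi> (carrier V)"
    proof (rule inj_onI)
      fix v w assume vw: "v \<in> carrier V" "w \<in> carrier V" "\<phi> v = \<phi> w"
      have "L (\<phi> v) = v" "L (\<phi> w) = w" using phi[OF vw(1)] phi[OF vw(2)] by blast+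
      then show "v = w" unfolding vw(3) by (rule trans[OF sym])
    qed
    show "\<phi> ` carrier V = Cn S"
    proof (intro equalityI subsetI)
      fix w assume "w \<in> \<phi> ` carrier V"
      then show "w \<in> Cn S" using phi by auto
    next
      fix w assume w: "w \<in> Cn S"
      then have eq: "\<phi> (L w) = w" by (rule phi_eq) simp
      have "\<phi> (L w) \<in> \<phi> ` carrier V" by (rule imageI[OF Lc])
      then show "w \<in> \<phi> ` carrier V" by (simp only: eq)
    qed
    show "\<phi> \<zero> = (\<lambda>_. 0)"
    proof (rule phi_eq)
      have "L (\<lambda>a. 0 * (0::complex)) = \<zero>" using Lsm[of 0 "\<lambda>_. 0"] smult_l_null[OF Lc, of "\<lambda>_. 0"] by simp
      then show "L (\<lambda>_. 0) = \<zero>" by simp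
    qed (simp add: Cn_def)
    show "\<phi> (v \<oplus> w) = (\<lambda>a. \<phi> v a + \<phi> w a)" if "v \<in> carrier V" "w \<in> carrier V" for v w
    proof (rule phi_eq)
      have "\<phi> v \<in> Cn S" "\<phi> w \<in> Cn S" and L: "L (\<phi> v) = v" "L (\<phi> w) = w"
        using phi[OF that(1)] phi[OF that(2)] by blast+
      then show "(\<lambda>a. \<phi> v a + \<phi> w a) \<in> Cn S" by (intro lsub_add[OF lsub_Cn])
      show "L (\<lambda>a. \<phi> v a + \<phi> w a) = v \<oplus> w" unfolding Ladd L ..
    qed
    show "\<phi> (c \<odot> v) = (\<lambda>a. c * \<phi> v a)" if "v \<in> carrier V" for c v
    proof (rule phi_eq)
      have "\<phi> v \<in> Cn S" and L: "L (\<phi> v) = v" using phi[OF that] by blast+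
      then show "(\<lambda>a. c * \<phi> v a) \<in> Cn S" by (intro lsub_scale[OF lsub_Cn])
      show "L (\<lambda>a. c * \<phi> v a) = c \<odot> v" unfolding Lsm L ..
    qed
  qed (use sm in auto)
  moreover have "\<phi> (x a) = unitv a" if a: "a \<in> S" for a
  proof (rule phi_eq)
    show "unitv a \<in> Cn S" using a by (simp add: unitv_Cn)
    have "L (unitv a) = (\<Oplus>c\<in>S. if a = c then x c else \<zero>)"
      unfolding L_def
    proof (rule finsum_cong')
      show "unitv a c \<odot> x c = (if a = c then x c else \<zero>)" if "c \<in> S" for c
        using smult_one[OF xc[OF that]] smult_l_null[OF xc[OF that]] by (auto simp: unitv_def)
    qed (use xc in auto)
    also have "\<dots> = x a" using finsum_singleton[OF a finS, of x] xc by auto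
    finally show "L (unitv a) = x a" .
  qed
  ultimately show ?thesis by blast
qed

section \<open>Kernels and images in coordinates\<close>

context hook_data
begin

lemma Nc_lincomb: "Nc (\<lambda>a. c * x a + d * y a) = (\<lambda>a. c * Nc x a + d * Nc y a)"
  unfolding Nc_def by (simp add: sum_distrib_left sum.distrib distrib_right mult.assoc)

lemma Nc_image_low:
  assumes "m \<le> b"
  shows "Nc ` Cn (low m) = Cn (low (m - 1))"
proof (cases "m = 0")
  case True
  have "Nc (\<lambda>_. 0) = (\<lambda>_. 0)" by (simp add: Nc_def)
  moreover have "Cn {} = {\<lambda>_. 0}" by (auto simp: Cn_def)
  ultimately show ?thesis using True by (simp add: low_def)
next
  case False
  show ?thesis
  proof (intro equalityI subsetI)
    fix w assume "w \<in> Nc ` Cn (low m)"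
    then obtain x where x: "x \<in> Cn (low m)" "w = Nc x" by auto
    show "w \<in> Cn (low (m - 1))"
      unfolding Cn_def
    proof (intro CollectI allI impI)
      fix a assume a: "a \<notin> low (m - 1)"
      show "w a = 0"
      proof (cases "a \<in> low (b - 1)")
        case True
        then obtain k where k: "k \<in> {1..b - 1}" "a = i k" by (auto simp: low_def)
        then have k': "k \<in> {1..<b}" "\<not> k \<le> m - 1" using a by (auto simp: low_def)
        then have "0 < n" using pos_n by auto
        then have "i (Suc k) \<notin> low m" using i_low[of "Suc k" m] k' assms by auto
        then show ?thesis using x Nc_i[OF k'(1), of x] k(2) by (simp add: Cn_def)
      qed (use Nc_low[of x] in \<open>simp add: x Cn_def\<close>)
    qed
  next
    fix w assume w: "w \<in> Cn (low (m - 1))"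
    let ?y = "\<lambda>a. \<Sum>k\<in>{1..m - 1}. w (i k) * unitv (i (Suc k)) a"
    have y: "?y \<in> Cn (low m)"
    proof -
      have "?y = lc {1..m - 1} (\<lambda>k. w (i k)) (\<lambda>k. unitv (i (Suc k)))" by (simp add: lc_def)
      also have "\<dots> \<in> Cn (low m)"
        by (rule lsub_lc[OF lsub_Cn]) (auto simp: unitv_Cn low_def)
      finally show ?thesis .
    qed
    have "Nc ?y = w"
    proof
      fix a show "Nc ?y a = w a"
      proof (cases "a \<in> low (b - 1)")
        case True
        then obtain k where k: "k \<in> {1..b - 1}" "a = i k" by (auto simp: low_def)
        then have k': "k \<in> {1..<b}" by auto
        then have n: "0 < n" using pos_n by auto
        have "Nc ?y (i k) = (\<Sum>l\<in>{1..m - 1}. if l = k then w (i k) else 0)"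
          unfolding Nc_i[OF k']
        proof (rule sum.cong)
          fix l assume l: "l \<in> {1..m - 1}"
          then have "Suc l \<le> b" using assms by auto
          then have "i (Suc l) = i (Suc k) \<longleftrightarrow> l = k" using i_eq[of "Suc l" "Suc k"] k' n by auto
          then show "w (i l) * unitv (i (Suc l)) (i (Suc k)) = (if l = k then w (i k) else 0)"
            by (auto simp: unitv_def)
        qed simp
        also have "\<dots> = w (i k)"
        proof (cases "k \<le> m - 1")
          case True
          then show ?thesis using k' by simp
        next
          case False
          then have "i k \<notin> low (m - 1)" using i_low[of k "m - 1"] k' n assms by auto
          then show ?thesis using w False by (simp add: Cn_def)
        qed
        finally show ?thesis using k(2) by simp
      next
        case False
        moreover have "m - 1 \<le> b - 1" using assms by simp
        ultimately have "a \<notin> low (m - 1)" using low_mono by blast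
        then show ?thesis using False Nc_low[of ?y] w by (simp add: Cn_def)
      qed
    qed
    then show "w \<in> Nc ` Cn (low m)" using y by (intro image_eqI[OF sym])
  qed
qed

lemma Nc_image_T: "Nc ` Cn T = Cn (low (b - 1))"
proof (intro equalityI)
  show "Nc ` Cn T \<subseteq> Cn (low (b - 1))" using Nc_low by auto
  show "Cn (low (b - 1)) \<subseteq> Nc ` Cn T"
  proof (cases "0 < n")
    case True
    have "low b \<subseteq> T" using i_pos i_le_n True by (auto simp: low_def)
    then have "Nc ` Cn (low b) \<subseteq> Nc ` Cn T" by (intro image_mono Cn_mono)
    then show ?thesis using Nc_image_low[of b] by simp
  next
    case False
    then have b: "b = 1" "T = {}" using n0 by auto
    have "{1..<b} = {}" using b(1) by simp
    then have "Nc (\<lambda>_. 0) = (\<lambda>_. 0)" by (simp only: Nc_def sum.empty)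
    moreover have "Cn {} = {\<lambda>_. 0}" by (auto simp: Cn_def)
    ultimately show ?thesis using b by (simp add: low_def)
  qed
qed

lemma Nc_pow_image: "(Nc ^^ e) ` Cn T = Imc e"
proof (induction e)
  case (Suc e)
  have "(Nc ^^ Suc e) ` Cn T = Nc ` (Nc ^^ e) ` Cn T" by (simp add: image_comp comp_def)
  also have "\<dots> = Nc ` Imc e" by (simp only: Suc)
  also have "\<dots> = Imc (Suc e)"
  proof (cases "e = 0")
    case True
    then show ?thesis using Nc_image_T by (simp add: Imc_def)
  next
    case False
    then show ?thesis using Nc_image_low[of "b - e"] by (simp add: Imc_def)
  qed
  finally show ?case .
qed (simp add: Imc_def)

text \<open>Between \<open>im N\<^sup>b\<^sup>-\<^sup>j\<close> and \<open>ker N\<^sup>j\<close>, the space \<open>F(i\<^sub>j)\<close> can only meet \<open>im N\<close> in \<open>im N\<^sup>b\<^sup>-\<^sup>j\<close>, because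
  \<open>ker N\<^sup>j \<inter> im N = im N\<^sup>b\<^sup>-\<^sup>j\<close>.\<close>

lemma K_Int_low:
  assumes G: "G \<in> K" and j: "j < b"
  shows "G (i j) \<inter> Cn (low (b - 1)) = Cn (low j)"
proof
  show "Cn (low j) \<subseteq> G (i j) \<inter> Cn (low (b - 1))"
    using K_bounds(1)[OF G, of j] j low_mono[of j "b - 1"] Cn_mono[of "low j" "low (b - 1)"] by auto
  show "G (i j) \<inter> Cn (low (b - 1)) \<subseteq> Cn (low j)"
  proof
    fix w assume w: "w \<in> G (i j) \<inter> Cn (low (b - 1))"
    then have wh: "w \<in> Cn (high j)" using K_bounds(2)[OF G, of j] j by auto
    show "w \<in> Cn (low j)" using low_Int_high w wh by blast
  qed
qed

end

section \<open>The Springer fiber in coordinates\<close>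

\<comment> \<open>Indices such as \<open>i 1\<close> and differences such as \<open>j - 1\<close> keep their literal form.\<close>
declare One_nat_def [simp del]

text \<open>A vector space with coordinates in which N is the shift of the top row of the tableau A.\<close>

locale hook_space = coords V \<phi> "{1..n}" + hook_columns n b i "column_of sh A"
  for V :: "'v cvs" (structure) and \<phi> n b i sh A +
  fixes N :: "'v \<Rightarrow> 'v"
  assumes N_in: "v \<in> carrier V \<Longrightarrow> N v \<in> carrier V"
    and phi_N: "v \<in> carrier V \<Longrightarrow> \<phi> (N v) = Nc (\<phi> v)"
begin

lemma N_pow: "v \<in> carrier V \<Longrightarrow> (N ^^ e) v \<in> carrier V \<and> \<phi> ((N ^^ e) v) = (Nc ^^ e) (\<phi> v)"
  by (induction e) (auto simp: N_in phi_N)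

lemma dim_n: "dim = n"
  using coords_dim(2) by simp

lemma N_pow_image: "{\<phi> ((N ^^ e) v) | v. v \<in> carrier V} = Imc e"
proof -
  have "{\<phi> ((N ^^ e) v) | v. v \<in> carrier V} = (Nc ^^ e) ` \<phi> ` carrier V"
  proof -
    have "{\<phi> ((N ^^ e) v) | v. v \<in> carrier V} = (\<lambda>v. \<phi> ((N ^^ e) v)) ` carrier V" by (simp only: Setcompr_eq_image)
    also have "\<dots> = (\<lambda>v. (Nc ^^ e) (\<phi> v)) ` carrier V" by (rule image_cong[OF refl conjunct2[OF N_pow]])
    finally show ?thesis by (simp only: image_image)
  qed
  then show ?thesis by (simp only: surj Nc_pow_image)
qed

context
  fixes W assumes W: "is_subspace W V" and NW: "N ` W \<subseteq> W"
begin

lemma induced_coset: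
  assumes x: "x \<in> carrier V"
  shows "induced_map V N W (W +> x) = W +> N x"
  unfolding induced_map_def
proof (rule coset_Union_const[OF W x])
  fix u assume "u \<in> W +> x"
  then obtain w where w: "w \<in> W" "u = w \<oplus> x" unfolding a_r_coset_def' by auto
  have wc: "w \<in> carrier V" using w subspaceD(1)[OF W] by auto
  have u: "u \<in> carrier V" using w wc x by simp
  have "Nc (\<phi> u) a - Nc (\<phi> x) a = Nc (\<phi> w) a" for a
    using Nc_lincomb[of 1 "\<phi> w" 1 "\<phi> x"] by (simp add: w(2) phi_add[OF wc x])
  then have "(\<lambda>a. \<phi> (N u) a - \<phi> (N x) a) = \<phi> (N w)" using phi_N u x wc by simp
  then show "W +> N u = W +> N x"
    using NW w(1) by (subst coset_eq_iff[OF W N_in[OF u] N_in[OF x]]) auto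
qed

lemma induced_pow_coset:
  assumes x: "x \<in> carrier V"
  shows "(induced_map V N W ^^ e) (W +> x) = W +> (N ^^ e) x"
  by (induction e) (use N_pow[OF x] induced_coset in auto)

lemma im_induced: "im (quotient_space V W) (induced_map V N W ^^ e) = (\<lambda>y. W +> y) ` {y \<in> carrier V. \<phi> y \<in> Imc e}"
proof (intro equalityI subsetI)
  fix C assume "C \<in> im (quotient_space V W) (induced_map V N W ^^ e)"
  then obtain x where x: "x \<in> carrier V" "C = W +> (N ^^ e) x"
    unfolding im_def carrier_quotient using induced_pow_coset by auto
  moreover have "\<phi> ((N ^^ e) x) \<in> Imc e" unfolding N_pow_image[of e, symmetric] using x(1) by blast
  ultimately show "C \<in> (\<lambda>y. W +> y) ` {y \<in> carrier V. \<phi> y \<in> Imc e}" using N_pow[OF x(1), of e] by blast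
next
  fix C assume "C \<in> (\<lambda>y. W +> y) ` {y \<in> carrier V. \<phi> y \<in> Imc e}"
  then obtain y where y: "y \<in> carrier V" "\<phi> y \<in> Imc e" "C = W +> y" by auto
  then obtain x where x: "x \<in> carrier V" "\<phi> y = \<phi> ((N ^^ e) x)"
    unfolding N_pow_image[of e, symmetric] by blast
  then have "y = (N ^^ e) x" using inj_onD[OF inj] y(1) N_pow[OF x(1), of e] by blast
  then have "C = (induced_map V N W ^^ e) (W +> x)" by (simp add: y(3) induced_pow_coset[OF x(1)])
  then show "C \<in> im (quotient_space V W) (induced_map V N W ^^ e)"
    unfolding im_def carrier_quotient using x(1) by blast
qed

lemma ker_induced: "ker (quotient_space V W) (induced_map V N W) = (\<lambda>x. W +> x) ` {x \<in> carrier V. Nc (\<phi> x) \<in> \<phi> ` W}"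
proof -
  have z: "\<zero>\<^bsub>quotient_space V W\<^esub> = W +> \<zero>" by (simp add: quotient_space_def coset_zero[OF W])
  have "induced_map V N W (W +> x) = \<zero>\<^bsub>quotient_space V W\<^esub> \<longleftrightarrow> Nc (\<phi> x) \<in> \<phi> ` W" if x: "x \<in> carrier V" for x
    unfolding z induced_coset[OF x] coset_eq_iff[OF W N_in[OF x] zero_closed] by (simp add: phi_zero phi_N[OF x])
  then show ?thesis unfolding ker_def carrier_quotient by auto
qed

lemma coset_in_image:
  assumes x: "x \<in> carrier V" and P: "P \<subseteq> carrier V"
  shows "W +> x \<in> (\<lambda>y. W +> y) ` P \<longleftrightarrow> (\<exists>y\<in>P. (\<lambda>a. \<phi> x a - \<phi> y a) \<in> \<phi> ` W)"
proof -
  have "W +> x = W +> y \<longleftrightarrow> (\<lambda>a. \<phi> x a - \<phi> y a) \<in> \<phi> ` W" if "y \<in> P" for y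
    using coset_eq_iff[OF W x] that P by blast
  then show ?thesis unfolding image_iff by (rule bex_cong[OF refl])
qed

lemma carrier_quotient_sub: "carrier (quotient_space (V\<lparr>carrier := U\<rparr>) W) = (\<lambda>x. W +> x) ` U"
  by (auto simp: quotient_space_def A_RCOSETS_def' a_r_coset_def')

text \<open>The conditions of \<open>SV(A)\<close> on a line \<open>U / W\<close>, pulled back to the vectors of U. Since W is stable under
  N, whether \<open>N x \<in> W\<close> depends only on the coset of x.\<close>

lemma line_condition:
  assumes U: "U \<subseteq> carrier V"
  shows "carrier (quotient_space (V\<lparr>carrier := U\<rparr>) W) \<subseteq> im (quotient_space V W) (induced_map V N W ^^ e) \<longleftrightarrow>
      (\<forall>x\<in>\<phi> ` U. \<exists>y\<in>Imc e. (\<lambda>a. x a - y a) \<in> \<phi> ` W)"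
    and "carrier (quotient_space (V\<lparr>carrier := U\<rparr>) W) \<subseteq> ker (quotient_space V W) (induced_map V N W) \<longleftrightarrow>
      Nc ` \<phi> ` U \<subseteq> \<phi> ` W"
proof -
  have ImS: "Imc e \<subseteq> \<phi> ` carrier V" unfolding N_pow_image[of e, symmetric]
    by (auto intro!: imageI conjunct1[OF N_pow])
  have eq: "(\<exists>y\<in>{y \<in> carrier V. \<phi> y \<in> Imc e}. (\<lambda>a. \<phi> x a - \<phi> y a) \<in> \<phi> ` W) \<longleftrightarrow>
      (\<exists>y\<in>Imc e. (\<lambda>a. \<phi> x a - y a) \<in> \<phi> ` W)" for x
    using ImS by blast
  have sub: "{y \<in> carrier V. \<phi> y \<in> Imc e} \<subseteq> carrier V" by blast
  have "W +> x \<in> im (quotient_space V W) (induced_map V N W ^^ e) \<longleftrightarrow>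
      (\<exists>y\<in>Imc e. (\<lambda>a. \<phi> x a - y a) \<in> \<phi> ` W)" if "x \<in> U" for x
    unfolding im_induced coset_in_image[OF subsetD[OF U that] sub] by (rule eq)
  then show "carrier (quotient_space (V\<lparr>carrier := U\<rparr>) W) \<subseteq> im (quotient_space V W) (induced_map V N W ^^ e) \<longleftrightarrow>
      (\<forall>x\<in>\<phi> ` U. \<exists>y\<in>Imc e. (\<lambda>a. x a - y a) \<in> \<phi> ` W)"
    unfolding carrier_quotient_sub by (simp add: image_subset_iff)
  have "W +> x \<in> ker (quotient_space V W) (induced_map V N W) \<longleftrightarrow> Nc (\<phi> x) \<in> \<phi> ` W" if "x \<in> U" for x
  proof -
    have x: "x \<in> carrier V" using that U by auto
    have "Nc (\<phi> x) \<in> \<phi> ` W" if y: "y \<in> carrier V" "Nc (\<phi> y) \<in> \<phi> ` W" "(\<lambda>a. \<phi> x a - \<phi> y a) \<in> \<phi> ` W" for y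
    proof -
      obtain w where w: "w \<in> W" "(\<lambda>a. \<phi> x a - \<phi> y a) = \<phi> w" using y(3) by auto
      have "\<phi> x a = 1 * \<phi> w a + 1 * \<phi> y a" for a using fun_cong[OF w(2), of a] by (simp add: diff_eq_eq)
      then have "\<phi> x = (\<lambda>a. 1 * \<phi> w a + 1 * \<phi> y a)" by (rule ext)
      then have "Nc (\<phi> x) = (\<lambda>a. Nc (\<phi> w) a + Nc (\<phi> y) a)" using Nc_lincomb[of 1 "\<phi> w" 1 "\<phi> y"] by simp
      moreover have "Nc (\<phi> w) \<in> \<phi> ` W"
      proof -
        have "N w \<in> W" using w(1) NW by blast
        moreover have "\<phi> (N w) = Nc (\<phi> w)" by (rule phi_N) (use w(1) subspaceD(1)[OF W] in blast)
        ultimately show ?thesis using imageI[of "N w" W \<phi>] by simp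
      qed
      ultimately show ?thesis using lsub_add[OF subspaceD(2)[OF W] _ y(2)] by simp
    qed
    moreover have "(\<lambda>a. \<phi> x a - \<phi> x a) \<in> \<phi> ` W" using lsub_zero[OF subspaceD(2)[OF W]] by simp
    ultimately show ?thesis unfolding ker_induced
      using coset_in_image[OF x, of "{x \<in> carrier V. Nc (\<phi> x) \<in> \<phi> ` W}"] x by blast
  qed
  then show "carrier (quotient_space (V\<lparr>carrier := U\<rparr>) W) \<subseteq> ker (quotient_space V W) (induced_map V N W) \<longleftrightarrow>
      Nc ` \<phi> ` U \<subseteq> \<phi> ` W"
    unfolding carrier_quotient_sub by (simp add: image_subset_iff)
qed

end

lemma flag_facts:
  assumes F: "F \<in> flags V" and l: "l \<le> n"
  shows "is_subspace (F l) V" "cvs_dim (V\<lparr>carrier := F l\<rparr>) = l" "F l \<subseteq> carrier V"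
    "flag_to_coords F l = \<phi> ` F l"
proof -
  have "F l \<subseteq> carrier V \<and> \<phi> ` F l \<in> Gs {1..n} l" using F l unfolding flags_iff by simp
  then show "is_subspace (F l) V" "cvs_dim (V\<lparr>carrier := F l\<rparr>) = l" "F l \<subseteq> carrier V"
    using grassmannian_iff[of "F l" l] by blast+
  show "flag_to_coords F l = \<phi> ` F l" using l by (simp add: flag_to_coords_def)
qed

lemma N_subset_iff:
  assumes "U \<subseteq> carrier V" "W \<subseteq> carrier V"
  shows "N ` U \<subseteq> W \<longleftrightarrow> Nc ` \<phi> ` U \<subseteq> \<phi> ` W"
proof -
  have "N x \<in> W \<longleftrightarrow> Nc (\<phi> x) \<in> \<phi> ` W" if "x \<in> U" for x
  proof -
    have x: "x \<in> carrier V" using that assms by auto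
    have "N x \<in> W \<longleftrightarrow> \<phi> (N x) \<in> \<phi> ` W" using inj_on_image_mem_iff[OF inj N_in[OF x] assms(2)] by simp
    then show ?thesis by (simp add: phi_N[OF x])
  qed
  then show ?thesis by (simp add: image_subset_iff)
qed

lemma topspace_springer:
  "topspace (springer_fiber V N) = {F \<in> flags V. \<forall>l\<in>{1..n}. Nc ` flag_to_coords F l \<subseteq> flag_to_coords F (l - 1)}"
proof -
  have "(N ` F l \<subseteq> F (l - 1)) = (Nc ` flag_to_coords F l \<subseteq> flag_to_coords F (l - 1))"
    if F: "F \<in> flags V" and l: "l \<in> {1..n}" for F l
  proof -
    have l': "l \<le> n" "l - 1 \<le> n" using l by auto
    note f1 = flag_facts[OF F l'(1)] and f2 = flag_facts[OF F l'(2)]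
    show ?thesis unfolding f1(4) f2(4) by (rule N_subset_iff[OF f1(3) f2(3)])
  qed
  then have "{F \<in> flags V. \<forall>l\<in>{1..n}. N ` F l \<subseteq> F (l - 1)} =
      {F \<in> flags V. \<forall>l\<in>{1..n}. Nc ` flag_to_coords F l \<subseteq> flag_to_coords F (l - 1)}" by blast
  then show ?thesis
    unfolding springer_fiber_def topspace_subtopology topspace_flag_variety dim_n by blast
qed

lemma SV_iff: "F \<in> SV V N sh A \<longleftrightarrow> F \<in> flags V \<and> flag_to_coords F \<in> cell"
proof -
  let ?G = "flag_to_coords F"
  have main: "(carrier (quotient_space (V\<lparr>carrier := F l\<rparr>) (F (l - 1))) \<subseteq>
        ker (quotient_space V (F (l - 1))) (induced_map V N (F (l - 1))) \<inter>
        im (quotient_space V (F (l - 1))) (induced_map V N (F (l - 1)) ^^ (column_of sh A l - 1)) \<and>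
      \<not> carrier (quotient_space (V\<lparr>carrier := F l\<rparr>) (F (l - 1))) \<subseteq>
        im (quotient_space V (F (l - 1))) (induced_map V N (F (l - 1)) ^^ column_of sh A l)) \<longleftrightarrow>
      (Nc ` ?G l \<subseteq> ?G (l - 1) \<and>
      (\<forall>x\<in>?G l. \<exists>y\<in>Imc (column_of sh A l - 1). (\<lambda>a. x a - y a) \<in> ?G (l - 1)) \<and>
      \<not> (\<forall>x\<in>?G l. \<exists>y\<in>Imc (column_of sh A l). (\<lambda>a. x a - y a) \<in> ?G (l - 1)))"
    if F: "F \<in> topspace (springer_fiber V N)" and l: "l \<in> {1..n}" for l
  proof -
    have FV: "F \<in> flags V" and sp: "\<forall>l\<in>{1..n}. Nc ` ?G l \<subseteq> ?G (l - 1)"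
      using F unfolding topspace_springer by auto
    have l': "l \<le> n" "l - 1 \<le> n" using l by auto
    note f1 = flag_facts[OF FV l'(1)] and f2 = flag_facts[OF FV l'(2)]
    have sub: "?G (l - 1) \<subseteq> ?G l"
      using Fls_mono[OF flag_to_coords[OF FV], of "l - 1" l] l by simp
    have NW: "N ` F (l - 1) \<subseteq> F (l - 1)"
    proof -
      have "Nc ` ?G (l - 1) \<subseteq> Nc ` ?G l" by (rule image_mono[OF sub])
      also have "\<dots> \<subseteq> ?G (l - 1)" using sp l by blast
      finally show ?thesis by (simp add: N_subset_iff[OF f2(3) f2(3)] f2(4))
    qed
    show ?thesis
      unfolding Int_subset_iff line_condition[OF f2(1) NW f1(3)] f1(4) f2(4) by blast
  qed
  have "F \<in> SV V N sh A \<longleftrightarrow> F \<in> topspace (springer_fiber V N) \<and> (\<forall>l\<in>{1..n}. Nc ` ?G l \<subseteq> ?G (l - 1) \<and>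
      (\<forall>x\<in>?G l. \<exists>y\<in>Imc (column_of sh A l - 1). (\<lambda>a. x a - y a) \<in> ?G (l - 1)) \<and>
      \<not> (\<forall>x\<in>?G l. \<exists>y\<in>Imc (column_of sh A l). (\<lambda>a. x a - y a) \<in> ?G (l - 1)))"
    unfolding SV_def Let_def dim_n mem_Collect_eq by (rule conj_cong[OF refl], rule ball_cong[OF refl], rule main)
  also have "\<dots> \<longleftrightarrow> F \<in> flags V \<and> ?G \<in> springer_cell"
    unfolding topspace_springer springer_cell_def using flag_to_coords[of F] by blast
  finally show ?thesis by (simp only: springer_cell)
qed

definition KV :: "(nat \<Rightarrow> 'v set) set" where "KV = flag_of_coords ` K"

lemma KV_iff: "F \<in> KV \<longleftrightarrow> F \<in> flags V \<and> flag_to_coords F \<in> K"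
proof
  assume "F \<in> KV"
  then obtain G where G: "G \<in> K" "F = flag_of_coords G" by (auto simp: KV_def)
  then show "F \<in> flags V \<and> flag_to_coords F \<in> K"
    using flag_of_coords[OF K_Fls[OF G(1)]] flag_to_of_coords[OF K_Fls[OF G(1)]] by simp
next
  assume "F \<in> flags V \<and> flag_to_coords F \<in> K"
  then show "F \<in> KV" unfolding KV_def using flag_of_to_coords[of F] by (intro image_eqI[of _ _ "flag_to_coords F"]) auto
qed

lemma SV_image: "SV V N sh A = flag_of_coords ` cell"
proof -
  have c: "cell \<subseteq> Fls T" using K_Fls by (auto simp: cell_def)
  show ?thesis
  proof (intro equalityI subsetI)
    fix F assume "F \<in> SV V N sh A"
    then have "F \<in> flags V" "flag_to_coords F \<in> cell" by (auto simp: SV_iff)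
    then show "F \<in> flag_of_coords ` cell" using flag_of_to_coords[of F] by (intro image_eqI[of _ _ "flag_to_coords F"]) auto
  next
    fix F assume "F \<in> flag_of_coords ` cell"
    then obtain G where G: "G \<in> cell" "F = flag_of_coords G" by auto
    then have "G \<in> Fls T" using c by auto
    then show "F \<in> SV V N sh A" unfolding SV_iff using G flag_of_coords[of G] flag_to_of_coords[of G] by simp
  qed
qed

lemma component_eq: "component V N sh A = subtopology (flag_variety V) KV"
proof -
  let ?X = "flag_variety V"
  let ?Sp = "topspace (springer_fiber V N)"
  have sp: "springer_fiber V N = subtopology ?X ?Sp"
    unfolding springer_fiber_def topspace_subtopology by (simp add: subtopology_restrict inf_commute)
  have hm: "homeomorphic_map (Fl T) ?X flag_of_coords"
    using flag_variety_homeo homeomorphic_maps_sym homeomorphic_map_maps by blast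
  have "cell \<subseteq> topspace (Fl T)" using K_Fls by (auto simp: cell_def topspace_Fl)
  from homeomorphic_map_closure_of[OF hm this]
  have cl: "?X closure_of (SV V N sh A) = KV"
    unfolding SV_image KV_def using closure_cell[of cell] by (simp add: cell_def)
  have KS: "KV \<subseteq> ?Sp"
  proof
    fix F assume "F \<in> KV"
    then have F: "F \<in> flags V" "flag_to_coords F \<in> K" by (auto simp: KV_iff)
    then show "F \<in> ?Sp" unfolding topspace_springer using K_springer[OF F(2)] by simp
  qed
  have SS: "SV V N sh A \<subseteq> ?Sp" by (auto simp: SV_def)
  have "springer_fiber V N closure_of SV V N sh A = ?Sp \<inter> ?X closure_of (?Sp \<inter> SV V N sh A)"
    by (subst sp) (rule closure_of_subtopology)
  also have "\<dots> = KV" using SS KS cl by (simp add: inf_absorb2)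
  finally have c: "springer_fiber V N closure_of SV V N sh A = KV" .
  have "component V N sh A = subtopology (subtopology ?X ?Sp) KV"
    unfolding component_def c using sp by simp
  also have "\<dots> = subtopology ?X KV" using KS by (simp add: subtopology_subtopology inf_absorb2)
  finally show ?thesis .
qed

lemma topspace_component: "topspace (component V N sh A) = KV"
  unfolding component_eq topspace_subtopology topspace_flag_variety by (auto simp: KV_iff)

subsection \<open>The bases\<close>

lemma has_dim_V: "has_dim V n"
  unfolding has_dim_def by (intro exI conjI, rule coords_axioms) simp

text \<open>Both sides are the flag variety of a space of dimension \<open>i\<^sub>j\<^sub>+\<^sub>1 - i\<^sub>j\<close>.\<close>

lemma even_base_homeomorphic:
  assumes F: "F \<in> flags V" and j: "j < b"
  shows "Fl (even_index j) homeomorphic_space even_base V i F (Suc j)"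
proof -
  have ij: "i j \<le> i (Suc j)" "i (Suc j) \<le> n" using mono[of j "Suc j"] i_le_n[of "Suc j"] j by auto
  note f1 = flag_facts[OF F ij(2)]
  have ijn: "i j \<le> n" using ij by simp
  note f2 = flag_facts[OF F ijn]
  have sub: "F (i j) \<subseteq> F (i (Suc j))"
  proof -
    have "\<phi> ` F (i j) \<subseteq> \<phi> ` F (i (Suc j))"
      using Fls_mono[OF flag_to_coords[OF F] ij(1)] ij f1(4) f2(4) by simp
    then show ?thesis using inj_on_image_subset_iff[OF inj f2(3) f1(3)] by simp
  qed
  interpret U: lin_inj "V\<lparr>carrier := F (i (Suc j))\<rparr>" \<phi> by (rule lin_inj_subspace[OF f1(1)])
  have s: "is_subspace (F (i j)) (V\<lparr>carrier := F (i (Suc j))\<rparr>)"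
    using U.subspace_iff[of "F (i j)"] sub subspaceD(2)[OF f2(1)] by simp
  have "has_dim (V\<lparr>carrier := F (i (Suc j))\<rparr>) (i (Suc j))"
    using has_dim_subspace[OF has_dim_V f1(1)] f1(2) by simp
  from has_dim_quotient[OF this s]
  have "has_dim (quotient_space (V\<lparr>carrier := F (i (Suc j))\<rparr>) (F (i j))) (i (Suc j) - i j)"
    using f2(2) by simp
  then show ?thesis
    unfolding even_base_def by (intro has_dim_flag_variety) (auto simp: even_index_def)
qed

lemma last_base_homeomorphic:
  assumes F: "F \<in> flags V"
  shows "Fl (even_index (b - 1)) homeomorphic_space last_base V i F b"
proof -
  have "i (b - 1) \<le> n" using i_le_n[of "b - 1"] by simp
  note f = flag_facts[OF F this]
  have "has_dim (quotient_space V (F (i (b - 1)))) (n - i (b - 1))"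
    using has_dim_quotient[OF has_dim_V f(1)] f(2) by simp
  then show ?thesis
    unfolding last_base_def by (intro has_dim_flag_variety) (use b1 ib in \<open>auto simp: even_index_def\<close>)
qed

text \<open>For \<open>W = F(i\<^sub>j)\<close> with F in K, the space \<open>W \<inter> im N = im N\<^sup>b\<^sup>-\<^sup>j\<close> does not depend on F. Hence the kernel of
  the induced map is \<open>ker N\<^sup>j\<^sup>+\<^sup>1 / W\<close>, its nilpotency index is \<open>b - j\<close>, and the image of its highest
  nonzero power is the line spanned by the class of \<open>e(i\<^sub>j\<^sub>+\<^sub>1)\<close>. The quotient of the kernel by this line
  has dimension \<open>dim ker N\<^sup>j\<^sup>+\<^sup>1 - i\<^sub>j - 1\<close>, which is the number of elements of \<open>odd_index j\<close>.\<close>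

lemma odd_base_homeomorphic:
  assumes FK: "F \<in> KV" and j: "Suc j < b"
  shows "Gr (odd_index j) (odd_rank j) homeomorphic_space odd_base V N i F (Suc j)"
proof -
  have F: "F \<in> flags V" and G: "flag_to_coords F \<in> K" using FK by (auto simp: KV_iff)
  have n: "0 < n" using pos_n j by simp
  have jb: "j < b" "j \<le> b" "Suc j \<le> b" using j by auto
  define W where "W = F (i j)"
  have ijn: "i j \<le> n" using i_le_n jb by simp
  note f = flag_facts[OF F ijn, folded W_def]
  have W: "is_subspace W V" and Wc: "W \<subseteq> carrier V" using f by auto
  have L: "lsub (\<phi> ` W)" by (rule subspaceD(2)[OF W])
  have bounds: "Cn (low j) \<subseteq> \<phi> ` W" "\<phi> ` W \<subseteq> Cn (high j)" "\<phi> ` W \<inter> Cn (low (b - 1)) = Cn (low j)"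
    using K_bounds[OF G, of j] K_Int_low[OF G, of j] jb f(4) by auto
  have high_mono: "high j \<subseteq> high (Suc j)" by (auto simp: high_def)
  have Nc_W: "Nc (\<phi> x) \<in> \<phi> ` W \<longleftrightarrow> \<phi> x \<in> Cn (high (Suc j))" if "x \<in> carrier V" for x
    using Nc_low[of "\<phi> x"] bounds Nc_low_iff[OF phi_in[OF that] jb(1)] by blast
  have NW: "N ` W \<subseteq> W"
    unfolding N_subset_iff[OF Wc Wc] using Nc_W Wc bounds(2) Cn_mono[OF high_mono] by blast
  let ?Q = "quotient_space V W" and ?M = "induced_map V N W"
  define U where "U = {x \<in> carrier V. \<phi> x \<in> Cn (high (Suc j))}"
  have highT: "high (Suc j) \<subseteq> T" by (auto simp: high_def)
  have phiU: "\<phi> ` U = Cn (high (Suc j))"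
  proof
    show "\<phi> ` U \<subseteq> Cn (high (Suc j))" by (auto simp: U_def)
    show "Cn (high (Suc j)) \<subseteq> \<phi> ` U"
    proof
      fix x assume x: "x \<in> Cn (high (Suc j))"
      then have "x \<in> Cn T" using Cn_mono[OF highT] by blast
      then have "\<psi> x \<in> U" "\<phi> (\<psi> x) = x" using x psi_in phi_psi by (simp_all add: U_def)
      then show "x \<in> \<phi> ` U" by (intro image_eqI[OF sym])
    qed
  qed
  have ker: "ker ?Q ?M = (\<lambda>x. W +> x) ` U"
    unfolding ker_induced[OF W NW] U_def using Nc_W by (intro image_cong) auto
  let ?R = "quotient_space (V\<lparr>carrier := U\<rparr>) W"
  have Qker: "?Q\<lparr>carrier := ker ?Q ?M\<rparr> = ?R"
  proof -
    have "set_add (V\<lparr>carrier := U\<rparr>) = set_add V" by (intro ext) (simp add: set_add_def')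
    then show ?thesis unfolding ker using carrier_quotient_sub[OF W NW, of U]
      by (simp add: quotient_space_def a_r_coset_def')
  qed
  have Uc: "U \<subseteq> carrier V" by (auto simp: U_def)
  have UG: "\<phi> ` U \<in> Gs T (card (high (Suc j)))" unfolding phiU by (rule Cn_Gs[OF _ highT]) simp
  note dU = dim_Gs[OF Uc UG]
  interpret UL: lin_inj "V\<lparr>carrier := U\<rparr>" \<phi> by (rule lin_inj_subspace[OF dU(1)])
  have WU: "W \<subseteq> U" using Wc bounds(2) Cn_mono[OF high_mono] by (auto simp: U_def)
  have sWU: "is_subspace W (V\<lparr>carrier := U\<rparr>)" using UL.subspace_iff[of W] WU L by simp
  have "has_dim (V\<lparr>carrier := U\<rparr>) (card (high (Suc j)))"
    using has_dim_subspace[OF has_dim_V dU(1)] dU(2) by simp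
  from has_dim_quotient[OF this sWU]
  have dR: "has_dim ?R (card (high (Suc j)) - i j)" using f(2) by simp
  have nil: "nil_index ?Q ?M = b - j"
    unfolding nil_index_def
  proof (rule Least_equality)
    have zero_iff: "is_zero_map ?Q (?M ^^ e) \<longleftrightarrow> Imc e \<subseteq> \<phi> ` W" for e
    proof -
      have z: "\<zero>\<^bsub>?Q\<^esub> = W +> \<zero>" by (simp add: quotient_space_def coset_zero[OF W])
      have "(?M ^^ e) (W +> x) = \<zero>\<^bsub>?Q\<^esub> \<longleftrightarrow> \<phi> ((N ^^ e) x) \<in> \<phi> ` W" if x: "x \<in> carrier V" for x
        unfolding z induced_pow_coset[OF W NW x] using coset_eq_iff[OF W _ zero_closed] N_pow[OF x, of e]
        by (simp add: phi_zero)
      then show ?thesis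
        unfolding is_zero_map_def carrier_quotient N_pow_image[symmetric] by auto
    qed
    have "b - (b - j) = j" using jb by simp
    then have "Imc (b - j) = Cn (low j)" using jb by (simp add: Imc_def)
    then show "0 < b - j \<and> is_zero_map ?Q (?M ^^ (b - j))" using bounds(1) jb zero_iff by simp
    fix k assume k: "0 < k \<and> is_zero_map ?Q (?M ^^ k)"
    show "b - j \<le> k"
    proof (rule ccontr)
      assume "\<not> b - j \<le> k"
      then have "Suc j \<le> b - k" by simp
      then have "i (Suc j) \<in> low (b - k)" by (auto simp: low_def)
      then have "unitv (i (Suc j)) \<in> Imc k" using k by (simp add: Imc_def unitv_Cn)
      then have "unitv (i (Suc j)) \<in> Cn (high j)" using k zero_iff bounds(2) by blast
      then show False using i_high[of "Suc j" j] jb n by (simp add: unitv_Cn)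
    qed
  qed
  define P where "P = im ?Q (?M ^^ (nil_index ?Q ?M - 1))"
  have "b - (b - j - 1) = Suc j" "b - j - 1 \<noteq> 0" using j by auto
  then have ImP: "Imc (b - j - 1) = Cn (low (Suc j))" by (simp only: Imc_def if_False)
  have P: "P = (\<lambda>y. W +> y) ` {y \<in> carrier V. \<phi> y \<in> Cn (low (Suc j))}"
    unfolding P_def nil im_induced[OF W NW] ImP ..
  obtain \<Phi> S1 where c1: "coords ?R \<Phi> S1" "card S1 = card (high (Suc j)) - i j" using dR by (auto simp: has_dim_def)
  interpret R: coords ?R \<Phi> S1 by (rule c1)
  define e where "e = \<psi> (unitv (i (Suc j)))"
  have iT: "i (Suc j) \<in> T" using i_pos[of "Suc j"] i_le_n[of "Suc j"] jb n by simp
  have e: "e \<in> carrier V" "\<phi> e = unitv (i (Suc j))"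
    using psi_in phi_psi iT by (auto simp: e_def unitv_Cn)
  have ih: "i (Suc j) \<in> high (Suc j)" using i_high[of "Suc j" "Suc j"] jb n by simp
  have eU: "e \<in> U" using e ih by (simp add: U_def unitv_Cn)
  have coset_sub: "W +>\<^bsub>V\<lparr>carrier := U\<rparr>\<^esub> x = W +> x" for x by (simp add: a_r_coset_def')
  have RC: "W +> x \<in> carrier ?R" if "x \<in> U" for x
    using that carrier_quotient_sub[OF W NW, of U] by blast
  have lowhigh: "low (Suc j) \<subseteq> high (Suc j)"
    using i_high[of _ "Suc j"] jb n by (auto simp: low_def)
  have smR: "c \<odot>\<^bsub>?R\<^esub> (W +> e) = W +> (c \<odot> e)" for c
    using UL.quotient_smult[OF sWU, of e c] eU unfolding coset_sub by simp
  have Psub: "P = (\<lambda>c. c \<odot>\<^bsub>?R\<^esub> (W +> e)) ` UNIV"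
  proof (intro equalityI subsetI)
    fix C assume "C \<in> P"
    then obtain y where y: "y \<in> carrier V" "\<phi> y \<in> Cn (low (Suc j))" "C = W +> y" unfolding P by auto
    let ?c = "\<phi> y (i (Suc j))"
    have "(\<lambda>a. \<phi> y a - ?c * unitv (i (Suc j)) a) \<in> \<phi> ` W" by (rule low_decompose[OF L bounds(1) y(2)])
    then have "C = W +> (?c \<odot> e)"
      unfolding y(3) coset_eq_iff[OF W y(1) smult_in[OF e(1)]] by (simp add: phi_smult[OF e(1)] e(2))
    then show "C \<in> (\<lambda>c. c \<odot>\<^bsub>?R\<^esub> (W +> e)) ` UNIV" unfolding smR by blast
  next
    fix C assume "C \<in> (\<lambda>c. c \<odot>\<^bsub>?R\<^esub> (W +> e)) ` UNIV"
    then obtain c where C: "C = W +> (c \<odot> e)" unfolding smR by auto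
    have "\<phi> (c \<odot> e) \<in> Cn (low (Suc j))"
      unfolding phi_smult[OF e(1)] e(2) by (rule lsub_scale[OF lsub_Cn]) (simp add: unitv_Cn low_Suc)
    then show "C \<in> P" unfolding P C using smult_in[OF e(1)] by blast
  qed
  have PR: "P \<subseteq> carrier ?R" unfolding Psub using R.smult_in[OF RC[OF eU]] by auto
  have PhiP: "\<Phi> ` P = sp {0::nat} (\<lambda>_. \<Phi> (W +> e))"
    unfolding Psub sp_def image_image R.phi_smult[OF RC[OF eU]] lc_def by (auto simp: image_iff)
  have "indep {0::nat} (\<lambda>_. \<Phi> (W +> e))"
    unfolding indep_def
  proof (intro allI impI ballI)
    fix c :: "nat \<Rightarrow> complex" and a :: nat
    assume z: "\<forall>d. lc {0} c (\<lambda>_. \<Phi> (W +> e)) d = 0" and a: "a \<in> {0}"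
    show "c a = 0"
    proof (rule ccontr)
      assume "c a \<noteq> 0"
      then have "\<Phi> (W +> e) = (\<lambda>_. 0)" using z a by (auto simp: lc_def)
      then have "\<Phi> (W +> e) = \<Phi> \<zero>\<^bsub>?R\<^esub>" by (simp add: R.phi_zero)
      then have "W +> e = \<zero>\<^bsub>?R\<^esub>" using inj_onD[OF R.inj] RC[OF eU] R.zero_closed by blast
      then have "W +> e = W +> \<zero>" by (simp add: quotient_space_def coset_zero[OF W])
      then have "unitv (i (Suc j)) \<in> \<phi> ` W"
        unfolding coset_eq_iff[OF W e(1) zero_closed] by (simp add: phi_zero e(2))
      then have "unitv (i (Suc j)) \<in> Cn (high j)" using bounds(2) by blast
      then show False using i_high[of "Suc j" j] jb n by (simp add: unitv_Cn)
    qed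
  qed
  then have PG: "\<Phi> ` P \<in> Gs S1 1"
    unfolding PhiP by (intro sp_Gs R.finS) (use R.phi_in[OF RC[OF eU]] in auto)
  note dP = R.dim_Gs[OF PR PG]
  have "has_dim (quotient_space ?R P) (card (high (Suc j)) - i j - 1)"
    using has_dim_quotient[OF dR dP(1)] dP(2) by simp
  moreover have "card (odd_index j) = card (high (Suc j)) - i j - 1"
  proof -
    have fin: "finite (odd_index j)" by (simp add: odd_index_def)
    have "i j < i (Suc j)" using strict[of j "Suc j"] jb n by simp
    then have "card ({1..i j} \<union> {i (Suc j)}) = Suc (i j)" by simp
    then have "card (high (Suc j)) = Suc (i j) + card (odd_index j)"
      using odd_index_decomp(1,2)[OF j] fin card_Un_disjoint[of "{1..i j} \<union> {i (Suc j)}" "odd_index j"] by simp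
    then show ?thesis by simp
  qed
  ultimately have "Gr (odd_index j) (odd_rank j) homeomorphic_space grassmannian (quotient_space ?R P) (odd_rank j)"
    by (intro has_dim_grassmannian) (auto simp: odd_index_def)
  moreover have "odd_base V N i F (Suc j) = grassmannian (quotient_space ?R P) (odd_rank j)"
    unfolding odd_base_def Let_def diff_Suc_1 W_def[symmetric] Qker P_def[symmetric] odd_rank_def ..
  ultimately show ?thesis by simp
qed

end

section \<open>The tower\<close>

context hook_space
begin

lemma homeomorphic_space_exists:
  fixes X :: "'x topology" and f :: "'x \<Rightarrow> 'y"
  assumes "inj_on f (topspace X)"
  shows "\<exists>Y :: 'y topology. X homeomorphic_space Y"
  using homeomorphic_space_pushforward[OF assms] by blast

text \<open>A subspace is encoded as a constant function, since the bases of the even steps and those of the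
  odd steps have to be topologies on one type.\<close>

lemma Gr_copy:
  assumes "D \<subseteq> T"
  shows "\<exists>B :: (nat \<Rightarrow> 'v set) topology. Gr D k homeomorphic_space B"
proof (rule homeomorphic_space_exists[where f = "\<lambda>W (_::nat). \<psi> ` W"])
  have finD: "finite D" by (rule finite_subset[OF assms]) simp
  show "inj_on (\<lambda>W (_::nat). \<psi> ` W) (topspace (Gr D k))"
    unfolding topspace_Gr[OF finD]
  proof (rule inj_onI)
    fix W W' assume W: "W \<in> Gs D k" "W' \<in> Gs D k" "(\<lambda>_::nat. \<psi> ` W) = (\<lambda>_. \<psi> ` W')"
    then have "W \<subseteq> Cn T" "W' \<subseteq> Cn T" using Cn_mono[OF assms] by (auto simp: Gs_def)
    moreover have "\<phi> ` \<psi> ` W = \<phi> ` \<psi> ` W'" using fun_cong[OF W(3)] by simp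
    ultimately show "W = W'" by (simp add: phi_psi_image)
  qed
qed

lemma Fl_copy:
  assumes "D \<subseteq> T"
  shows "\<exists>B :: (nat \<Rightarrow> 'v set) topology. Fl D homeomorphic_space B"
proof (rule homeomorphic_space_exists[where f = "\<lambda>F l. \<psi> ` F l"])
  have finD: "finite D" by (rule finite_subset[OF assms]) simp
  show "inj_on (\<lambda>F l. \<psi> ` F l) (topspace (Fl D))"
    unfolding topspace_Fl[OF finD]
  proof (rule inj_onI)
    fix F F' assume F: "F \<in> Fls D" "F' \<in> Fls D" "(\<lambda>l. \<psi> ` F l) = (\<lambda>l. \<psi> ` F' l)"
    show "F = F'"
    proof
      fix l
      show "F l = F' l"
      proof (cases "l \<le> card D")
        case True
        then have "F l \<in> Gs D l" "F' l \<in> Gs D l" using F(1,2) by (simp_all add: Fls_def)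
        then have "F l \<subseteq> Cn D" "F' l \<subseteq> Cn D" unfolding Gs_def by blast+
        then have "F l \<subseteq> Cn T" "F' l \<subseteq> Cn T" using Cn_mono[OF assms] by blast+
        moreover have "\<phi> ` \<psi> ` F l = \<phi> ` \<psi> ` F' l" using fun_cong[OF F(3), of l] by simp
        ultimately show ?thesis by (simp add: phi_psi_image)
      next
        case False
        then show ?thesis using F(1,2) by (auto simp: Fls_def extensional_def)
      qed
    qed
  qed
qed

text \<open>The spaces \<open>Zs 0, Ys 0, Zs 1, Ys 1, \<dots>, Zs (b - 1), Zs b\<close>, numbered from 1. The space \<open>Ys (b - 1)\<close> is
  omitted since it equals \<open>Zs (b - 1)\<close>, whence the last of the flag bundles directly follows another
  one.\<close>

definition tower :: "nat \<Rightarrow> (nat \<Rightarrow> cvec set) set"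
  where "tower m = (if m = 2 * b then Zs b else if odd m then Zs ((m - 1) div 2) else Ys (m div 2 - 1))"

definition towerV :: "nat \<Rightarrow> (nat \<Rightarrow> 'v set) topology"
  where "towerV m = subtopology (flag_variety V) (flag_of_coords ` tower m)"

lemma tower_sub: "tower m \<subseteq> Fls T"
  using Zs_sub Ys_sub by (auto simp: tower_def)

lemma towerV_homeo: "homeomorphic_maps (towerV m) (subtopology (Fl T) (tower m)) flag_to_coords flag_of_coords"
  unfolding towerV_def
proof (rule homeomorphic_maps_restrict[OF flag_variety_homeo])
  have s: "tower m \<subseteq> Fls T" by (rule tower_sub)
  have 1: "flag_of_coords ` tower m \<subseteq> flags V" using s flag_of_coords by auto
  have 2: "flag_to_coords ` flag_of_coords ` tower m = tower m"
    using s flag_to_of_coords by (force simp: image_image)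
  show "flag_to_coords ` (topspace (flag_variety V) \<inter> flag_of_coords ` tower m) = topspace (Fl T) \<inter> tower m"
    unfolding topspace_flag_variety topspace_Fl[OF finS] using 1 2 s by (simp add: inf_absorb2)
qed

lemma tower_first: "towerV 1 = component V N sh A"
  unfolding component_eq towerV_def tower_def KV_def using b1 Zs_0 by simp

lemma tower_last: "topspace (towerV (2 * b)) = {flag_of_coords Eflag}"
  unfolding towerV_def tower_def Zs_b topspace_subtopology topspace_flag_variety
  using flag_of_coords[OF Eflag_Fls] by auto

lemma odd_fiber_bundle:
  assumes j: "Suc j < b" and B: "Gr (odd_index j) (odd_rank j) homeomorphic_space B"
  shows "\<exists>p. fiber_bundle (towerV (2 * j + 1)) B (towerV (2 * j + 2)) p"
proof -
  have t: "tower (2 * j + 1) = Zs j" "tower (2 * j + 2) = Ys j" using j by (auto simp: tower_def)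
  obtain g g' where g: "homeomorphic_maps (Gr (odd_index j) (odd_rank j)) B g g'"
    using B unfolding homeomorphic_space_def by (elim exE)
  have "homeomorphic_maps (YX j) (towerV (2 * j + 2)) flag_of_coords flag_to_coords"
    by (rule iffD1[OF homeomorphic_maps_sym towerV_homeo[of "2 * j + 2", unfolded t]])
  from fiber_bundle_homeomorphic[OF odd_bundle[OF j] towerV_homeo[of "2 * j + 1", unfolded t] g this]
  show ?thesis by blast
qed

lemma even_fiber_bundle:
  assumes j: "j < b" and X: "tower m = Ys j" and X': "tower (Suc m) = Zs (Suc j)"
    and B: "Fl (even_index j) homeomorphic_space B"
  shows "\<exists>p. fiber_bundle (towerV m) B (towerV (Suc m)) p"
proof -
  obtain g g' where g: "homeomorphic_maps (Fl (even_index j)) B g g'"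
    using B unfolding homeomorphic_space_def by (elim exE)
  have "homeomorphic_maps (ZX (Suc j)) (towerV (Suc m)) flag_of_coords flag_to_coords"
    by (rule iffD1[OF homeomorphic_maps_sym towerV_homeo[of "Suc m", unfolded X']])
  from fiber_bundle_homeomorphic[OF even_bundle[OF j] towerV_homeo[of m, unfolded X] g this]
  show ?thesis by blast
qed

theorem component_tower:
  shows "topspace (component V N sh A) \<noteq> {} \<and>
    (\<exists>B :: nat \<Rightarrow> (nat \<Rightarrow> 'v set) topology.
       iterated_fiber_bundle (component V N sh A) (2 * b - 1) B \<and>
       (\<forall>F\<in>topspace (component V N sh A).
          (\<forall>j\<in>{1..b - 1}.
             B (2 * j - 1) homeomorphic_space odd_base V N i F j \<and>
             B (2 * j) homeomorphic_space even_base V i F j) \<and>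
          B (2 * b - 1) homeomorphic_space last_base V i F b))"
proof
  have "flag_of_coords Eflag \<in> KV" using Eflag_K by (simp add: KV_def)
  then show "topspace (component V N sh A) \<noteq> {}" unfolding topspace_component by blast
next
  have evT: "even_index j \<subseteq> T" if "j < b" for j
    using i_le_n[of "Suc j"] that by (auto simp: even_index_def)
  have odT: "odd_index j \<subseteq> T" for j by (auto simp: odd_index_def)
  have "\<forall>j. \<exists>B :: (nat \<Rightarrow> 'v set) topology. Gr (odd_index j) (odd_rank j) homeomorphic_space B"
    using Gr_copy[OF odT] by blast
  from choice[OF this] obtain Bo
    where Bo: "\<And>j. Gr (odd_index j) (odd_rank j) homeomorphic_space (Bo j :: (nat \<Rightarrow> 'v set) topology)" by blast
  have "\<forall>j. \<exists>B :: (nat \<Rightarrow> 'v set) topology. j < b \<longrightarrow> Fl (even_index j) homeomorphic_space B"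
    using Fl_copy[OF evT] by blast
  from choice[OF this] obtain Be
    where Be: "\<And>j. j < b \<Longrightarrow> Fl (even_index j) homeomorphic_space (Be j :: (nat \<Rightarrow> 'v set) topology)" by blast
  define B where "B m = (if m = 2 * b - 1 then Be (b - 1) else if odd m then Bo ((m - 1) div 2) else Be (m div 2 - 1))"
    for m
  have Bodd: "B (2 * j + 1) = Bo j" if "Suc j < b" for j
    using that by (auto simp: B_def)
  have Beven: "B (2 * j + 2) = Be j" for j
  proof -
    have "2 * j + 2 \<noteq> 2 * b - 1" using b1 by presburger
    then show ?thesis by (simp add: B_def)
  qed
  have Blast: "B (2 * b - 1) = Be (b - 1)" by (simp add: B_def)
  have each: "\<exists>p. fiber_bundle (towerV m) (B m) (towerV (Suc m)) p" if m: "m \<in> {1..2 * b - 1}" for m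
  proof -
    consider "m = 2 * b - 1" | j where "m = 2 * j + 1" "Suc j < b" | j where "m = 2 * j + 2" "Suc j < b"
    proof (cases "odd m")
      case True
      then obtain j where "m = 2 * j + 1" by (rule oddE)
      then show thesis using that m by (cases "Suc j < b") auto
    next
      case False
      then obtain k where k: "m = 2 * k" by auto
      then obtain j where "k = Suc j" using m by (cases k) auto
      then show thesis using that(3)[of j] m k by auto
    qed
    then show ?thesis
    proof cases
      case 1
      have b: "Suc (b - 1) = b" "b - 1 < b" using b1 by auto
      have m': "m = 2 * (b - 1) + 1" "Suc m = 2 * b" "m \<noteq> 2 * b" using 1 b1 by auto
      have "tower m = Ys (b - 1)" unfolding Ys_last using m'(3) by (simp add: tower_def m'(1))
      moreover have "tower (Suc m) = Zs (Suc (b - 1))" unfolding m'(2) b by (simp add: tower_def)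
      ultimately show ?thesis
        using even_fiber_bundle[OF b(2) _ _ Be[OF b(2)], of m] by (simp only: 1 Blast)
    next
      case 2
      show ?thesis using odd_fiber_bundle[OF 2(2) Bo] unfolding 2(1) Bodd[OF 2(2)] by simp
    next
      case 3
      then have "tower m = Ys j" by (auto simp: tower_def)
      moreover have "tower (Suc m) = Zs (Suc j)"
      proof -
        have "odd (Suc m)" "Suc m \<noteq> 2 * b" "(Suc m - 1) div 2 = Suc j" using 3 by auto
        then show ?thesis by (simp add: tower_def)
      qed
      moreover have "j < b" using 3 by simp
      moreover have "B m = Be j" using Beven[of j] 3(1) by simp
      ultimately show ?thesis
        using even_fiber_bundle[of j m "Be j"] Be[of j] by simp
    qed
  qed
  then have "\<forall>m. \<exists>p. m \<in> {1..2 * b - 1} \<longrightarrow> fiber_bundle (towerV m) (B m) (towerV (Suc m)) p" by blast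
  from choice[OF this] obtain p
    where p: "\<And>m. m \<in> {1..2 * b - 1} \<Longrightarrow> fiber_bundle (towerV m) (B m) (towerV (Suc m)) (p m)" by blast
  have "Suc (2 * b - 1) = 2 * b" using b1 by simp
  then have "iterated_fiber_bundle (component V N sh A) (2 * b - 1) B"
    unfolding iterated_fiber_bundle_def using p tower_first tower_last
    by (intro exI[of _ towerV] exI[of _ p]) auto
  moreover have "(\<forall>j\<in>{1..b - 1}.
        B (2 * j - 1) homeomorphic_space odd_base V N i F j \<and>
        B (2 * j) homeomorphic_space even_base V i F j) \<and>
      B (2 * b - 1) homeomorphic_space last_base V i F b"
    if "F \<in> topspace (component V N sh A)" for F
  proof (intro conjI ballI)
    have FK: "F \<in> KV" and F: "F \<in> flags V" using that by (auto simp: topspace_component KV_iff)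
    have b: "b - 1 < b" using b1 by simp
    show "B (2 * b - 1) homeomorphic_space last_base V i F b"
      unfolding Blast using Be[OF b] last_base_homeomorphic[OF F]
      by (rule homeomorphic_space_trans[OF iffD1[OF homeomorphic_space_sym]])
    fix j assume j: "j \<in> {1..b - 1}"
    then obtain k where k: "j = Suc k" by (cases j) auto
    then have kb: "Suc k < b" "k < b" using j by auto
    have "2 * Suc k - 1 = 2 * k + 1" "2 * Suc k = 2 * k + 2" by auto
    then have Bj: "B (2 * Suc k - 1) = Bo k" "B (2 * Suc k) = Be k" using Bodd[OF kb(1)] Beven[of k] by metis+
    show "B (2 * j - 1) homeomorphic_space odd_base V N i F j"
      unfolding k Bj using Bo[of k] odd_base_homeomorphic[OF FK kb(1)]
      by (rule homeomorphic_space_trans[OF iffD1[OF homeomorphic_space_sym]])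
    show "B (2 * j) homeomorphic_space even_base V i F j"
      unfolding k Bj using Be[OF kb(2)] even_base_homeomorphic[OF F kb(2)]
      by (rule homeomorphic_space_trans[OF iffD1[OF homeomorphic_space_sym]])
  qed
  ultimately show "\<exists>B :: nat \<Rightarrow> (nat \<Rightarrow> 'v set) topology.
       iterated_fiber_bundle (component V N sh A) (2 * b - 1) B \<and>
       (\<forall>F\<in>topspace (component V N sh A).
          (\<forall>j\<in>{1..b - 1}.
             B (2 * j - 1) homeomorphic_space odd_base V N i F j \<and>
             B (2 * j) homeomorphic_space even_base V i F j) \<and>
          B (2 * b - 1) homeomorphic_space last_base V i F b)" by blast
qed

end

section \<open>From a tableau to coordinates\<close>

lemma hook_rows:
  assumes "hook_shape sh" "sorted_wrt (\<ge>) sh" "\<forall>s\<in>set sh. 0 < s" "1 \<le> r" "r < length sh"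
  shows "sh ! r = 1"
proof (rule ccontr)
  assume "sh ! r \<noteq> 1"
  moreover have "0 < sh ! r" using assms(3,5) by simp
  ultimately have r1: "1 < sh ! r" by simp
  have "sh ! r \<le> sh ! 0" using sorted_wrt_nth_less[OF assms(2), of 0 r] assms(4,5) by simp
  then have "{0, r} \<subseteq> {r. r < length sh \<and> 1 < sh ! r}" using r1 assms(5) by auto
  then have "card {0, r} \<le> card {r. r < length sh \<and> 1 < sh ! r}" by (intro card_mono) auto
  moreover have "card {0, r} = 2" using assms(4) by simp
  ultimately show False using assms(1) by (simp add: hook_shape_def)
qed

locale hook_tableau =
  fixes V :: "'v cvs" and N :: "'v \<Rightarrow> 'v" and sh :: "nat list"
    and A :: "nat \<times> nat \<Rightarrow> nat" and i :: "nat \<Rightarrow> nat" and n b :: nat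
  assumes vs: "vectorspace class_ring V"
    and dim: "cvs_dim V = n"
    and nil: "nilpotent_map V N"
    and young: "young_shape V N sh"
    and hook: "hook_shape sh"
    and tab: "standard_tableau sh A"
    and b: "b = nil_index V N"
    and i0: "i 0 = 0" and ib: "i b = n"
    and top_row: "\<forall>c\<in>{1..b}. A (1, c) = i (b + 1 - c)"
begin

text \<open>The boxes with rows and columns numbered from 0, as in the Jordan basis \<open>N\<^sup>k v\<^sub>r\<close>.\<close>

definition P :: "(nat \<times> nat) set" where "P = (SIGMA r:{..<length sh}. {..<sh ! r})"
definition label :: "nat \<times> nat \<Rightarrow> nat" where "label = (\<lambda>(r, k). A (Suc r, Suc k))"

lemma shape: "sorted_wrt (\<ge>) sh" "\<forall>s\<in>set sh. 0 < s"
  using young by (auto simp: young_shape_def)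

lemma boxes_P: "boxes sh = (\<lambda>(r, k). (Suc r, Suc k)) ` P"
proof (intro equalityI subsetI)
  fix p assume "p \<in> boxes sh"
  then obtain r c where p: "p = (r, c)" "1 \<le> r" "r \<le> length sh" "1 \<le> c" "c \<le> sh ! (r - 1)"
    by (auto simp: boxes_def)
  then have "(r - 1, c - 1) \<in> P" "p = (\<lambda>(r, k). (Suc r, Suc k)) (r - 1, c - 1)" by (auto simp: P_def)
  then show "p \<in> (\<lambda>(r, k). (Suc r, Suc k)) ` P" by blast
qed (auto simp: P_def boxes_def)

lemma label_bij: "bij_betw label P {1..sum_list sh}"
proof -
  have "bij_betw (\<lambda>(r, k). (Suc r, Suc k)) P (boxes sh)"
    unfolding boxes_P by (rule inj_on_imp_bij_betw) (auto simp: inj_on_def)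
  moreover have "bij_betw A (boxes sh) {1..sum_list sh}" using tab by (simp add: standard_tableau_def)
  ultimately have "bij_betw (A \<circ> (\<lambda>(r, k). (Suc r, Suc k))) P {1..sum_list sh}" by (rule bij_betw_trans)
  moreover have "A \<circ> (\<lambda>(r, k). (Suc r, Suc k)) = label" by (auto simp: label_def)
  ultimately show ?thesis by simp
qed

text \<open>The basis vector \<open>N\<^sup>k v\<^sub>r\<close> is numbered by the entry of its box.\<close>

lemma adapted_coordinates:
  obtains v \<phi> where "\<And>r. r < length sh \<Longrightarrow> v r \<in> carrier V"
    "\<And>r. r < length sh \<Longrightarrow> (N ^^ (sh ! r)) (v r) = \<zero>\<^bsub>V\<^esub>"
    "coords V \<phi> {1..n}" "\<And>r k. (r, k) \<in> P \<Longrightarrow> \<phi> ((N ^^ k) (v r)) = unitv (label (r, k))" "n = sum_list sh"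
proof -
  interpret vectorspace "class_ring :: complex ring" V by (rule vs)
  obtain v where v: "\<And>r. r < length sh \<Longrightarrow> v r \<in> carrier V \<and> (N ^^ (sh ! r)) (v r) = \<zero>\<^bsub>V\<^esub>"
    and inj: "inj_on (\<lambda>(r, k). (N ^^ k) (v r)) P"
    and basis: "basis ((\<lambda>(r, k). (N ^^ k) (v r)) ` P)"
    using young unfolding young_shape_def P_def by blast
  let ?f = "\<lambda>(r, k). (N ^^ k) (v r)"
  let ?x = "?f \<circ> inv_into P label"
  have finP: "finite P" by (simp add: P_def)
  have cardP: "card P = sum_list sh" using bij_betw_same_card[OF label_bij] by simp
  have "local.dim = card (?f ` P)" by (rule dim_basis) (use finP basis in auto)
  then have n: "n = sum_list sh" using dim card_image[OF inj] cardP by simp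
  have bi: "bij_betw (inv_into P label) {1..n} P" using bij_betw_inv_into[OF label_bij] n by simp
  have im: "?x ` {1..n} = ?f ` P" by (simp only: image_comp[symmetric] bij_betw_imp_surj_on[OF bi])
  have xi: "inj_on ?x {1..n}" using bi inj by (simp add: comp_inj_on bij_betw_def)
  obtain \<phi> where c: "coords V \<phi> {1..n}" and ph: "\<forall>a\<in>{1..n}. \<phi> (?x a) = unitv a"
    using coords_of_basis[OF vs _ xi] im basis by auto
  have "\<phi> ((N ^^ k) (v r)) = unitv (label (r, k))" if p: "(r, k) \<in> P" for r k
  proof -
    have "label (r, k) \<in> {1..n}" using bij_betwE[OF label_bij] p n by auto
    moreover have "inv_into P label (label (r, k)) = (r, k)"
      using label_bij p by (simp add: bij_betw_def)
    ultimately show ?thesis using ph by (force simp: comp_def)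
  qed
  then show thesis using that[of v \<phi>] v c n by blast
qed

lemma label_top: "k < b \<Longrightarrow> label (0, k) = i (b - k)"
  using top_row[rule_format, of "Suc k"] by (simp add: label_def One_nat_def)

lemma hook_space_exists:
  obtains \<phi> where "hook_space V \<phi> n b i sh A N"
proof -
  obtain v \<phi> where v: "\<And>r. r < length sh \<Longrightarrow> v r \<in> carrier V"
    and vz: "\<And>r. r < length sh \<Longrightarrow> (N ^^ (sh ! r)) (v r) = \<zero>\<^bsub>V\<^esub>"
    and c: "coords V \<phi> {1..n}"
    and ph: "\<And>r k. (r, k) \<in> P \<Longrightarrow> \<phi> ((N ^^ k) (v r)) = unitv (label (r, k))"
    and ns: "n = sum_list sh" by (rule adapted_coordinates) blast
  interpret coords V \<phi> "{1..n}" by (rule c)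
  have lin: "linear_map class_ring V V N" using nil by (simp add: nilpotent_map_def)
  then have mh: "mod_hom class_ring V V N" by (simp add: linear_map_def)
  have Nin: "N x \<in> carrier V" if "x \<in> carrier V" for x
    using mod_hom.f_im[OF mh that] .
  have Nadd: "N (x \<oplus>\<^bsub>V\<^esub> y) = N x \<oplus>\<^bsub>V\<^esub> N y" if "x \<in> carrier V" "y \<in> carrier V" for x y
    using module_hom_add[OF mod_hom.f_hom[OF mh] that] .
  have Nsm: "N (k \<odot>\<^bsub>V\<^esub> x) = k \<odot>\<^bsub>V\<^esub> N x" if "x \<in> carrier V" for k x
    using module_hom_smult[OF mod_hom.f_hom[OF mh] _ that, of k] by (simp add: class_ring_simps)
  have N0: "N \<zero>\<^bsub>V\<^esub> = \<zero>\<^bsub>V\<^esub>" using mod_hom.f0_is_0[OF mh] .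
  have pin: "(N ^^ e) x \<in> carrier V" if "x \<in> carrier V" for e x
    by (induction e) (use that Nin in auto)
  have padd: "(N ^^ e) (x \<oplus>\<^bsub>V\<^esub> y) = (N ^^ e) x \<oplus>\<^bsub>V\<^esub> (N ^^ e) y" if "x \<in> carrier V" "y \<in> carrier V" for e x y
    by (induction e) (use that Nadd pin in auto)
  have psm: "(N ^^ e) (k \<odot>\<^bsub>V\<^esub> x) = k \<odot>\<^bsub>V\<^esub> (N ^^ e) x" if "x \<in> carrier V" for e k x
    by (induction e) (use that Nsm pin in auto)
  have p0: "(N ^^ e) \<zero>\<^bsub>V\<^esub> = \<zero>\<^bsub>V\<^esub>" for e by (induction e) (use N0 in auto)
  have fn: "(\<lambda>x. \<phi> ((N ^^ e) x) d) \<in> linear_functionals V" for e d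
    unfolding linear_functionals_def by (simp add: padd psm pin phi_add phi_smult)
  have expand: "\<phi> ((N ^^ e) x) d = (\<Sum>a\<in>{1..n}. \<phi> x a * \<phi> ((N ^^ e) (\<psi> (unitv a))) d)"
    if "x \<in> carrier V" for e x d
    by (rule functional_expand[OF fn that])
  have lab: "label p \<in> {1..n}" if "p \<in> P" for p
    using bij_betwE[OF label_bij] that ns by auto
  have lab_ex: "\<exists>r k. (r, k) \<in> P \<and> a = label (r, k)" if "a \<in> {1..n}" for a
  proof -
    have "a \<in> label ` P" using bij_betw_imp_surj_on[OF label_bij] that ns by simp
    then obtain p where "p \<in> P" "a = label p" by (rule imageE)
    then show ?thesis by (cases p) auto
  qed
  have psi_label: "\<psi> (unitv (label (r, k))) = (N ^^ k) (v r)" if p: "(r, k) \<in> P" for r k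
  proof -
    have "(N ^^ k) (v r) \<in> carrier V" by (rule pin, rule v) (use p in \<open>simp add: P_def\<close>)
    from psi_phi[OF this] show ?thesis by (simp add: ph[OF p])
  qed
  have rows: "sh ! r = 1" if "1 \<le> r" "r < length sh" for r
    by (rule hook_rows[OF hook shape that])
  have pow_zero: "(N ^^ e) (v r) = \<zero>\<^bsub>V\<^esub>" if "r < length sh" "sh ! r \<le> e" for e r
  proof -
    have "(N ^^ e) (v r) = (N ^^ (e - sh ! r + sh ! r)) (v r)" using that by simp
    also have "\<dots> = (N ^^ (e - sh ! r)) ((N ^^ (sh ! r)) (v r))" by (simp only: funpow_add comp_apply)
    finally show ?thesis by (simp add: vz[OF that(1)] p0)
  qed
  have bval: "0 < n \<Longrightarrow> 0 < length sh \<and> b = sh ! 0" and b_zero: "n = 0 \<Longrightarrow> b = 1"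
  proof -
    assume n: "0 < n"
    then have len: "0 < length sh" using ns by (cases sh) auto
    have s0: "0 < sh ! 0" using shape(2) len by simp
    have max: "sh ! r \<le> sh ! 0" if "r < length sh" for r
      using sorted_wrt_nth_less[OF shape(1), of 0 r] that by (cases "r = 0") auto
    have "(N ^^ (sh ! 0)) x = \<zero>\<^bsub>V\<^esub>" if x: "x \<in> carrier V" for x
    proof -
      have "\<phi> ((N ^^ (sh ! 0)) (\<psi> (unitv a))) d = 0" if a: "a \<in> {1..n}" for a d
      proof -
        obtain r k where p: "(r, k) \<in> P" "a = label (r, k)" using lab_ex[OF a] by blast
        then have r: "r < length sh" by (simp add: P_def)
        have "(N ^^ (sh ! 0)) (\<psi> (unitv a)) = (N ^^ (sh ! 0 + k)) (v r)"
          by (simp add: p(2) psi_label[OF p(1)] funpow_add)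
        also have "\<dots> = \<zero>\<^bsub>V\<^esub>" by (rule pow_zero[OF r]) (use max[OF r] in simp)
        finally show ?thesis by (simp add: phi_zero)
      qed
      then have "\<phi> ((N ^^ (sh ! 0)) x) d = 0" for d unfolding expand[OF x] by simp
      then have "\<phi> ((N ^^ (sh ! 0)) x) = \<phi> \<zero>\<^bsub>V\<^esub>" unfolding phi_zero by (rule ext)
      then show ?thesis using inj_onD[OF inj] pin[OF x] by blast
    qed
    then have "is_zero_map V (N ^^ (sh ! 0))" by (simp add: is_zero_map_def)
    moreover have "\<not> is_zero_map V (N ^^ k)" if "k < sh ! 0" for k
    proof
      assume z: "is_zero_map V (N ^^ k)"
      have p: "(0, k) \<in> P" using that len by (simp add: P_def)
      have "(N ^^ k) (v 0) = \<zero>\<^bsub>V\<^esub>" using z v[OF len] by (simp add: is_zero_map_def)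
      then have "unitv (label (0, k)) = (\<lambda>_. 0)" using ph[OF p] phi_zero by simp
      from fun_cong[OF this, of "label (0, k)"] show False by (simp add: unitv_def)
    qed
    ultimately have "nil_index V N = sh ! 0"
      unfolding nil_index_def using s0 by (intro Least_equality) (auto simp: not_less[symmetric])
    then show "0 < length sh \<and> b = sh ! 0" using b len by simp
  next
    assume n: "n = 0"
    have "N x = \<zero>\<^bsub>V\<^esub>" if x: "x \<in> carrier V" for x
    proof -
      have "\<phi> (N x) = \<phi> \<zero>\<^bsub>V\<^esub>" using phi_in[OF Nin[OF x]] n by (auto simp: Cn_def phi_zero)
      then show ?thesis using inj_onD[OF inj] Nin[OF x] by blast
    qed
    then have "is_zero_map V (N ^^ 1)" by (simp add: is_zero_map_def One_nat_def)
    then have "nil_index V N = 1" unfolding nil_index_def by (intro Least_equality) auto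
    then show "b = 1" using b by simp
  qed
  have b1: "1 \<le> b"
  proof (cases "0 < n")
    case True
    then have "0 < length sh" "b = sh ! 0" using bval by auto
    then have "0 < b" using shape(2) by simp
    then show ?thesis by simp
  qed (use b_zero in simp)
  have topP: "(0, k) \<in> P \<longleftrightarrow> k < b" if "0 < n" for k
    using bval[OF that] by (auto simp: P_def)
  have box: "(1, k) \<in> boxes sh" if "1 \<le> k" "k \<le> b" "0 < n" for k
    using bval[OF that(3)] that by (cases sh) (auto simp: boxes_def One_nat_def)
  have step: "i j < i (Suc j)" if j: "j < b" and n: "0 < n" for j
  proof (cases "j = 0")
    case True
    have "label (0, b - 1) \<in> {1..n}" by (rule lab) (use topP[OF n] b1 in simp)
    then show ?thesis using label_top[of "b - 1"] b1 True i0 by (simp add: One_nat_def)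
  next
    case False
    have "A (1, b + 1 - j) < A (1, b - j)"
    proof -
      have "\<forall>r c c'. (r, c) \<in> boxes sh \<and> (r, c') \<in> boxes sh \<and> c < c' \<longrightarrow> A (r, c') < A (r, c)"
        using tab by (simp add: standard_tableau_def)
      moreover have "(1, b - j) \<in> boxes sh" "(1, b + 1 - j) \<in> boxes sh" "b - j < b + 1 - j"
        using j False n by (auto intro!: box)
      ultimately show ?thesis by blast
    qed
    moreover have "A (1, b + 1 - j) = i j" "A (1, b - j) = i (Suc j)"
    proof -
      have m: "b + 1 - j \<in> {1..b}" "b - j \<in> {1..b}" using j False by auto
      have "b + 1 - (b + 1 - j) = j" "b + 1 - (b - j) = Suc j" using j by auto
      then show "A (1, b + 1 - j) = i j" "A (1, b - j) = i (Suc j)"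
        using top_row[rule_format, OF m(1)] top_row[rule_format, OF m(2)] by (simp_all only:)
    qed
    ultimately show ?thesis by simp
  qed
  have hd: "hook_data n b i"
    by unfold_locales (use b1 i0 ib step b_zero in auto)
  interpret hook_data n b i by (rule hd)
  have col: "column_of sh A (label (r, k)) = Suc k" if p: "(r, k) \<in> P" for r k
    unfolding column_of_def
  proof (rule the_equality)
    show "\<exists>r'. (r', Suc k) \<in> boxes sh \<and> A (r', Suc k) = label (r, k)"
      using p by (intro exI[of _ "Suc r"]) (auto simp: boxes_P label_def)
    fix c assume "\<exists>r'. (r', c) \<in> boxes sh \<and> A (r', c) = label (r, k)"
    then obtain r' k' where k': "(r', k') \<in> P" "c = Suc k'" "label (r', k') = label (r, k)"
      by (auto simp: boxes_P label_def)
    have "(r', k') = (r, k)" by (rule inj_onD[OF bij_betw_imp_inj_on[OF label_bij] k'(3,1) p])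
    then show "c = Suc k" using k'(2) by simp
  qed
  have hc: "hook_columns n b i (column_of sh A)"
  proof (intro hook_columns.intro hook_columns_axioms.intro hd)
    fix j assume n: "0 < n" and j: "1 \<le> j" "j \<le> b"
    then have "b - j < b" "b - (b - j) = j" "Suc (b - j) = b + 1 - j" by auto
    then show "column_of sh A (i j) = b + 1 - j"
      using col[of 0 "b - j"] topP[OF n] label_top[of "b - j"] by simp
  next
    fix l assume l: "l \<in> {1..n}" "l \<notin> i ` {1..b}"
    then have n: "0 < n" by auto
    obtain r k where p: "(r, k) \<in> P" "l = label (r, k)" using lab_ex[OF l(1)] by blast
    have "r \<noteq> 0"
    proof
      assume "r = 0"
      then have "k < b" using p(1) topP[OF n] by simp
      then have "l = i (b - k)" "b - k \<in> {1..b}" using label_top p(2) \<open>r = 0\<close> by auto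
      then show False using l(2) by blast
    qed
    moreover have "r < length sh" "k < sh ! r" using p(1) by (auto simp: P_def)
    ultimately have "k = 0" using rows[of r] by auto
    then show "column_of sh A l = 1" using col[OF p(1)] p(2) by (simp add: One_nat_def)
  qed
  \<comment> \<open>By linearity it suffices to evaluate N on the basis. Only the vectors in the top row other than
  the last one have a nonzero image, as the other rows have length one.\<close>
  have shift: "\<phi> (N x) = Nc (\<phi> x)" if x: "x \<in> carrier V" for x
  proof
    fix d
    let ?g = "\<lambda>a. \<phi> (N (\<psi> (unitv a)))"
    let ?M = "(\<lambda>m. i (Suc m)) ` {1..<b}"
    have g1: "?g (i (Suc m)) = unitv (i m)" if m: "m \<in> {1..<b}" for m
    proof -
      have n: "0 < n" using pos_n m by auto
      define k where "k = b - Suc m"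
      have k: "k < b" "Suc k < b" "b - k = Suc m" "b - Suc k = m" using m by (auto simp: k_def)
      have p: "(0, k) \<in> P" "(0, Suc k) \<in> P" using topP[OF n] k by auto
      have "\<psi> (unitv (i (Suc m))) = (N ^^ k) (v 0)"
        using psi_label[OF p(1)] label_top[OF k(1)] k(3) by simp
      then have "?g (i (Suc m)) = \<phi> ((N ^^ Suc k) (v 0))" by simp
      also have "\<dots> = unitv (i m)" using ph[OF p(2)] label_top[OF k(2)] k(4) by simp
      finally show ?thesis .
    qed
    have g0: "?g a = (\<lambda>_. 0)" if a: "a \<in> {1..n} - ?M" for a
    proof -
      have n: "0 < n" using a by auto
      obtain r k where p: "(r, k) \<in> P" "a = label (r, k)" using lab_ex a by blast
      have r: "r < length sh" "k < sh ! r" using p(1) by (auto simp: P_def)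
      have "sh ! r \<le> Suc k"
      proof (cases "r = 0")
        case True
        have kb: "k < b" using p(1) True topP[OF n] by simp
        have "\<not> Suc k < b"
        proof
          assume lt: "Suc k < b"
          then have "b - Suc k \<in> {1..<b}" "Suc (b - Suc k) = b - k" by auto
          moreover have "a = i (b - k)" using p(2) label_top[OF kb] True by simp
          ultimately have "a \<in> ?M" by (metis (no_types, lifting) imageI)
          then show False using a by simp
        qed
        then show ?thesis using bval[OF n] True by simp
      next
        case False
        then show ?thesis using rows[of r] r by simp
      qed
      then have "(N ^^ Suc k) (v r) = \<zero>\<^bsub>V\<^esub>" by (rule pow_zero[OF r(1)])
      then show ?thesis by (simp add: p(2) psi_label[OF p(1)] phi_zero)
    qed
    have Msub: "?M \<subseteq> {1..n}"
    proof
      fix a assume "a \<in> ?M"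
      then obtain m where "m \<in> {1..<b}" "a = i (Suc m)" by blast
      then show "a \<in> {1..n}" using i_pos[of "Suc m"] i_le_n[of "Suc m"] pos_n by auto
    qed
    have Minj: "inj_on (\<lambda>m. i (Suc m)) {1..<b}"
    proof (rule inj_onI)
      fix m m' assume "m \<in> {1..<b}" "m' \<in> {1..<b}" "i (Suc m) = i (Suc m')"
      then show "m = m'" using i_eq[of "Suc m" "Suc m'"] pos_n by auto
    qed
    have "\<phi> (N x) d = (\<Sum>a\<in>{1..n}. \<phi> x a * ?g a d)" using expand[OF x, of 1 d] by (simp add: One_nat_def)
    also have "\<dots> = (\<Sum>a\<in>?M. \<phi> x a * ?g a d)"
      by (rule sum.mono_neutral_right) (use Msub g0 in auto)
    also have "\<dots> = (\<Sum>m\<in>{1..<b}. \<phi> x (i (Suc m)) * ?g (i (Suc m)) d)"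
      by (simp only: sum.reindex[OF Minj] comp_def)
    also have "\<dots> = Nc (\<phi> x) d"
      unfolding Nc_def by (rule sum.cong) (use g1 in auto)
    finally show "\<phi> (N x) d = Nc (\<phi> x) d" .
  qed
  have "hook_space V \<phi> n b i sh A N"
    by (intro hook_space.intro hook_space_axioms.intro c hc Nin shift)
  then show thesis by (rule that)
qed

end

theorem theorem3p1:
  fixes V :: "'v cvs" and N :: "'v \<Rightarrow> 'v" and sh :: "nat list"
    and A :: "nat \<times> nat \<Rightarrow> nat" and i :: "nat \<Rightarrow> nat" and n b :: nat
  assumes "vectorspace class_ring V"
    and "vectorspace.fin_dim class_ring V"
    and "cvs_dim V = n"
    and "nilpotent_map V N"
    and "young_shape V N sh"
    and "hook_shape sh"
    and "standard_tableau sh A"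
    and "b = nil_index V N"
    and "i 0 = 0" and "i b = n"
    and "\<forall>c\<in>{1..b}. A (1, c) = i (b + 1 - c)"
  shows "topspace (component V N sh A) \<noteq> {} \<and>
    (\<exists>B :: nat \<Rightarrow> (nat \<Rightarrow> 'v set) topology.
       iterated_fiber_bundle (component V N sh A) (2 * b - 1) B \<and>
       (\<forall>F\<in>topspace (component V N sh A).
          (\<forall>j\<in>{1..b - 1}.
             B (2 * j - 1) homeomorphic_space odd_base V N i F j \<and>
             B (2 * j) homeomorphic_space even_base V i F j) \<and>
          B (2 * b - 1) homeomorphic_space last_base V i F b))"
proof -
  interpret hook_tableau V N sh A i n b
    by (rule hook_tableau.intro) (fact assms)+
  obtain \<phi> where "hook_space V \<phi> n b i sh A N" by (rule hook_space_exists)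
  then show ?thesis by (rule hook_space.component_tower)
qed

end
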